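(* Use the notation of the context (fixed isentropic equation of state satisfying the non-degeneracy condition). Let $\mathring\varphi$ be an admissible seed profile satisfying the amplitude smallness assumption, let $\mathring{\mathcal R}_{(+)}:=\mathfrak A^{-1}[\mathring\varphi]$ be the corresponding initial data, and let $\mathcal R_{(+)}$ be the corresponding solution of $L\mathcal R_{(+)}=0$ (with $\mathcal R_{(-)}\equiv 0$). Then there exists a constant $U_\ast\in(0,1)$, depending only on the seed profile, such that all of the following hold (where $\mathcal O_{\rm pos}$ is as in the context). **A. Classical existence in geometric coordinates $(t,U)$.** (A1) $\mathcal R_{(+)}(t,U)=\mathring{\mathcal R}_{(+)}(U)$; in particular it is a smooth function of $U$ alone. (A2) $\mathcal R_{(+)}$, the null vectorfields $L$ and $\breve{\underline L}$, the vectorfield $\breve X$ and the inverse foliation density $\mu$ exist classically on all of $\mathbb R_t\times\mathbb R_U$. (A3) On $\{(t,U)\in\mathbb R^2: U\notin[-U_1,U_2]\}$: $\mathcal R_{(+)}=0$, $Lx^1=\overline c$, $\underline L x^1=-\overline c$ and $\mu=1/\overline c$, where $\overline c=c(\overline H)>0$. (A4) $L\mu(t,U)=-\mathcal O_{\rm pos}(1)\,\mathring\delta_*$ for $(t,U)\in\mathbb R\times[-U_\ast,U_\ast]$; in particular this holds on the closure $\overline{\mathcal M_*}$. **B. Description of the maximal globally hyperbolic development in geometric coordinates.** (B1) $\overline{\mathcal M_*}=\mathcal M_*\sqcup\mathcal B_{[-U_\ast,0]}$ (disjoint union). (B2) The crease is a single point: $\partial_-\mathcal B=\{(T_{\rm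 Shock},0)\}$. (B3) For $U\in[-U_\ast,0]$: $\frac{d}{dU}\mathfrak t_{\rm Sing}(U)=\mathcal O_{\rm pos}(1)\,U$ and $\mathfrak t_{\rm Sing}(U)=T_{\rm Shock}+\mathcal O_{\rm pos}(1)\,U^2$. (B4) For $U\in[-U_\ast,0]$: $\frac{d}{dU}\,x^1(\mathfrak t_{\rm Sing}(U),U)=\mathcal O_{\rm pos}(1)\,U$. (B5) The initial value problem defining the integral curve $\breve{\underline\gamma}$ of $\frac12\breve{\underline L}$ with $\breve{\underline\gamma}(0)=(T_{\rm Shock},0)$ has a unique solution for $U\in[0,U_\ast]$, so that $\underline{\mathcal C}_{[0,U_\ast]}=\{(\mathfrak t_{\rm CH}(U),U): U\in[0,U_\ast]\}$. Moreover, for $U\in[0,U_\ast]$: $\frac{d}{dU}\mathfrak t_{\rm CH}(U)=\mathcal O_{\rm pos}(1)\,U^2$ and $\mathfrak t_{\rm CH}(U)=T_{\rm Shock}+\mathcal O_{\rm pos}(1)\,U^3$. (B6) For $U\in[0,U_\ast]$: $\mu(\mathfrak t_{\rm CH}(U),U)=\mathcal O_{\rm pos}(1)\,U^2$. (B7) For $U\in[0,U_\ast]$: $\frac{d}{dU}\,x^1(\mathfrak t_{\rm CH}(U),U)=-\mathcal O_{\rm pos}(1)\,U^2$. (B8) $\mu>0$ on $\mathcal M_*$ and $\mu=0$ on $\mathcal B_{[-U_\ast,0]}$. In particular $\mu>0$ on $\underline{\mathcal C}_{(0,U_\ast]}$, while $\mu=0$ at the crease $\partial_-\mathcal B\subset\underline{\mathcal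 C}_{[0,U_\ast]}$. **C. Singularity formation and description in Minkowski-rectangular coordinates $(t,x^1)$.** (C1) The map $\Upsilon(t,U)=(t,x^1)$ is a diffeomorphism from $\mathcal M_*$ onto its image and a homeomorphism from $\overline{\mathcal M_*}$ onto its image. (C2) $\mathcal R_{(+)}$ exists classically with respect to $(t,x^1)$ on $\Upsilon(\mathcal M_* )$. (C3) For $(t,x^1)\in\Upsilon(\mathcal M_* )$, $$\bigl|[\partial_1\mathcal R_{(+)}]\circ\Upsilon^{-1}(t,x^1)\bigr|=\Bigl(\frac1\mu\Bigl|\frac{\mathfrak n}{c}\breve X\mathcal R_{(+)}\Bigr|\Bigr)\circ\Upsilon^{-1}(t,x^1)=\Bigl(\frac1\mu\Bigr)\circ\Upsilon^{-1}(t,x^1)\;\mathcal O_{\rm pos}(1).$$ In particular, since $\mu$ vanishes along the singular curve, for any $(t_*,x^1_* )\in\Upsilon(\mathcal B_{[-U_\ast,0]})$ and any sequence $\{(t_m,x^1_m)\}_{m\in\mathbb N}\subset\Upsilon(\mathcal M_* )$ converging to $(t_*,x_*^1)$, one has $|\partial_1\mathcal R_{(+)}|\circ\Upsilon^{-1}(t_m,x^1_m)\to\infty$ as $m\to\infty$. (C4) With respect to $(t,x^1)$, $\mathcal R_{(+)}$ and $L^M\mathcal R_{(+)}$ for every $M$ are continuous on $\Upsilon(\overline{\mathcal M_*})$, including on $\Upsilon(\mathcal B_{[-U_\ast,0]})$. On $\Upsilon(\overline{\mathcal M_*})$, relative to the $(t,x^1)$-coordinates, the $1D$ acoustical metric $(\mathbf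 h_{\alpha\beta})_{\alpha,\beta=0,1}$ is a continuous, non-degenerate $2\times2$ matrix of signature $(-,+)$. **D. Causal structure of the Cauchy horizon.** $\underline{\mathcal C}_{[0,U_\ast]}$ is an $\mathbf h$-null curve portion, i.e. its tangent vector is null with respect to $\mathbf h$. **E. Causal structure of the singular curve.** (E1) The vectorfield $$Q:=L-\frac{L(\frac{c}{\mathfrak n}\mu)}{\breve X(\frac{c}{\mathfrak n}\mu)}\,\breve X$$ is well-defined on $\mathcal B_{[-U_\ast,0)}$ and tangent to $\mathcal B_{[-U_\ast,0)}$. (E2) On $\mathcal B_{[-U_\ast,0)}$, $Qt>0$ and $QU<0$; in particular $Q$ is future-directed and transversal to the characteristics (the level sets of $U$). (E3) For every $q\in\mathcal B_{[-U_\ast,0)}$, the pushforward $[d\Upsilon(q)]\cdot Q(q)$, which is tangent to the curve $\Upsilon(\mathcal B_{[-U_\ast,0)})\subset\mathbb R_t\times\mathbb R_{x^1}$, equals $L|_{\Upsilon(q)}=[L^\kappa\partial_\kappa]_{\Upsilon(q)}$. (E4) For every $q\in\mathcal B_{[-U_\ast,0)}$, $L|_{\Upsilon(q)}$ is $\mathbf h$-orthogonal to the tangent space of $\Upsilon(\mathcal B_{[-U_\ast,0)})$. Since there exist integral curves of the $\mathbf h$-null vectorfield $L^\kappa\partial_\kappa$ that foliate and are $\mathbf h$-orthogonal to $\Upsilon(\mathcal B_{[-U_\ast,0)})$, it follows that $\Upsilon(\mathcal B_{[-U_\ast,0)})$ is an $\mathbf h$-null curve in the $(t,x^1)$ differential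 structure.
   Context: **Fluid setup.** Work in $1+1$ dimensions with Minkowski-rectangular coordinates $(t,x^1)$, $t=x^0$, partial derivatives $\partial_0=\partial_t,\partial_1$, and Minkowski metric $\mathfrak m=\mathrm{diag}(-1,1)$, used to lower and raise indices. Fix $\overline H>0$. The isentropic equation of state gives the speed of sound as a smooth function $c=c(H)$ of the enthalpy $H$, with $0<c\le1$ for $H$ near $\overline H$; put $c'=\frac{dc}{dH}$, $\overline c=c(\overline H)$, $\overline c'=c'(\overline H)$. Non-degeneracy condition: $1-\overline c^{\,2}+\frac{\overline c'}{\overline c\,\overline H}\neq0$. Let $F=F(H)$ solve $\frac{dF}{dH}=\frac1{Hc(H)}$, $F(\overline H)=0$, with local inverse $F^{-1}$ near $0$. In simple isentropic plane-symmetric flow the only non-vanishing Riemann invariant is $\mathcal R_{(+)}$ (and $\mathcal R_{(-)}\equiv0$), and all fluid variables are functions of it: $\mathbf u^0=\cosh(\frac12\mathcal R_{(+)})$, $\mathbf u^1=\sinh(\frac12\mathcal R_{(+)})$, $H=F^{-1}(\frac12\mathcal R_{(+)})$, $c=c(H)$, $\mathfrak n:=c^2+(1-c^2)(\mathbf u^0)^2$. The relativistic Euler equations then reduce to $L\mathcal R_{(+)}=0$, where $$L:=\partial_t+\frac{\frac{\mathbf u^1}{\mathbf u^0}+c}{1+\frac{\mathbf u^1}{\mathbf u^0}c}\,\partial_1,\qquad \underline L:=\partial_t+\frac{\frac{\mathbf u^1}{\mathbf u^0}-c}{1-\frac{\mathbf u^1}{\mathbf u^0}c}\,\partial_1 .$$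 The $1D$ acoustical metric is $\mathbf h_{\alpha\beta}:=\mathfrak n\{c^{-2}\mathfrak m_{\alpha\beta}+(c^{-2}-1)\mathbf u_\alpha\mathbf u_\beta\}$, $\alpha,\beta\in\{0,1\}$; $L$ and $\underline L$ are $\mathbf h$-null. **Geometric coordinates.** The eikonal function $U$ solves $(\mathbf h^{-1})^{\alpha\beta}\partial_\alpha U\,\partial_\beta U=0$, $\partial_tU>0$, $U|_{t=0}=-x^1$; for the solutions considered here this is equivalent to $LU=0$, $U|_{t=0}=-x^1$. The inverse foliation density is $\mu:=-\bigl(\frac c{\mathfrak n}\partial_1U\bigr)^{-1}$. Put $X:=\frac12(\underline L-L)$ (which equals $-\frac c{\mathfrak n}\partial_1$), $\breve X:=\mu X$, $\breve{\underline L}:=\mu\underline L$. The geometric coordinates are $(t,U)$, with coordinate vectorfields $\frac{\partial}{\partial t},\frac{\partial}{\partial U}$; in them $L=\frac{\partial}{\partial t}$, $\breve X=\frac{\partial}{\partial U}$, $\breve{\underline L}=\mu\frac{\partial}{\partial t}+2\frac{\partial}{\partial U}$. The change of variables map is $\Upsilon(t,U):=(t,x^1)$; as a function of $(t,U)$, $x^1$ satisfies $\frac{\partial}{\partial t}x^1=L^1$, $x^1(0,U)=-U$ (with $L^1=Lx^1$ viewed as a function of $\mathcal R_{(+)}$), and $\frac{\partial}{\partial U}x^1=-\frac c{\mathfrak n}\mu$; $x^1$ and $\mu$ are regarded as functions of $(t,U)\in\mathbb R^2$. Initial data for $\mathcal R_{(+)}$ are given as a function $\mathring{\mathcal R}_{(+)}(U)$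 on $\{t=0\}$, where $U=-x^1$. **Source term.** Define $$\mathfrak A[\mathcal R]:=\int_0^{\mathcal R}\Bigl\{-\frac{1-c^2+\frac{c'}{cH}}{2(\mathbf u^0+c\,\mathbf u^1)^2}\Bigr\}(z)\,dz,\qquad G:=-\frac{1-c^2+\frac{c'}{cH}}{2(\mathbf u^0+c\,\mathbf u^1)^2}\,\breve X\mathcal R_{(+)},$$ the integrand being viewed as a function of $z=\mathcal R_{(+)}$. By the non-degeneracy condition, $\mathfrak A$ is a diffeomorphism from a neighborhood of $0$ onto a neighborhood of $0$. Viewed as a function of $U$, $G(U)=\frac{d}{dU}\mathfrak A[\mathring{\mathcal R}_{(+)}(U)]$. **Admissible seed profile.** A $C^\infty$ function $\mathring\varphi=\mathring\varphi(U)$, compactly supported in $[-U_1,U_2]$ with $U_1,U_2>1$, such that $\frac{d}{dU}\mathring\varphi$ has a unique, non-degenerate minimum at $U=0$, and there are constants $\mathring\delta_*>0$, $\mathfrak b>0$, $\mathfrak p\in[0,1)$ with: $\mathring\varphi'(0)=-\mathring\delta_*$; $\mathring\varphi''(0)=0$; $\mathring\varphi'''(0)=\mathfrak b$; $\frac12\mathfrak b\le\mathring\varphi'''(U)\le2\mathfrak b$ for $|U|\le1$; $\mathring\varphi'(U)>-\mathfrak p\,\mathring\delta_*$ for $|U|\ge1$. **Initial data and amplitude smallness assumption.** $\mathring{\mathcal R}_{(+)}(U):=\mathfrak A^{-1}[\mathring\varphi(U)]$, where $\mathring\varphi$ has been multiplied by a constant, if necessary, to shrink the amplitude of $\mathring{\mathcal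 R}_{(+)}$ and ensure that: (1) the fluid data determined by $\mathring{\mathcal R}_{(+)}$ lie in the interior of the regime of hyperbolicity $\{0<c\le1\}$; (2) $\frac{d}{d\mathcal R}\mathfrak A[\mathcal R]\big|_{\mathcal R=\mathring{\mathcal R}_{(+)}(U)}\neq0$ for $U\in[-U_1,U_2]$. Put $T_{\rm Shock}:=1/\mathring\delta_*$. **Subsets of geometric coordinate space.** $\mathfrak t_{\rm Sing}(U):=-1/G(U)$. For $I\subset[-U_\ast,U_\ast]$, the truncated singular curve is $\mathcal B_I:=\{(t,U)\in[0,\infty)\times I:\ \mu(t,U)=0,\ \breve X\mu(t,U)\le0\}$. The crease is $\partial_-\mathcal B:=\{(t,U)\in[0,\infty)\times[-U_\ast,U_\ast]:\ \mu(t,U)=0,\ \breve X\mu(t,U)=0\}$. The curve $\breve{\underline\gamma}$ solves $\frac{d}{dU}\breve{\underline\gamma}(U)=\frac12\breve{\underline L}\circ\breve{\underline\gamma}(U)$, $\breve{\underline\gamma}(0)=(T_{\rm Shock},0)$; equivalently $\breve{\underline\gamma}(U)=(\mathfrak t_{\rm CH}(U),U)$ with $\frac{d}{dU}\mathfrak t_{\rm CH}(U)=\frac12\mu(\mathfrak t_{\rm CH}(U),U)$, $\mathfrak t_{\rm CH}(0)=T_{\rm Shock}$. For an interval $I\subset[0,\infty)$, the truncated Cauchy horizon is $\underline{\mathcal C}_I:=\breve{\underline\gamma}(I)$. Finally $$\mathcal M_{\rm Sing}:=\{0\le t<\mathfrak t_{\rm Sing}(U),\ U\in[-U_\ast,0]\},\quad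 \mathcal M_{\rm Reg}:=\{0\le t\le\mathfrak t_{\rm CH}(U),\ U\in(0,U_\ast]\},\quad \mathcal M_*:=\mathcal M_{\rm Sing}\cup\mathcal M_{\rm Reg}.$$ **Notation.** $A=\mathcal O_{\rm pos}(1)\,B$ means that $A=fB$ for a function $f$ with $C_1\le f\le C_2$, where $0<C_1\le C_2$ are constants depending on the seed profile.
   Formalization: The factor 1-c^2+c'/(cH) in the non-degeneracy condition, A and G is corrected to 1-c^2+c c'H (as printed, mu need not vanish at -1/G), and amplitude smallness also requires subsonic data |u^1/u^0|<c, without which B4 and B7 can fail. *)

theory Defs
  imports "HOL-Analysis.Analysis"
begin

section \<open>Smooth maps and tangent vectors\<close>

fun higher_differentiable_on ::
  "nat \<Rightarrow> 'a::real_normed_vector set \<Rightarrow> ('a \<Rightarrow> 'b::real_normed_vector) \<Rightarrow> bool" where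
  "higher_differentiable_on 0 T f \<longleftrightarrow> continuous_on T f"
| "higher_differentiable_on (Suc n) T f \<longleftrightarrow>
     (\<forall>x\<in>T. f differentiable (at x)) \<and>
     (\<forall>v. higher_differentiable_on n T (\<lambda>x. frechet_derivative f (at x) v))"

text \<open>Smoothness on a set that need not be open means: near every point of the set there is a
  smooth extension to an open neighbourhood.\<close>

definition smooth_on ::
  "'a::real_normed_vector set \<Rightarrow> ('a \<Rightarrow> 'b::real_normed_vector) \<Rightarrow> bool" where
  "smooth_on S f \<longleftrightarrow>
     (\<forall>x\<in>S. \<exists>T g. open T \<and> x \<in> T \<and> (\<forall>n. higher_differentiable_on n T g) \<and>
                 (\<forall>y\<in>S \<inter> T. f y = g y))"

definition diffeomorphism ::
  "'a::real_normed_vector set \<Rightarrow> 'b::real_normed_vector set \<Rightarrow> ('a \<Rightarrow> 'b) \<Rightarrow> ('b \<Rightarrow> 'a) \<Rightarrow> bool" where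
  "diffeomorphism S T f g \<longleftrightarrow>
     f ` S = T \<and> g ` T = S \<and> (\<forall>x\<in>S. g (f x) = x) \<and> (\<forall>y\<in>T. f (g y) = y) \<and>
     smooth_on S f \<and> smooth_on T g"

text \<open>Tangent vectors of a curve given as a point set.  Only one-sided velocities and their
  negatives are used, so that end points belonging to the curve also get a full tangent line.\<close>

definition tangent_vectors :: "'a::real_normed_vector set \<Rightarrow> 'a \<Rightarrow> 'a set" where
  "tangent_vectors S q =
     {v. \<exists>\<sigma> e. 0 < e \<and> \<sigma> 0 = q \<and> \<sigma> ` {0..<e} \<subseteq> S \<and>
           ((\<sigma> has_vector_derivative v) (at 0 within {0..<e}) \<or>
            (\<sigma> has_vector_derivative - v) (at (0::real) within {0..<e}))}"

definition integral_curve ::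
  "('a::real_normed_vector \<Rightarrow> 'a) \<Rightarrow> (real \<Rightarrow> 'a) \<Rightarrow> real set \<Rightarrow> bool" where
  "integral_curve V \<sigma> I \<longleftrightarrow> (\<forall>s\<in>I. (\<sigma> has_vector_derivative V (\<sigma> s)) (at s within I))"

text \<open>\<open>a = O_pos(1) b\<close>, pointwise, with explicit constants.\<close>

definition Opos :: "real \<Rightarrow> real \<Rightarrow> real \<Rightarrow> real \<Rightarrow> bool" where
  "Opos C1 C2 a b \<longleftrightarrow> (\<exists>f. C1 \<le> f \<and> f \<le> C2 \<and> a = f * b)"


section \<open>Equation of state and simple isentropic flow\<close>

text \<open>\<open>sound\<close> is the speed of sound as a function of the enthalpy, \<open>Hdom\<close> an open interval around
  \<open>Hbar\<close> on which it is smooth and takes values in \<open>(0, 1]\<close>, and \<open>Ffun\<close> is the function \<open>F\<close>.\<close>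

record eos =
  Hbar :: real
  Hdom :: "real set"
  sound :: "real \<Rightarrow> real"
  Ffun :: "real \<Rightarrow> real"

definition equation_of_state :: "eos \<Rightarrow> bool" where
  "equation_of_state E \<longleftrightarrow>
     open (Hdom E) \<and> is_interval (Hdom E) \<and> Hdom E \<subseteq> {0<..} \<and> 0 < Hbar E \<and> Hbar E \<in> Hdom E \<and>
     smooth_on (Hdom E) (sound E) \<and>
     (\<forall>H\<in>Hdom E. 0 < sound E H \<and> sound E H \<le> 1) \<and>
     (\<forall>H\<in>Hdom E. (Ffun E has_real_derivative 1 / (H * sound E H)) (at H)) \<and>
     Ffun E (Hbar E) = 0"

text \<open>The factor \<open>1 - c\<^sup>2 + c c' H\<close> is what the chain rule gives for the \<open>R\<close>-derivative of \<open>L\<^sup>1\<close>: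
  since \<open>H = F\<inverse>(R/2)\<close> and \<open>F' = 1/(H c)\<close>, one has \<open>dc/dR = c' H c / 2\<close>; see
  \<open>L1_has_derivative\<close> below.  The source prints \<open>c'/(c H)\<close> instead of \<open>c c' H\<close>, both in the
  non-degeneracy condition and in the source term; with that (dimensionally inconsistent)
  expression the density \<open>\<mu>\<close> would not vanish at \<open>-1/G\<close>.\<close>

definition nonlin :: "eos \<Rightarrow> real \<Rightarrow> real" where
  "nonlin E H = 1 - (sound E H)\<^sup>2 + sound E H * deriv (sound E) H * H"

definition nondegenerate :: "eos \<Rightarrow> bool" where
  "nondegenerate E \<longleftrightarrow> nonlin E (Hbar E) \<noteq> 0"

text \<open>The fluid variables as functions of the Riemann invariant \<open>R\<close>, for \<open>R\<close> in \<open>Rdom E\<close>.\<close>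

definition Rdom :: "eos \<Rightarrow> real set" where
  "Rdom E = {R. R / 2 \<in> Ffun E ` Hdom E}"

definition enthalpy :: "eos \<Rightarrow> real \<Rightarrow> real" where
  "enthalpy E R = the_inv_into (Hdom E) (Ffun E) (R / 2)"

definition csnd :: "eos \<Rightarrow> real \<Rightarrow> real" where
  "csnd E R = sound E (enthalpy E R)"

definition u0 :: "real \<Rightarrow> real" where "u0 R = cosh (R / 2)"

definition u1 :: "real \<Rightarrow> real" where "u1 R = sinh (R / 2)"

definition nfac :: "eos \<Rightarrow> real \<Rightarrow> real" where
  "nfac E R = (csnd E R)\<^sup>2 + (1 - (csnd E R)\<^sup>2) * (u0 R)\<^sup>2"

definition L1 :: "eos \<Rightarrow> real \<Rightarrow> real" where
  "L1 E R = (u1 R / u0 R + csnd E R) / (1 + u1 R / u0 R * csnd E R)"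

definition Lb1 :: "eos \<Rightarrow> real \<Rightarrow> real" where
  "Lb1 E R = (u1 R / u0 R - csnd E R) / (1 - u1 R / u0 R * csnd E R)"

text \<open>Components of \<open>L\<close>, \<open>L_bar\<close> and \<open>X\<close> relative to the rectangular coordinates
  \<open>(t, x\<^sup>1)\<close>.\<close>

definition L_rect :: "eos \<Rightarrow> real \<Rightarrow> real \<times> real" where
  "L_rect E R = (1, L1 E R)"

definition Lb_rect :: "eos \<Rightarrow> real \<Rightarrow> real \<times> real" where
  "Lb_rect E R = (1, Lb1 E R)"

definition X_rect :: "eos \<Rightarrow> real \<Rightarrow> real \<times> real" where
  "X_rect E R = (1 / 2) *\<^sub>R (Lb_rect E R - L_rect E R)"

text \<open>Space-time indices 0 and 1 are the elements 1 and 2 of the index type \<open>2\<close>.\<close>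

definition minkowski :: "real ^ 2 ^ 2" where
  "minkowski = vector [vector [-1, 0], vector [0, 1]]"

definition u_lower :: "real \<Rightarrow> real ^ 2" where
  "u_lower R = minkowski *v vector [u0 R, u1 R]"

definition hmat :: "eos \<Rightarrow> real \<Rightarrow> real ^ 2 ^ 2" where
  "hmat E R = (\<chi> \<alpha> \<beta>. nfac E R *
      (minkowski $ \<alpha> $ \<beta> / (csnd E R)\<^sup>2 +
       (1 / (csnd E R)\<^sup>2 - 1) * u_lower R $ \<alpha> * u_lower R $ \<beta>))"

definition vec2 :: "real \<times> real \<Rightarrow> real ^ 2" where
  "vec2 v = vector [fst v, snd v]"

definition hprod :: "eos \<Rightarrow> real \<Rightarrow> real \<times> real \<Rightarrow> real \<times> real \<Rightarrow> real" where
  "hprod E R v w = (\<Sum>\<alpha>\<in>UNIV. \<Sum>\<beta>\<in>UNIV. hmat E R $ \<alpha> $ \<beta> * vec2 v $ \<alpha> * vec2 w $ \<beta>)"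

text \<open>Signature \<open>(-, +)\<close> of a symmetric \<open>2 \<times> 2\<close> matrix: one negative and one positive
  eigenvalue.\<close>

definition lorentzian :: "real ^ 2 ^ 2 \<Rightarrow> bool" where
  "lorentzian A \<longleftrightarrow> transpose A = A \<and>
     (\<exists>l0 l1. l0 < 0 \<and> 0 < l1 \<and>
        (\<exists>v. v \<noteq> 0 \<and> A *v v = l0 *\<^sub>R v) \<and> (\<exists>v. v \<noteq> 0 \<and> A *v v = l1 *\<^sub>R v))"


section \<open>Source term and initial data\<close>

definition Adens :: "eos \<Rightarrow> real \<Rightarrow> real" where
  "Adens E R = - nonlin E (enthalpy E R) / (2 * (u0 R + csnd E R * u1 R)\<^sup>2)"

definition Afun :: "eos \<Rightarrow> real \<Rightarrow> real" where
  "Afun E R = (LBINT z=0..R. Adens E z)"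

text \<open>The inverse of \<open>Afun\<close> is taken on the largest interval around 0 on which \<open>Afun\<close> is a
  diffeomorphism onto its image, so that it is the continuation of the local inverse near 0.\<close>

definition Adom :: "eos \<Rightarrow> real set" where
  "Adom E = connected_component_set {R \<in> Rdom E. Adens E R \<noteq> 0} 0"

definition Ainv :: "eos \<Rightarrow> real \<Rightarrow> real" where
  "Ainv E = the_inv_into (Adom E) (Afun E)"

definition admissible_seed ::
  "(real \<Rightarrow> real) \<Rightarrow> real \<Rightarrow> real \<Rightarrow> real \<Rightarrow> real \<Rightarrow> real \<Rightarrow> bool" where
  "admissible_seed \<phi> U1 U2 \<delta> b p \<longleftrightarrow>
     1 < U1 \<and> 1 < U2 \<and> 0 < \<delta> \<and> 0 < b \<and> 0 \<le> p \<and> p < 1 \<and>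
     smooth_on UNIV \<phi> \<and> (\<forall>U. U \<notin> {-U1..U2} \<longrightarrow> \<phi> U = 0) \<and>
     (\<forall>U. U \<noteq> 0 \<longrightarrow> deriv \<phi> 0 < deriv \<phi> U) \<and>
     deriv \<phi> 0 = - \<delta> \<and> (deriv ^^ 2) \<phi> 0 = 0 \<and> (deriv ^^ 3) \<phi> 0 = b \<and>
     (\<forall>U. \<bar>U\<bar> \<le> 1 \<longrightarrow> b / 2 \<le> (deriv ^^ 3) \<phi> U \<and> (deriv ^^ 3) \<phi> U \<le> 2 * b) \<and>
     (\<forall>U. 1 \<le> \<bar>U\<bar> \<longrightarrow> deriv \<phi> U > - p * \<delta>)"

definition initial_data :: "eos \<Rightarrow> (real \<Rightarrow> real) \<Rightarrow> real \<Rightarrow> real" where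
  "initial_data E \<phi> U = Ainv E (\<phi> U)"

text \<open>The first clause says that \<open>initial_data\<close> is well defined.  The last clause (the data are
  subsonic, equivalently \<open>L_bar\<^sup>1 < 0 < L\<^sup>1\<close>) is the part of the smallness of the amplitude
  that singles out the solution of \<open>L U = 0\<close> by the condition \<open>\<partial>\<^sub>t U > 0\<close> on the eikonal function,
  and that fixes the signs of the velocities of the singular curve and of the Cauchy horizon.
  All clauses hold once the seed has been multiplied by a small constant; see
  \<open>amplitude_small_attainable\<close> below.\<close>

definition amplitude_small :: "eos \<Rightarrow> (real \<Rightarrow> real) \<Rightarrow> real \<Rightarrow> real \<Rightarrow> bool" where
  "amplitude_small E \<phi> U1 U2 \<longleftrightarrow>
     (\<forall>U. \<phi> U \<in> Afun E ` Adom E) \<and>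
     (\<forall>U. enthalpy E (initial_data E \<phi> U)
            \<in> interior {H \<in> Hdom E. 0 < sound E H \<and> sound E H \<le> 1}) \<and>
     (\<forall>U\<in>{-U1..U2}. deriv (Afun E) (initial_data E \<phi> U) \<noteq> 0) \<and>
     (\<forall>U. \<bar>u1 (initial_data E \<phi> U) / u0 (initial_data E \<phi> U)\<bar> < csnd E (initial_data E \<phi> U))"


section \<open>Geometric coordinates\<close>

text \<open>Functions of the geometric coordinates \<open>(t, U)\<close> have type \<open>real \<times> real \<Rightarrow> real\<close>.
  The vectorfields \<open>L = \<partial>/\<partial>t\<close>, \<open>X_breve = \<partial>/\<partial>U\<close> and \<open>\<mu> L_bar = \<mu> \<partial>/\<partial>t + 2 \<partial>/\<partial>U\<close>, as derivations and by
  their components relative to \<open>(\<partial>/\<partial>t, \<partial>/\<partial>U)\<close>:\<close>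

definition dL :: "(real \<times> real \<Rightarrow> real) \<Rightarrow> real \<times> real \<Rightarrow> real" where
  "dL f = (\<lambda>(t, U). deriv (\<lambda>s. f (s, U)) t)"

definition dX :: "(real \<times> real \<Rightarrow> real) \<Rightarrow> real \<times> real \<Rightarrow> real" where
  "dX f = (\<lambda>(t, U). deriv (\<lambda>u. f (t, u)) U)"

definition dLb :: "(real \<times> real \<Rightarrow> real) \<Rightarrow> (real \<times> real \<Rightarrow> real) \<Rightarrow> real \<times> real \<Rightarrow> real" where
  "dLb \<mu> f p = \<mu> p * dL f p + 2 * dX f p"

definition L_geo :: "real \<times> real \<Rightarrow> real \<times> real" where
  "L_geo p = (1, 0)"

definition X_geo :: "real \<times> real \<Rightarrow> real \<times> real" where
  "X_geo p = (0, 1)"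

definition Lb_geo :: "(real \<times> real \<Rightarrow> real) \<Rightarrow> real \<times> real \<Rightarrow> real \<times> real" where
  "Lb_geo \<mu> p = (\<mu> p, 2)"

text \<open>The solution with data \<open>R0\<close> in geometric coordinates: \<open>L R = 0\<close> with \<open>L = \<partial>/\<partial>t\<close>, together
  with the equations for the rectangular coordinate \<open>x\<^sup>1\<close> and the inverse foliation density \<open>\<mu>\<close>
  as functions of \<open>(t, U)\<close>.\<close>

definition geometric_solution ::
  "eos \<Rightarrow> (real \<Rightarrow> real) \<Rightarrow> (real \<times> real \<Rightarrow> real) \<Rightarrow> (real \<times> real \<Rightarrow> real) \<Rightarrow>
   (real \<times> real \<Rightarrow> real) \<Rightarrow> bool" where
  "geometric_solution E R0 R x1 \<mu> \<longleftrightarrow>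
     (\<forall>t U. R (t, U) \<in> Rdom E \<and>
        ((\<lambda>s. R (s, U)) has_real_derivative 0) (at t) \<and>
        R (0, U) = R0 U \<and>
        ((\<lambda>s. x1 (s, U)) has_real_derivative L1 E (R (t, U))) (at t) \<and>
        x1 (0, U) = - U \<and>
        ((\<lambda>u. x1 (t, u)) has_real_derivative
           - (csnd E (R (t, U)) / nfac E (R (t, U))) * \<mu> (t, U)) (at U))"

definition Upsilon :: "(real \<times> real \<Rightarrow> real) \<Rightarrow> real \<times> real \<Rightarrow> real \<times> real" where
  "Upsilon x1 p = (fst p, x1 p)"

definition pushforward ::
  "(real \<times> real \<Rightarrow> real) \<Rightarrow> real \<times> real \<Rightarrow> real \<times> real \<Rightarrow> real \<times> real" where
  "pushforward x1 p v = frechet_derivative (Upsilon x1) (at p) v"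

definition Gsrc :: "eos \<Rightarrow> (real \<Rightarrow> real) \<Rightarrow> real \<Rightarrow> real" where
  "Gsrc E R0 U = Adens E (R0 U) * deriv R0 U"

definition t_sing :: "eos \<Rightarrow> (real \<Rightarrow> real) \<Rightarrow> real \<Rightarrow> real" where
  "t_sing E R0 U = - 1 / Gsrc E R0 U"

definition sing_curve :: "(real \<times> real \<Rightarrow> real) \<Rightarrow> real set \<Rightarrow> (real \<times> real) set" where
  "sing_curve \<mu> I = {p \<in> {0..} \<times> I. \<mu> p = 0 \<and> dX \<mu> p \<le> 0}"

definition crease :: "(real \<times> real \<Rightarrow> real) \<Rightarrow> real \<Rightarrow> (real \<times> real) set" where
  "crease \<mu> Us = {p \<in> {0..} \<times> {-Us..Us}. \<mu> p = 0 \<and> dX \<mu> p = 0}"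

definition CH_curve :: "(real \<times> real \<Rightarrow> real) \<Rightarrow> real \<Rightarrow> real \<Rightarrow> (real \<Rightarrow> real \<times> real) \<Rightarrow> bool" where
  "CH_curve \<mu> T Us \<gamma> \<longleftrightarrow>
     integral_curve (\<lambda>p. (1 / 2) *\<^sub>R Lb_geo \<mu> p) \<gamma> {0..Us} \<and> \<gamma> 0 = (T, 0)"

definition M_sing :: "(real \<Rightarrow> real) \<Rightarrow> real \<Rightarrow> (real \<times> real) set" where
  "M_sing tS Us = {(t, U). 0 \<le> t \<and> t < tS U \<and> U \<in> {-Us..0}}"

definition M_reg :: "(real \<Rightarrow> real) \<Rightarrow> real \<Rightarrow> (real \<times> real) set" where
  "M_reg tCH Us = {(t, U). 0 \<le> t \<and> t \<le> tCH U \<and> U \<in> {0<..Us}}"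

definition M_star :: "(real \<Rightarrow> real) \<Rightarrow> (real \<Rightarrow> real) \<Rightarrow> real \<Rightarrow> (real \<times> real) set" where
  "M_star tS tCH Us = M_sing tS Us \<union> M_reg tCH Us"

definition cn_mu :: "eos \<Rightarrow> (real \<times> real \<Rightarrow> real) \<Rightarrow> (real \<times> real \<Rightarrow> real) \<Rightarrow> real \<times> real \<Rightarrow> real" where
  "cn_mu E R \<mu> p = csnd E (R p) / nfac E (R p) * \<mu> p"

definition Qvec ::
  "eos \<Rightarrow> (real \<times> real \<Rightarrow> real) \<Rightarrow> (real \<times> real \<Rightarrow> real) \<Rightarrow> real \<times> real \<Rightarrow> real \<times> real" where
  "Qvec E R \<mu> p = L_geo p - (dL (cn_mu E R \<mu>) p / dX (cn_mu E R \<mu>) p) *\<^sub>R X_geo p"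


section \<open>Rectangular coordinates\<close>

text \<open>Partial derivatives relative to \<open>(t, x\<^sup>1)\<close> on a set \<open>S\<close>; the boundary points of \<open>S\<close> that
  belong to \<open>S\<close> are treated by the derivative within \<open>S\<close>.\<close>

definition pt :: "(real \<times> real) set \<Rightarrow> (real \<times> real \<Rightarrow> real) \<Rightarrow> real \<times> real \<Rightarrow> real" where
  "pt S f q = frechet_derivative f (at q within S) (1, 0)"

definition px :: "(real \<times> real) set \<Rightarrow> (real \<times> real \<Rightarrow> real) \<Rightarrow> real \<times> real \<Rightarrow> real" where
  "px S f q = frechet_derivative f (at q within S) (0, 1)"

text \<open>The derivation \<open>L = \<partial>\<^sub>t + L\<^sup>1 \<partial>\<^sub>1\<close>, where \<open>r\<close> is the Riemann invariant as a function of
  \<open>(t, x\<^sup>1)\<close>.\<close>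

definition L_op ::
  "eos \<Rightarrow> (real \<times> real) set \<Rightarrow> (real \<times> real \<Rightarrow> real) \<Rightarrow> (real \<times> real \<Rightarrow> real) \<Rightarrow>
   real \<times> real \<Rightarrow> real" where
  "L_op E S r f q = pt S f q + L1 E (r q) * px S f q"

definition classical_solution ::
  "eos \<Rightarrow> (real \<times> real) set \<Rightarrow> (real \<Rightarrow> real) \<Rightarrow> (real \<times> real \<Rightarrow> real) \<Rightarrow> bool" where
  "classical_solution E S R0 r \<longleftrightarrow>
     smooth_on S r \<and> (\<forall>q\<in>S. r q \<in> Rdom E \<and> r differentiable (at q within S) \<and> L_op E S r r q = 0) \<and>
     (\<forall>x. (0, x) \<in> S \<longrightarrow> r (0, x) = R0 (- x))"

definition eikonal_function ::
  "eos \<Rightarrow> (real \<times> real) set \<Rightarrow> (real \<times> real \<Rightarrow> real) \<Rightarrow> (real \<times> real \<Rightarrow> real) \<Rightarrow> bool" where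
  "eikonal_function E S r u \<longleftrightarrow>
     smooth_on S u \<and>
     (\<forall>q\<in>S. u differentiable (at q within S) \<and>
        (\<Sum>\<alpha>\<in>UNIV. \<Sum>\<beta>\<in>UNIV. matrix_inv (hmat E (r q)) $ \<alpha> $ \<beta> *
            vec2 (pt S u q, px S u q) $ \<alpha> * vec2 (pt S u q, px S u q) $ \<beta>) = 0 \<and>
        0 < pt S u q) \<and>
     (\<forall>x. (0, x) \<in> S \<longrightarrow> u (0, x) = - x)"


section \<open>Two checks of the definitions\<close>

lemma smooth_on_open_deriv:
  fixes f :: "real \<Rightarrow> real"
  assumes "smooth_on S f" "open S" "x \<in> S"
  shows "(f has_real_derivative deriv f x) (at x)" and "isCont (deriv f) x"
proof -
  obtain T g where T: "open T" "x \<in> T" "\<And>n. higher_differentiable_on n T g"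
    and eq: "\<And>y. y \<in> S \<inter> T \<Longrightarrow> f y = g y"
    using assms unfolding smooth_on_def by meson
  have diff: "\<And>y. y \<in> T \<Longrightarrow> g differentiable (at y)"
    and c1: "continuous_on T (\<lambda>y. frechet_derivative g (at y) 1)"
    using T(3)[of "Suc 0"] by auto
  have der: "(f has_real_derivative frechet_derivative g (at y) 1) (at y)" if "y \<in> S \<inter> T" for y
  proof -
    have "(g has_derivative frechet_derivative g (at y)) (at y)"
      using diff that frechet_derivative_works by blast
    then have "(g has_real_derivative frechet_derivative g (at y) 1) (at y)"
      by (metis differentiableI frechet_derivative_at has_field_derivative_def lambda_one
          mult.commute real_differentiable_def real_differentiableE)
    moreover have "open (S \<inter> T)" by (intro open_Int assms(2) T(1))
    ultimately show ?thesis
      by (rule has_field_derivative_transform_within_open[OF _ _ that eq[symmetric]])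
  qed
  have d: "deriv f y = frechet_derivative g (at y) 1" if "y \<in> S \<inter> T" for y
    by (rule DERIV_imp_deriv[OF der[OF that]])
  have x: "x \<in> S \<inter> T" using assms(3) T(2) by (rule IntI)
  show "(f has_real_derivative deriv f x) (at x)"
    unfolding d[OF x] by (rule der[OF x])
  have "continuous_on (S \<inter> T) (deriv f)"
    by (rule continuous_on_eq[OF continuous_on_subset[OF c1 Int_lower2] d[symmetric]])
  moreover have "open (S \<inter> T)" by (intro open_Int assms(2) T(1))
  ultimately show "isCont (deriv f) x"
    using x continuous_on_eq_continuous_at by blast
qed

context
  fixes E :: eos
  assumes E: "equation_of_state E"
begin

lemma Ffun_inj: "inj_on (Ffun E) (Hdom E)"
proof -
  have "Ffun E x < Ffun E y" if "x \<in> Hdom E" "y \<in> Hdom E" "x < y" for x y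
  proof (rule DERIV_pos_imp_increasing[OF that(3)])
    fix z assume "x \<le> z" "z \<le> y"
    then have z: "z \<in> Hdom E"
      using that E unfolding equation_of_state_def is_interval_1 by blast
    then have "0 < 1 / (z * sound E z)"
      using E unfolding equation_of_state_def by (auto simp: subset_iff)
    then show "\<exists>d. DERIV (Ffun E) z :> d \<and> 0 < d"
      using z E unfolding equation_of_state_def by blast
  qed
  then show ?thesis
    by (intro linorder_inj_onI') (metis less_irrefl)
qed

lemma Ffun_cont: "continuous_on (Hdom E) (Ffun E)"
  using E unfolding equation_of_state_def
  by (meson DERIV_isCont continuous_at_imp_continuous_on)

lemma open_Rdom: "open (Rdom E)"
proof -
  have "open (Ffun E ` Hdom E)"
    using E Ffun_cont Ffun_inj unfolding equation_of_state_def
    by (intro invariance_of_domain) auto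
  then have "open ((\<lambda>R::real. R / 2) -` (Ffun E ` Hdom E))"
    by (intro open_vimage) (auto intro!: continuous_intros)
  then show ?thesis by (simp add: Rdom_def vimage_def)
qed

lemma enthalpy_props:
  assumes "R \<in> Rdom E"
  shows "enthalpy E R \<in> Hdom E" "Ffun E (enthalpy E R) = R / 2"
    "(enthalpy E has_real_derivative enthalpy E R * csnd E R / 2) (at R)"
proof -
  obtain H where H: "H \<in> Hdom E" "R / 2 = Ffun E H" using assms by (auto simp: Rdom_def)
  define g where "g = the_inv_into (Hdom E) (Ffun E)"
  have g: "g (Ffun E z) = z" if "z \<in> Hdom E" for z
    using that Ffun_inj by (simp add: g_def the_inv_into_f_f)
  have eH: "enthalpy E R = H" using H g by (simp add: enthalpy_def g_def)
  show "enthalpy E R \<in> Hdom E" "Ffun E (enthalpy E R) = R / 2" using eH H by auto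
  have pos: "0 < H" "0 < sound E H" using H E unfolding equation_of_state_def by auto
  have dF: "(Ffun E has_derivative (*) (1 / (H * sound E H))) (at H)"
    using H E unfolding equation_of_state_def has_field_derivative_def by blast
  have "(*) (1 / (H * sound E H)) \<circ> (*) (H * sound E H) = id"
    using pos by (auto simp: fun_eq_iff)
  then have "(g has_derivative (*) (H * sound E H)) (at (Ffun E H))"
    using H E dF Ffun_cont g unfolding equation_of_state_def
    by (intro has_derivative_inverse_strong[of "Hdom E" H "Ffun E" g "(*) (1 / (H * sound E H))"])
       auto
  then have "(g has_real_derivative H * sound E H) (at (R / 2))"
    using H by (simp add: has_field_derivative_def)
  then have "((\<lambda>R. g (R / 2)) has_real_derivative H * sound E H * (1 / 2)) (at R)"
    by (rule DERIV_chain2) (auto intro!: derivative_eq_intros)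
  then show "(enthalpy E has_real_derivative enthalpy E R * csnd E R / 2) (at R)"
    using eH by (simp add: g_def csnd_def enthalpy_def[abs_def])
qed

lemma csnd_props:
  assumes "R \<in> Rdom E"
  shows "0 < csnd E R" "csnd E R \<le> 1"
    "(csnd E has_real_derivative
        deriv (sound E) (enthalpy E R) * (enthalpy E R * csnd E R / 2)) (at R)"
proof -
  note e = enthalpy_props[OF assms]
  show "0 < csnd E R" "csnd E R \<le> 1"
    using e(1) E unfolding equation_of_state_def csnd_def by auto
  have "(sound E has_real_derivative deriv (sound E) (enthalpy E R)) (at (enthalpy E R))"
    using e(1) E unfolding equation_of_state_def by (intro smooth_on_open_deriv) auto
  from DERIV_chain2[OF this e(3)] show "(csnd E has_real_derivative
        deriv (sound E) (enthalpy E R) * (enthalpy E R * csnd E R / 2)) (at R)"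
    by (simp add: csnd_def[abs_def])
qed

lemma abs_u1_less_u0: "\<bar>u1 R\<bar> < u0 R"
proof -
  have "u0 R + u1 R = exp (R / 2)" "u0 R - u1 R = exp (- (R / 2))"
    by (simp_all add: u0_def u1_def cosh_plus_sinh cosh_minus_sinh)
  moreover have "0 < exp (R / 2)" "0 < exp (- (R / 2))" by simp_all
  ultimately show ?thesis by linarith
qed

lemma u0_csnd_u1_pos:
  assumes "R \<in> Rdom E"
  shows "0 < u0 R + csnd E R * u1 R"
proof -
  have "\<bar>csnd E R * u1 R\<bar> \<le> \<bar>u1 R\<bar>"
    using csnd_props(1,2)[OF assms] by (simp add: abs_mult mult_left_le_one_le)
  then show ?thesis using abs_u1_less_u0[of R] by linarith
qed

lemma L1_has_derivative:
  assumes "R \<in> Rdom E"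
  shows "(L1 E has_real_derivative - Adens E R) (at R)"
proof -
  define c H c' S C where "c = csnd E R" and "H = enthalpy E R" and "c' = deriv (sound E) H"
    and "S = u1 R" and "C = u0 R"
  have C0: "C > 0" by (simp add: C_def u0_def)
  have pos: "0 < C + c * S" using u0_csnd_u1_pos[OF assms] by (simp add: C_def S_def c_def)
  have CS: "C\<^sup>2 = S\<^sup>2 + 1" by (simp add: C_def S_def u0_def u1_def cosh_square_eq)
  have eq: "L1 E = (\<lambda>R. (u1 R + csnd E R * u0 R) / (u0 R + csnd E R * u1 R))"
  proof
    fix R have "u0 R > 0" by (simp add: u0_def)
    then show "L1 E R = (u1 R + csnd E R * u0 R) / (u0 R + csnd E R * u1 R)"
      by (simp add: L1_def divide_simps) (simp add: algebra_simps)
  qed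
  have du: "(u1 has_real_derivative C / 2) (at R)" "(u0 has_real_derivative S / 2) (at R)"
    unfolding u0_def[abs_def] u1_def[abs_def] C_def S_def
    by (auto intro!: derivative_eq_intros simp: u0_def u1_def)
  have dc: "(csnd E has_real_derivative c' * (H * c / 2)) (at R)"
    using csnd_props(3)[OF assms] by (simp add: c_def H_def c'_def)
  define N where "N = C / 2 + (c * (S / 2) + c' * (H * c / 2) * C)"
  define D where "D = S / 2 + (c * (C / 2) + c' * (H * c / 2) * S)"
  have dN: "((\<lambda>R. u1 R + csnd E R * u0 R) has_real_derivative N) (at R)"
    using DERIV_add[OF du(1) DERIV_mult[OF dc du(2)]]
    by (simp add: N_def C_def S_def c_def ac_simps)
  have dD: "((\<lambda>R. u0 R + csnd E R * u1 R) has_real_derivative D) (at R)"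
    using DERIV_add[OF du(2) DERIV_mult[OF dc du(1)]]
    by (simp add: D_def C_def S_def c_def ac_simps)
  have "u0 R + csnd E R * u1 R \<noteq> 0" using pos by (simp add: C_def S_def c_def)
  from DERIV_divide[OF dN dD this]
  have "(L1 E has_real_derivative
      (N * (C + c * S) - (S + c * C) * D) / ((C + c * S) * (C + c * S))) (at R)"
    by (simp add: eq C_def S_def c_def)
  moreover have "N * (C + c * S) - (S + c * C) * D = (1 - c\<^sup>2 + c * c' * H) / 2"
  proof -
    have "N * (C + c * S) - (S + c * C) * D = (1 - c\<^sup>2 + c * c' * H) * (C\<^sup>2 - S\<^sup>2) / 2"
      unfolding N_def D_def by (simp add: field_simps power2_eq_square)
    then show ?thesis using CS by simp
  qed
  moreover have "- Adens E R = (1 - c\<^sup>2 + c * c' * H) / 2 / ((C + c * S) * (C + c * S))"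
    unfolding Adens_def nonlin_def c_def H_def c'_def S_def C_def csnd_def power2_eq_square
    by (simp only: divide_divide_eq_left minus_divide_left minus_minus)
  ultimately show ?thesis by simp
qed

lemma isCont_Adens:
  assumes "R \<in> Rdom E"
  shows "isCont (Adens E) R"
proof -
  have e: "isCont (enthalpy E) R" "enthalpy E R \<in> Hdom E"
    using enthalpy_props[OF assms] DERIV_isCont by blast+
  have s: "isCont (sound E) (enthalpy E R)" "isCont (deriv (sound E)) (enthalpy E R)"
    using smooth_on_open_deriv[of "Hdom E" "sound E" "enthalpy E R"] e(2) E DERIV_isCont
    unfolding equation_of_state_def by blast+
  have "isCont (\<lambda>R. sound E (enthalpy E R)) R" "isCont (\<lambda>R. deriv (sound E) (enthalpy E R)) R"
    using e s isCont_o2 by blast+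
  then show ?thesis
    unfolding Adens_def[abs_def] nonlin_def csnd_def u0_def u1_def
    using u0_csnd_u1_pos[OF assms] e(1)
    by (intro continuous_intros) (auto simp: u0_def u1_def csnd_def)
qed

lemma Adom_props: "open (Adom E)" "connected (Adom E)" "Adom E \<subseteq> {R \<in> Rdom E. Adens E R \<noteq> 0}"
proof -
  have "continuous_on (Rdom E) (Adens E)"
    by (simp add: continuous_at_imp_continuous_on isCont_Adens)
  then have "open (Rdom E \<inter> Adens E -` (- {0}))"
    using open_Rdom by (intro continuous_open_preimage) auto
  moreover have "Rdom E \<inter> Adens E -` (- {0}) = {R \<in> Rdom E. Adens E R \<noteq> 0}" by auto
  ultimately have "open {R \<in> Rdom E. Adens E R \<noteq> 0}" by simp
  then show "open (Adom E)" unfolding Adom_def by (rule open_connected_component)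
  show "connected (Adom E)" "Adom E \<subseteq> {R \<in> Rdom E. Adens E R \<noteq> 0}"
    unfolding Adom_def by (simp_all add: connected_component_subset)
qed

lemma Afun_has_derivative:
  assumes "0 \<in> Adom E" "R \<in> Adom E"
  shows "(Afun E has_real_derivative Adens E R) (at R)"
proof -
  have iv: "is_interval (Adom E)" using Adom_props(2) is_interval_connected_1 by blast
  obtain e where e: "e > 0" "cball 0 e \<subseteq> Adom E"
    using Adom_props(1) assms(1) open_contains_cball by blast
  obtain d where d: "d > 0" "cball R d \<subseteq> Adom E"
    using Adom_props(1) assms(2) open_contains_cball by blast
  define a b where "a = min (- e) (R - d)" and "b = max e (R + d)"
  have "- e \<in> cball 0 e" "e \<in> cball 0 e" "R - d \<in> cball R d" "R + d \<in> cball R d"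
    using e(1) d(1) by (simp_all add: dist_real_def)
  then have "a \<in> Adom E" "b \<in> Adom E"
    unfolding a_def b_def min_def max_def using subsetD[OF e(2)] subsetD[OF d(2)] by presburger+
  then have sub: "{a..b} \<subseteq> Adom E"
    using mem_is_interval_1_I[OF iv] by (meson atLeastAtMost_iff subsetI)
  have ab: "a \<le> 0" "0 \<le> b" "a < R" "R < b"
    using e(1) d(1) unfolding a_def b_def by linarith+
  have "continuous_on {a..b} (Adens E)"
    using sub Adom_props(3) isCont_Adens by (intro continuous_at_imp_continuous_on) blast
  then have "((\<lambda>u. LBINT y=ereal 0..ereal u. Adens E y) has_vector_derivative Adens E R)
      (at R within {a..b})"
    using ab by (intro interval_integral_FTC2) auto
  then have "((\<lambda>u. LBINT y=ereal 0..ereal u. Adens E y) has_vector_derivative Adens E R) (at R)"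
    using ab by (simp add: at_within_Icc_at)
  then show ?thesis
    by (simp add: Afun_def[abs_def] has_real_derivative_iff_has_vector_derivative zero_ereal_def)
qed

lemma Afun_inj:
  assumes "0 \<in> Adom E"
  shows "inj_on (Afun E) (Adom E)"
proof (rule linorder_inj_onI')
  fix x y assume xy: "x \<in> Adom E" "y \<in> Adom E" "x < y"
  have "is_interval (Adom E)" using Adom_props(2) is_interval_connected_1 by blast
  then have sub: "{x..y} \<subseteq> Adom E" 
    using mem_is_interval_1_I[OF _ xy(1,2)] by (meson atLeastAtMost_iff subsetI)
  obtain z where z: "x < z" "z < y" "Afun E y - Afun E x = (y - x) * Adens E z"
    using MVT2[OF xy(3), of "Afun E" "Adens E"] Afun_has_derivative[OF assms] sub
    by (metis atLeastAtMost_iff subsetD)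
  then have "z \<in> Adom E" using sub by auto
  then have "Adens E z \<noteq> 0" using Adom_props(3) by blast
  then show "Afun E x \<noteq> Afun E y" using z xy by auto
qed

lemma amplitude_small_attainable:
  assumes nd: "nondegenerate E" and seed: "admissible_seed \<phi> U1 U2 \<delta> b p"
  shows "\<exists>l0>0. \<forall>l. 0 < l \<and> l \<le> l0 \<longrightarrow> amplitude_small E (\<lambda>U. l * \<phi> U) U1 U2"
proof -
  have H: "Hbar E \<in> Hdom E" "Ffun E (Hbar E) = 0" using E by (auto simp: equation_of_state_def)
  then have R0: "0 \<in> Rdom E" by (force simp: Rdom_def)
  have e0: "enthalpy E 0 = Hbar E"
    using H the_inv_into_f_f[OF Ffun_inj] unfolding enthalpy_def by fastforce
  have A0: "Adens E 0 \<noteq> 0"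
    using nd by (simp add: Adens_def e0 nondegenerate_def u0_def u1_def)
  have c0: "0 < csnd E 0" using csnd_props R0 by auto
  define k where "k = (\<lambda>R. csnd E R - \<bar>u1 R / u0 R\<bar>)"
  have "isCont k 0"
    unfolding k_def u0_def u1_def
    by (intro continuous_intros DERIV_isCont[OF csnd_props(3)[OF R0]]) auto
  then have "(k \<longlongrightarrow> k 0) (nhds 0)" by (simp add: isCont_def tendsto_at_iff_tendsto_nhds)
  moreover have "k 0 > 0" using c0 by (simp add: k_def u1_def)
  ultimately have ev1: "\<forall>\<^sub>F R in nhds 0. 0 < k R" by (rule order_tendstoD(1))
  have "(Adens E \<longlongrightarrow> Adens E 0) (nhds 0)"
    using isCont_Adens[OF R0] by (simp add: isCont_def tendsto_at_iff_tendsto_nhds)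
  then have ev2: "\<forall>\<^sub>F R in nhds 0. Adens E R \<noteq> 0" using A0 by (rule tendsto_imp_eventually_ne)
  have ev3: "\<forall>\<^sub>F R in nhds 0. R \<in> Rdom E"
    using open_Rdom R0 eventually_nhds by blast
  obtain e where e: "e > 0"
    and eW: "\<And>R. \<bar>R\<bar> < e \<Longrightarrow> R \<in> Rdom E \<and> Adens E R \<noteq> 0 \<and> \<bar>u1 R / u0 R\<bar> < csnd E R"
    using eventually_conj[OF ev3 eventually_conj[OF ev2 ev1]]
    by (auto simp: eventually_nhds_metric dist_real_def k_def)
  define I where "I = ball (0::real) e"
  have IA: "I \<subseteq> Adom E"
    unfolding Adom_def using e eW by (intro connected_component_maximal) (auto simp: I_def)
  have zA: "0 \<in> Adom E" using IA e by (auto simp: I_def)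
  have "continuous_on I (Afun E)"
    using IA Afun_has_derivative[OF zA] DERIV_isCont
    by (intro continuous_at_imp_continuous_on) blast
  then have "open (Afun E ` I)"
    using inj_on_subset[OF Afun_inj[OF zA] IA] by (intro invariance_of_domain) (auto simp: I_def)
  moreover have "Afun E 0 = 0" by (simp add: Afun_def zero_ereal_def)
  then have "0 \<in> Afun E ` I" using e by (force simp: I_def)
  ultimately obtain \<eta> where eta: "\<eta> > 0" "ball 0 \<eta> \<subseteq> Afun E ` I"
    using open_contains_ball by blast
  have "continuous_on {-U1..U2} \<phi>"
    using seed smooth_on_open_deriv(1)[of UNIV \<phi>] DERIV_isCont
    unfolding admissible_seed_def by (intro continuous_at_imp_continuous_on) blast
  then have "bounded (\<phi> ` {-U1..U2})"
    by (intro compact_imp_bounded compact_continuous_image) auto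
  then obtain K where K: "K > 0" "\<And>U. U \<in> {-U1..U2} \<Longrightarrow> \<bar>\<phi> U\<bar> \<le> K"
    by (metis bounded_pos imageI real_norm_def)
  have K': "\<bar>\<phi> U\<bar> \<le> K" for U
    using K seed unfolding admissible_seed_def by (metis abs_zero less_imp_le)
  have "amplitude_small E (\<lambda>U. l * \<phi> U) U1 U2" if l: "0 < l" "l \<le> \<eta> / (2 * K)" for l
  proof -
    have "\<exists>R\<in>I. Afun E R = l * \<phi> U \<and> Ainv E (l * \<phi> U) = R" for U
    proof -
      have "\<bar>l * \<phi> U\<bar> \<le> \<eta> / (2 * K) * K"
        unfolding abs_mult using l K' K by (intro mult_mono) auto
      then have "l * \<phi> U \<in> Afun E ` I" using eta K by (auto simp: subset_iff)
      then obtain R where R: "R \<in> I" "Afun E R = l * \<phi> U" by auto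
      then have "Ainv E (l * \<phi> U) = R"
        unfolding Ainv_def using the_inv_into_f_f[OF Afun_inj[OF zA], of R] IA by auto
      then show ?thesis using R by blast
    qed
    then obtain \<rho> where \<rho>: "\<And>U. \<rho> U \<in> I" "\<And>U. Afun E (\<rho> U) = l * \<phi> U"
      "initial_data E (\<lambda>U. l * \<phi> U) = \<rho>"
      unfolding initial_data_def[abs_def] by metis
    have "{H \<in> Hdom E. 0 < sound E H \<and> sound E H \<le> 1} = Hdom E" "open (Hdom E)"
      using E by (auto simp: equation_of_state_def)
    moreover have "\<rho> U \<in> Rdom E \<and> Adens E (\<rho> U) \<noteq> 0 \<and> \<bar>u1 (\<rho> U) / u0 (\<rho> U)\<bar> < csnd E (\<rho> U)"
      for U using eW \<rho>(1)[of U] by (auto simp: I_def)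
    moreover have "deriv (Afun E) (\<rho> U) = Adens E (\<rho> U)" for U
      using Afun_has_derivative[OF zA] \<rho>(1) IA DERIV_imp_deriv by blast
    moreover have "l * \<phi> U \<in> Afun E ` Adom E" for U
      using \<rho>(1,2) IA by (metis imageI subsetD)
    ultimately show ?thesis
      unfolding amplitude_small_def \<rho>(3) using enthalpy_props(1) by (auto simp: interior_open)
  qed
  then show ?thesis using eta K by (intro exI[of _ "\<eta> / (2 * K)"]) auto
qed

end

end

theory Submission
  imports Defs
begin

text \<open>
  In geometric coordinates the equation \<open>L R = 0\<close> says that \<open>R (t, U) = R0 U\<close>, so the whole solution is
  explicit.  The rectangular coordinate is \<open>x1 (t, U) = t * L1 (R0 U) - U\<close>.  The derivative of \<open>L1\<close> is
  minus the density of \<open>\<AA>\<close>, and the data are chosen such that \<open>\<AA> (R0 U) = \<phi> U\<close>; therefore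
  \<open>\<partial>x1 / \<partial>U = - (1 + t * \<phi>' U)\<close>, that is, \<open>\<mu>\<close> equals the positive function \<open>N U = n / c\<close> of \<open>U\<close> times
  \<open>m = 1 + t * \<phi>' U\<close>.  The theorem is thus a statement about the fold \<open>(t, U) \<mapsto> (t, x1)\<close>, and it is
  governed by the nondegenerate minimum of \<open>\<phi>'\<close> at \<open>0\<close>.

  The density vanishes exactly at \<open>t = - 1 / \<phi>' U\<close>, and Taylor's formula for \<open>\<phi>'\<close> gives the shape of the
  singular curve (\<open>\<psi>_taylor\<close>, \<open>comparable_tS\<close>).  The Cauchy horizon solves \<open>tCH' = N / 2 * m\<close>, which is a
  linear equation for \<open>tCH\<close>; hence it exists, is unique, and along it \<open>m\<close> solves a linear equation
  with source of size \<open>U\<close>, so that \<open>m\<close> has size \<open>U\<^sup>2\<close> and \<open>tCH - T\<close> has size \<open>U\<^sup>3\<close> (\<open>comparable_tCH\<close>).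
  The constants hidden in these estimates come from continuous positive functions on compact
  intervals.

  For the rectangular picture the main point is injectivity of the change of variables on the closed
  region (\<open>x_strict\<close>).  Up to time \<open>T\<close> it is monotonicity in \<open>U\<close>.  Later, a horizontal line
  meets the region in two pieces; since the singular curve moves to the right (\<open>L1 > 0\<close>) and the
  Cauchy horizon to the left (\<open>Lb1 < 0\<close>), the crease separates their images.  Compactness makes the
  inverse continuous, and where \<open>m > 0\<close> its \<open>U\<close>-component satisfies a differential equation that
  makes it smooth across the boundary of the region (\<open>local_inverse\<close>).  The gradient of \<open>R\<close> is
  \<open>R0' / m\<close> up to sign, with \<open>R0'\<close> away from \<open>0\<close>, so it blows up like \<open>1 / \<mu>\<close>.

  The velocities of the images of the Cauchy horizon and of the singular curve are multiples of the
  null vectors \<open>(1, Lb1)\<close> and \<open>(1, L1)\<close>.  Hence both images are graphs over \<open>t\<close> with these slopes, even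
  at the crease, where the velocities vanish (\<open>reparametrised_slope\<close>); that determines all
  tangent vectors and the causal structure.
\<close>

section \<open>Smooth functions\<close>

text \<open>Derivatives at a point of an open set depend only on the values in that set, so each order of
  differentiability can be transferred along equality on it.\<close>

lemma higher_differentiable_on_cong:
  assumes "open T" "\<And>x. x \<in> T \<Longrightarrow> f x = g x" "higher_differentiable_on n T f"
  shows "higher_differentiable_on n T g"
  using assms(2,3)
proof (induction n arbitrary: f g)
  case 0
  then show ?case using continuous_on_cong[of T T f g] by simp
next
  case (Suc n)
  have d: "(g has_derivative frechet_derivative f (at x)) (at x)" if "x \<in> T" for x
  proof (rule has_derivative_transform_within_open[OF _ assms(1) that])
    show "(f has_derivative frechet_derivative f (at x)) (at x)"
      using Suc.prems(2) that frechet_derivative_works by auto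
  qed (use Suc.prems in auto)
  have e: "frechet_derivative f (at x) = frechet_derivative g (at x)" if "x \<in> T" for x
    using frechet_derivative_at[OF d[OF that]] by simp
  have "higher_differentiable_on n T (\<lambda>x. frechet_derivative g (at x) v)" for v
    by (rule Suc.IH[where f = "\<lambda>x. frechet_derivative f (at x) v"])
      (use e Suc.prems(2) in auto)
  with d show ?case by (auto simp: differentiable_def)
qed

text \<open>The introduction rule behind all closure properties: any family of derivatives will do, since
  derivatives are unique.\<close>

lemma higher_differentiable_on_SucI:
  assumes "open T" "\<And>x. x \<in> T \<Longrightarrow> (f has_derivative D x) (at x)"
    "\<And>v. higher_differentiable_on n T (\<lambda>x. D x v)"
  shows "higher_differentiable_on (Suc n) T f"
proof -
  have "higher_differentiable_on n T (\<lambda>x. frechet_derivative f (at x) v)" for v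
    by (rule higher_differentiable_on_cong[OF assms(1) _ assms(3)[of v]])
      (use frechet_derivative_at[OF assms(2)] in auto)
  then show ?thesis using assms(2) by (auto simp: differentiable_def)
qed

lemma higher_differentiable_on_SucD:
  "higher_differentiable_on (Suc n) T f \<Longrightarrow> higher_differentiable_on n T f"
proof (induction n arbitrary: f)
  case 0
  then show ?case
    by (auto intro!: continuous_at_imp_continuous_on differentiable_imp_continuous_within)
next
  case (Suc n)
  then show ?case by (metis higher_differentiable_on.simps(2))
qed

lemma higher_differentiable_on_has_derivative:
  assumes "higher_differentiable_on (Suc n) T f" "x \<in> T"
  shows "(f has_derivative frechet_derivative f (at x)) (at x)"
  using assms frechet_derivative_works by auto

lemma higher_differentiable_on_subset:
  "higher_differentiable_on n T f \<Longrightarrow> S \<subseteq> T \<Longrightarrow> higher_differentiable_on n S f"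
  by (induction n arbitrary: f) (auto intro: continuous_on_subset)

lemma higher_differentiable_on_local:
  assumes "\<And>x. x \<in> S \<Longrightarrow> \<exists>T. open T \<and> x \<in> T \<and> higher_differentiable_on n T f"
  shows "higher_differentiable_on n S f"
  using assms
proof (induction n arbitrary: f)
  case 0
  have "isCont f x" if "x \<in> S" for x
    using 0[OF that] continuous_on_eq_continuous_at by auto
  then show ?case by (simp add: continuous_at_imp_continuous_on)
next
  case (Suc n)
  show ?case
    unfolding higher_differentiable_on.simps
  proof (intro conjI ballI allI)
    show "f differentiable (at x)" if "x \<in> S" for x
      using Suc.prems[OF that] by auto
    show "higher_differentiable_on n S (\<lambda>x. frechet_derivative f (at x) v)" for v
      by (rule Suc.IH) (use Suc.prems in fastforce)
  qed
qed

text \<open>On an open set the local extensions in the definition of smoothness are locally equal to the function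
  itself, so smoothness means differentiability of every order.\<close>

lemma smooth_on_open_iff:
  assumes "open S"
  shows "smooth_on S f \<longleftrightarrow> (\<forall>n. higher_differentiable_on n S f)"
proof (intro iffI allI)
  fix n assume *: "smooth_on S f"
  show "higher_differentiable_on n S f"
  proof (rule higher_differentiable_on_local)
    fix x assume "x \<in> S"
    then obtain T g where T: "open T" "x \<in> T" "\<And>n. higher_differentiable_on n T g"
      "\<And>y. y \<in> S \<inter> T \<Longrightarrow> f y = g y"
      using * unfolding smooth_on_def by meson
    have "higher_differentiable_on n (S \<inter> T) f"
      by (rule higher_differentiable_on_cong[where f = g])
        (use T assms in \<open>auto intro: higher_differentiable_on_subset\<close>)
    then show "\<exists>T. open T \<and> x \<in> T \<and> higher_differentiable_on n T f"
      using T(1,2) \<open>x \<in> S\<close> assms by (intro exI[of _ "S \<inter> T"]) auto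
  qed
qed (use assms in \<open>auto simp: smooth_on_def\<close>)

lemma higher_differentiable_on_const: "higher_differentiable_on n T (\<lambda>x. c)"
  by (induction n arbitrary: c) simp_all

lemma higher_differentiable_on_bounded_linear:
  assumes "bounded_linear f"
  shows "higher_differentiable_on n T f"
proof (cases n)
  case 0
  then show ?thesis using assms by (simp add: linear_continuous_on)
next
  case (Suc k)
  have "(f has_derivative f) (at x)" for x
    by (rule bounded_linear_imp_has_derivative[OF assms])
  then have "frechet_derivative f (at x) = f" for x
    by (metis frechet_derivative_at)
  then show ?thesis
    using Suc assms by (auto simp: higher_differentiable_on_const bounded_linear_imp_differentiable)
qed

lemmas higher_differentiable_on_ident =
  higher_differentiable_on_bounded_linear[OF bounded_linear_ident]
lemmas higher_differentiable_on_fst =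
  higher_differentiable_on_bounded_linear[OF bounded_linear_fst]
lemmas higher_differentiable_on_snd =
  higher_differentiable_on_bounded_linear[OF bounded_linear_snd]

lemma higher_differentiable_on_add:
  assumes "open T" "higher_differentiable_on n T f" "higher_differentiable_on n T g"
  shows "higher_differentiable_on n T (\<lambda>x. f x + g x)"
  using assms(2,3)
proof (induction n arbitrary: f g)
  case 0
  then show ?case by (auto intro: continuous_on_add)
next
  case (Suc n)
  show ?case
    by (rule higher_differentiable_on_SucI[OF assms(1)
          has_derivative_add[OF higher_differentiable_on_has_derivative[OF Suc.prems(1)]
            higher_differentiable_on_has_derivative[OF Suc.prems(2)]]])
      (use Suc in auto)
qed

lemma higher_differentiable_on_mult:
  fixes f g :: "'a::real_normed_vector \<Rightarrow> real"
  assumes "open T" "higher_differentiable_on n T f" "higher_differentiable_on n T g"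
  shows "higher_differentiable_on n T (\<lambda>x. f x * g x)"
  using assms(2,3)
proof (induction n arbitrary: f g)
  case 0
  then show ?case by (auto intro: continuous_on_mult)
next
  case (Suc n)
  show ?case
    by (rule higher_differentiable_on_SucI[OF assms(1)
          has_derivative_mult[OF higher_differentiable_on_has_derivative[OF Suc.prems(1)]
            higher_differentiable_on_has_derivative[OF Suc.prems(2)]]])
      (assumption, assumption, intro higher_differentiable_on_add[OF assms(1)] Suc.IH,
        use Suc.prems higher_differentiable_on_SucD[OF Suc.prems(1)]
          higher_differentiable_on_SucD[OF Suc.prems(2)] in auto)
qed

lemma higher_differentiable_on_diff:
  fixes f g :: "'a::real_normed_vector \<Rightarrow> real"
  assumes "open T" "higher_differentiable_on n T f" "higher_differentiable_on n T g"
  shows "higher_differentiable_on n T (\<lambda>x. f x - g x)"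
proof -
  have "higher_differentiable_on n T (\<lambda>x. f x + (- 1) * g x)"
    by (intro higher_differentiable_on_add higher_differentiable_on_mult
        higher_differentiable_on_const assms)
  then show ?thesis by simp
qed

lemma higher_differentiable_on_minus:
  fixes f :: "'a::real_normed_vector \<Rightarrow> real"
  assumes "open T" "higher_differentiable_on n T f"
  shows "higher_differentiable_on n T (\<lambda>x. - f x)"
  using higher_differentiable_on_diff[OF assms(1) higher_differentiable_on_const assms(2), of 0]
  by simp

lemma higher_differentiable_on_power:
  fixes f :: "'a::real_normed_vector \<Rightarrow> real"
  assumes "open T" "higher_differentiable_on n T f"
  shows "higher_differentiable_on n T (\<lambda>x. f x ^ k)"
  by (induction k)
    (use assms in \<open>auto intro: higher_differentiable_on_const higher_differentiable_on_mult\<close>)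

lemma higher_differentiable_on_Pair:
  assumes "open T" "higher_differentiable_on n T f" "higher_differentiable_on n T g"
  shows "higher_differentiable_on n T (\<lambda>x. (f x, g x))"
  using assms(2,3)
proof (induction n arbitrary: f g)
  case 0
  then show ?case by (auto intro: continuous_on_Pair)
next
  case (Suc n)
  show ?case
    by (rule higher_differentiable_on_SucI[OF assms(1)
          has_derivative_Pair[OF higher_differentiable_on_has_derivative[OF Suc.prems(1)]
            higher_differentiable_on_has_derivative[OF Suc.prems(2)]]])
      (use Suc in auto)
qed

lemma frechet_derivative_real:
  fixes f :: "real \<Rightarrow> real"
  assumes "f differentiable (at x)"
  shows "frechet_derivative f (at x) v = deriv f x * v"
proof -
  have "(f has_real_derivative deriv f x) (at x)"
    using assms DERIV_deriv_iff_real_differentiable by blast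
  then show ?thesis
    by (metis frechet_derivative_at has_field_derivative_def)
qed

lemma higher_differentiable_on_Suc_real:
  fixes f :: "real \<Rightarrow> real"
  assumes "open T"
  shows "higher_differentiable_on (Suc n) T f \<longleftrightarrow>
    (\<forall>x\<in>T. f differentiable (at x)) \<and> higher_differentiable_on n T (deriv f)"
proof
  assume *: "higher_differentiable_on (Suc n) T f"
  have "higher_differentiable_on n T (\<lambda>x. frechet_derivative f (at x) 1)" using * by simp
  from higher_differentiable_on_cong[OF assms _ this, of "deriv f"] *
  show "(\<forall>x\<in>T. f differentiable (at x)) \<and> higher_differentiable_on n T (deriv f)"
    by (simp add: frechet_derivative_real)
next
  assume *: "(\<forall>x\<in>T. f differentiable (at x)) \<and> higher_differentiable_on n T (deriv f)"
  show "higher_differentiable_on (Suc n) T f"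
  proof (rule higher_differentiable_on_SucI[OF assms, where D = "\<lambda>x v. deriv f x * v"])
    show "(f has_derivative (*) (deriv f x)) (at x)" if "x \<in> T" for x
      using * that DERIV_deriv_iff_real_differentiable has_field_derivative_def by blast
    show "higher_differentiable_on n T (\<lambda>x. deriv f x * v)" for v
      using * by (intro higher_differentiable_on_mult higher_differentiable_on_const assms) auto
  qed
qed

text \<open>The outer function has one real variable, so the chain rule produces a product and the
  induction on the order closes.\<close>

lemma higher_differentiable_on_compose:
  fixes f :: "real \<Rightarrow> real" and g :: "'a::real_normed_vector \<Rightarrow> real"
  assumes "open S" "open T" "higher_differentiable_on n S f" "higher_differentiable_on n T g"
    "g ` T \<subseteq> S"
  shows "higher_differentiable_on n T (\<lambda>x. f (g x))"
  using assms(3,4)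
proof (induction n arbitrary: f)
  case 0
  then show ?case using assms(5) by (auto intro: continuous_on_compose2)
next
  case (Suc n)
  have f: "(f has_derivative (*) (deriv f y)) (at y)" if "y \<in> S" for y
    using Suc.prems(1) that DERIV_deriv_iff_real_differentiable
    by (metis has_field_derivative_def higher_differentiable_on.simps(2))
  show ?case
  proof (rule higher_differentiable_on_SucI[OF assms(2),
        where D = "\<lambda>x v. deriv f (g x) * frechet_derivative g (at x) v"])
    fix x assume "x \<in> T"
    then show "((\<lambda>x. f (g x)) has_derivative (\<lambda>v. deriv f (g x) * frechet_derivative g (at x) v))
        (at x)"
      using has_derivative_compose[OF higher_differentiable_on_has_derivative[OF Suc.prems(2)] f]
        assms(5) by auto
  next
    fix v
    have "higher_differentiable_on n S (deriv f)"
      using Suc.prems(1) higher_differentiable_on_Suc_real[OF assms(1)] by blast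
    from Suc.IH[OF this higher_differentiable_on_SucD[OF Suc.prems(2)]]
    show "higher_differentiable_on n T (\<lambda>x. deriv f (g x) * frechet_derivative g (at x) v)"
      using Suc.prems(2) by (intro higher_differentiable_on_mult assms(2)) auto
  qed
qed

lemma higher_differentiable_on_inverse:
  fixes g :: "'a::real_normed_vector \<Rightarrow> real"
  assumes "open T" "higher_differentiable_on n T g" "\<And>x. x \<in> T \<Longrightarrow> g x \<noteq> 0"
  shows "higher_differentiable_on n T (\<lambda>x. inverse (g x))"
proof -
  have o: "open (- {0::real})" by auto
  have "higher_differentiable_on n (- {0}) (inverse :: real \<Rightarrow> real)"
  proof (induction n)
    case 0
    then show ?case by (auto intro!: continuous_intros)
  next
    case (Suc n)
    show ?case
    proof (rule higher_differentiable_on_SucI[OF o])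
      show "(inverse has_derivative (\<lambda>h. - (inverse x * h * inverse x))) (at x)"
        if "x \<in> - {0::real}" for x
        using that by (intro has_derivative_inverse') auto
      show "higher_differentiable_on n (- {0}) (\<lambda>x::real. - (inverse x * v * inverse x))" for v
        by (intro higher_differentiable_on_minus higher_differentiable_on_mult o Suc
            higher_differentiable_on_const)
    qed
  qed
  then show ?thesis
    by (rule higher_differentiable_on_compose[OF o assms(1) _ assms(2)]) (use assms(3) in auto)
qed

lemma higher_differentiable_on_divide:
  fixes f g :: "'a::real_normed_vector \<Rightarrow> real"
  assumes "open T" "higher_differentiable_on n T f" "higher_differentiable_on n T g"
    "\<And>x. x \<in> T \<Longrightarrow> g x \<noteq> 0"
  shows "higher_differentiable_on n T (\<lambda>x. f x / g x)"
  unfolding divide_inverse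
  by (intro higher_differentiable_on_mult higher_differentiable_on_inverse assms)

text \<open>A solution of an autonomous equation is as smooth as the right-hand side, because its derivative is
  again a function of the solution.  Inverse functions satisfy such equations.\<close>

lemma higher_differentiable_on_ode:
  fixes g h :: "real \<Rightarrow> real"
  assumes "open S" "open T" "\<And>n. higher_differentiable_on n S h" "g ` T \<subseteq> S"
    "\<And>x. x \<in> T \<Longrightarrow> (g has_real_derivative h (g x)) (at x)"
  shows "higher_differentiable_on n T g"
proof (induction n)
  case 0
  then show ?case
    using assms(5) by (auto intro!: continuous_at_imp_continuous_on DERIV_isCont)
next
  case (Suc n)
  show ?case
  proof (rule higher_differentiable_on_SucI[OF assms(2), where D = "\<lambda>x v. h (g x) * v"])
    show "(g has_derivative (*) (h (g x))) (at x)" if "x \<in> T" for x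
      using assms(5)[OF that] by (simp add: has_field_derivative_def)
    show "higher_differentiable_on n T (\<lambda>x. h (g x) * v)" for v
      by (intro higher_differentiable_on_mult higher_differentiable_on_const assms(2)
          higher_differentiable_on_compose[OF assms(1,2,3) Suc assms(4)])
  qed
qed

text \<open>The two functions are derivatives of each other, hence the simultaneous induction.\<close>

lemma higher_differentiable_on_cosh_sinh:
  "higher_differentiable_on n UNIV (cosh :: real \<Rightarrow> real)"
  "higher_differentiable_on n UNIV (sinh :: real \<Rightarrow> real)"
proof (induction n)
  case 0
  { case 1 show ?case by (auto intro!: continuous_intros) }
  { case 2 show ?case by (auto intro!: continuous_intros) }
next
  case (Suc n)
  have m: "higher_differentiable_on n UNIV (\<lambda>x. f x * v)"
    if "higher_differentiable_on n UNIV f" for f :: "real \<Rightarrow> real" and v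
    by (intro higher_differentiable_on_mult higher_differentiable_on_const that open_UNIV)
  { case 1 show ?case
      by (rule higher_differentiable_on_SucI[OF open_UNIV, where D = "\<lambda>x v. sinh x * v"])
        (use m Suc has_field_derivative_cosh[OF DERIV_ident] in \<open>auto simp: has_field_derivative_def\<close>) }
  { case 2 show ?case
      by (rule higher_differentiable_on_SucI[OF open_UNIV, where D = "\<lambda>x v. cosh x * v"])
        (use m Suc has_field_derivative_sinh[OF DERIV_ident] in \<open>auto simp: has_field_derivative_def\<close>) }
qed

lemmas higher_differentiable_on_intros =
  higher_differentiable_on_const higher_differentiable_on_ident
  higher_differentiable_on_fst higher_differentiable_on_snd
  higher_differentiable_on_add higher_differentiable_on_diff higher_differentiable_on_minus
  higher_differentiable_on_mult higher_differentiable_on_power higher_differentiable_on_divide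
  higher_differentiable_on_Pair

section \<open>The acoustical metric of simple flow\<close>

lemma u0_pos: "0 < u0 R" and u0_sq: "(u0 R)\<^sup>2 = (u1 R)\<^sup>2 + 1"
  by (simp_all add: u0_def u1_def cosh_square_eq)

lemma higher_differentiable_on_u:
  "higher_differentiable_on n UNIV u0" "higher_differentiable_on n UNIV u1"
  unfolding u0_def[abs_def] u1_def[abs_def]
  by (rule higher_differentiable_on_compose[OF open_UNIV open_UNIV
        higher_differentiable_on_cosh_sinh(1)],
      auto intro!: higher_differentiable_on_intros)
    (rule higher_differentiable_on_compose[OF open_UNIV open_UNIV
        higher_differentiable_on_cosh_sinh(2)],
      auto intro!: higher_differentiable_on_intros)

lemma hmat_nth:
  "hmat E R $ 1 $ 1 = nfac E R * (- 1 / (csnd E R)\<^sup>2 + (1 / (csnd E R)\<^sup>2 - 1) * (u0 R)\<^sup>2)"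
  "hmat E R $ 1 $ 2 = nfac E R * (- (1 / (csnd E R)\<^sup>2 - 1) * u0 R * u1 R)"
  "hmat E R $ 2 $ 1 = nfac E R * (- (1 / (csnd E R)\<^sup>2 - 1) * u0 R * u1 R)"
  "hmat E R $ 2 $ 2 = nfac E R * (1 / (csnd E R)\<^sup>2 + (1 / (csnd E R)\<^sup>2 - 1) * (u1 R)\<^sup>2)"
  by (simp_all add: hmat_def minkowski_def u_lower_def matrix_vector_mult_def sum_2
      power2_eq_square) (simp_all add: algebra_simps)

lemma hprod_eq:
  "hprod E R v w = hmat E R $ 1 $ 1 * fst v * fst w
     + hmat E R $ 1 $ 2 * (fst v * snd w + snd v * fst w) + hmat E R $ 2 $ 2 * snd v * snd w"
proof -
  have "hmat E R $ 2 $ 1 = hmat E R $ 1 $ 2" by (simp add: hmat_nth)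
  then show ?thesis by (simp add: hprod_def vec2_def sum_2 algebra_simps)
qed

lemma hprod_scale: "hprod E R (a *\<^sub>R v) (b *\<^sub>R w) = a * b * hprod E R v w"
  by (simp add: hprod_eq algebra_simps)

lemma matrix_inv_2:
  fixes A :: "real ^ 2 ^ 2"
  assumes "A $ 1 $ 1 * A $ 2 $ 2 - A $ 1 $ 2 * A $ 2 $ 1 \<noteq> 0" (is "?d \<noteq> 0")
  shows "invertible A" "matrix_inv A $ 1 $ 1 = A $ 2 $ 2 / ?d" "matrix_inv A $ 1 $ 2 = - A $ 1 $ 2 / ?d"
    "matrix_inv A $ 2 $ 1 = - A $ 2 $ 1 / ?d" "matrix_inv A $ 2 $ 2 = A $ 1 $ 1 / ?d"
proof -
  define B :: "real ^ 2 ^ 2"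
    where "B = vector [vector [A$2$2 / ?d, - A$1$2 / ?d], vector [- A$2$1 / ?d, A$1$1 / ?d]]"
  show inv: "invertible A" using assms by (simp add: invertible_det_nz det_2)
  have "?d * inverse ?d = 1" using assms by simp
  then have "A ** B = mat 1"
    by (simp add: vec_eq_iff forall_2 matrix_matrix_mult_def sum_2 B_def mat_def divide_inverse
        algebra_simps)
  moreover have "matrix_inv A ** A = mat 1"
    using inv unfolding invertible_def matrix_inv_def by (metis (mono_tags, lifting) someI_ex)
  ultimately have "B = matrix_inv A"
    by (metis matrix_mul_assoc matrix_mul_lid matrix_mul_rid)
  then show "matrix_inv A $ 1 $ 1 = A $ 2 $ 2 / ?d" "matrix_inv A $ 1 $ 2 = - A $ 1 $ 2 / ?d"
    "matrix_inv A $ 2 $ 1 = - A $ 2 $ 1 / ?d" "matrix_inv A $ 2 $ 2 = A $ 1 $ 1 / ?d"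
    by (simp_all add: B_def flip: \<open>B = matrix_inv A\<close>)
qed

text \<open>A symmetric matrix of negative determinant has real eigenvalues of opposite signs: the
  characteristic polynomial is negative at 0.\<close>

lemma lorentzian_if_det_neg:
  fixes A :: "real ^ 2 ^ 2"
  assumes sym: "A $ 1 $ 2 = A $ 2 $ 1" and det: "det A < 0"
  shows "lorentzian A"
proof -
  define tr where "tr = A $ 1 $ 1 + A $ 2 $ 2"
  define s where "s = sqrt (tr\<^sup>2 - 4 * det A)"
  have "4 * det A \<le> tr\<^sup>2" using det by (intro order_trans[OF _ zero_le_power2]) simp
  then have s: "\<bar>tr\<bar> < s" "s\<^sup>2 = tr\<^sup>2 - 4 * det A"
    using det by (auto simp: s_def intro!: real_less_rsqrt)
  have ev: "\<exists>v. v \<noteq> 0 \<and> A *v v = l *\<^sub>R v" if "l\<^sup>2 - tr * l + det A = 0" for l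
  proof -
    have "det (A - l *\<^sub>R mat 1) = 0"
      using that by (simp add: det_2 tr_def mat_def algebra_simps power2_eq_square)
    then have "\<not> invertible (A - l *\<^sub>R mat 1)" by (simp add: invertible_det_nz)
    then obtain v where "v \<noteq> 0" "(A - l *\<^sub>R mat 1) *v v = 0"
      by (metis invertible_left_inverse matrix_left_invertible_ker)
    then show ?thesis
      by (auto simp: matrix_vector_mult_diff_rdistrib simp flip: scaleR_matrix_vector_assoc)
  qed
  have "((tr - s) / 2)\<^sup>2 - tr * ((tr - s) / 2) + det A = 0"
    "((tr + s) / 2)\<^sup>2 - tr * ((tr + s) / 2) + det A = 0"
    using s(2) by (simp_all add: power2_eq_square field_simps)
  moreover have "(tr - s) / 2 < 0" "0 < (tr + s) / 2" using s(1) by auto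
  moreover have "transpose A = A"
    using sym by (simp add: transpose_def vec_eq_iff forall_2)
  ultimately show ?thesis unfolding lorentzian_def using ev by blast
qed

context
  fixes E :: eos
  assumes E: "equation_of_state E"
begin

lemma zero_Rdom: "0 \<in> Rdom E" and enthalpy_zero: "enthalpy E 0 = Hbar E"
proof -
  have H: "Hbar E \<in> Hdom E" "Ffun E (Hbar E) = 0" using E by (auto simp: equation_of_state_def)
  then show "0 \<in> Rdom E" by (force simp: Rdom_def)
  show "enthalpy E 0 = Hbar E"
    using H the_inv_into_f_f[OF Ffun_inj[OF E]] unfolding enthalpy_def by fastforce
qed

lemma fluid_zero:
  "csnd E 0 = sound E (Hbar E)" "nfac E 0 = 1" "L1 E 0 = sound E (Hbar E)"
  by (simp_all add: csnd_def nfac_def L1_def u0_def u1_def enthalpy_zero)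

lemma nfac_eq: "nfac E R = (u0 R)\<^sup>2 - (csnd E R)\<^sup>2 * (u1 R)\<^sup>2"
  unfolding nfac_def using u0_sq[of R] by algebra

lemma fluid_pos:
  assumes "R \<in> Rdom E"
  shows "0 < csnd E R" "0 < u0 R + csnd E R * u1 R" "0 < u0 R - csnd E R * u1 R" "0 < nfac E R"
proof -
  note c = csnd_props(1,2)[OF E assms]
  have "\<bar>csnd E R * u1 R\<bar> \<le> \<bar>u1 R\<bar>" using c by (simp add: abs_mult mult_left_le_one_le)
  then show *: "0 < csnd E R" "0 < u0 R + csnd E R * u1 R" "0 < u0 R - csnd E R * u1 R"
    using c abs_u1_less_u0[OF E, of R] by linarith+
  have "nfac E R = (u0 R + csnd E R * u1 R) * (u0 R - csnd E R * u1 R)"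
    unfolding nfac_eq by algebra
  then show "0 < nfac E R" using * by simp
qed

lemma L1_eq: "L1 E R = (u1 R + csnd E R * u0 R) / (u0 R + csnd E R * u1 R)"
  and Lb1_eq: "Lb1 E R = (u1 R - csnd E R * u0 R) / (u0 R - csnd E R * u1 R)"
  using u0_pos[of R] by (simp_all add: L1_def Lb1_def divide_simps) (simp_all add: algebra_simps)

text \<open>This is the identity \<open>X = - (c / n) \<partial>\<^sub>1\<close>: the two null directions differ by twice \<open>X\<close>.\<close>

lemma L1_minus_Lb1:
  assumes "R \<in> Rdom E"
  shows "Lb1 E R = L1 E R - 2 * (csnd E R / nfac E R)"
proof -
  note p = fluid_pos[OF assms]
  have n: "nfac E R = (u0 R + csnd E R * u1 R) * (u0 R - csnd E R * u1 R)"
    unfolding nfac_eq by algebra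
  have "(u1 R + csnd E R * u0 R) * (u0 R - csnd E R * u1 R)
      - (u1 R - csnd E R * u0 R) * (u0 R + csnd E R * u1 R) = 2 * csnd E R"
    using u0_sq[of R] by algebra
  then have "L1 E R - Lb1 E R = 2 * csnd E R / nfac E R"
    unfolding L1_eq Lb1_eq n using p(2,3) by (subst diff_frac_eq) auto
  then show ?thesis by simp
qed

lemma subsonic_signs:
  assumes "R \<in> Rdom E" "\<bar>u1 R / u0 R\<bar> < csnd E R"
  shows "0 < L1 E R" "Lb1 E R < 0"
proof -
  have "\<bar>u1 R\<bar> < csnd E R * u0 R"
    using assms(2) u0_pos[of R] by (simp add: abs_divide divide_simps split: if_splits)
  then have "0 < u1 R + csnd E R * u0 R" "u1 R - csnd E R * u0 R < 0" by linarith+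
  then show "0 < L1 E R" "Lb1 E R < 0"
    unfolding L1_eq Lb1_eq using fluid_pos[OF assms(1)] by (simp_all add: divide_neg_pos)
qed

lemma det_hmat:
  assumes "R \<in> Rdom E"
  shows "hmat E R $ 1 $ 1 * hmat E R $ 2 $ 2 - hmat E R $ 1 $ 2 * hmat E R $ 2 $ 1
    = - (nfac E R / csnd E R)\<^sup>2"
proof -
  define k where "k = 1 / (csnd E R)\<^sup>2"
  have k: "(nfac E R / csnd E R)\<^sup>2 = (nfac E R)\<^sup>2 * k" by (simp add: k_def power_divide)
  have k': "- 1 / (csnd E R)\<^sup>2 = - k" by (simp add: k_def)
  have "hmat E R $ 1 $ 1 * hmat E R $ 2 $ 2 - hmat E R $ 1 $ 2 * hmat E R $ 2 $ 1
    = (nfac E R)\<^sup>2 * ((- k + (k - 1) * (u0 R)\<^sup>2) * (k + (k - 1) * (u1 R)\<^sup>2)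
        - (k - 1)\<^sup>2 * (u0 R)\<^sup>2 * (u1 R)\<^sup>2)"
    unfolding hmat_nth k' k_def[symmetric] by (simp add: power2_eq_square algebra_simps)
  also have "\<dots> = (nfac E R)\<^sup>2 * - k"
    unfolding u0_sq by (simp add: power2_eq_square algebra_simps)
  finally show ?thesis unfolding k by simp
qed

lemma hmat_invertible_lorentzian:
  assumes "R \<in> Rdom E"
  shows "invertible (hmat E R)" "lorentzian (hmat E R)"
proof -
  have "- (nfac E R / csnd E R)\<^sup>2 < 0" using fluid_pos[OF assms] by simp
  then have d: "det (hmat E R) < 0" using det_hmat[OF assms] by (simp add: det_2)
  then show "invertible (hmat E R)" by (simp add: invertible_det_nz)
  show "lorentzian (hmat E R)" by (rule lorentzian_if_det_neg[OF _ d]) (simp add: hmat_nth)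
qed

text \<open>Both characteristic speeds have the form \<open>(S + d * C) / (C + d * S)\<close> with \<open>d = c\<close> and \<open>d = - c\<close>; since
  \<open>d\<^sup>2 = c\<^sup>2\<close> in both cases, one computation serves.\<close>

lemma hprod_null:
  assumes "R \<in> Rdom E"
  shows "hprod E R (L_rect E R) (L_rect E R) = 0" "hprod E R (Lb_rect E R) (Lb_rect E R) = 0"
proof -
  note p = fluid_pos[OF assms]
  define c S C where "c = csnd E R" and "S = u1 R" and "C = u0 R"
  have CS: "C\<^sup>2 = S\<^sup>2 + 1" unfolding C_def S_def by (rule u0_sq)
  have gen: "hprod E R (1, (S + d * C) / (C + d * S)) (1, (S + d * C) / (C + d * S)) = 0"
    if d: "d\<^sup>2 = c\<^sup>2" "C + d * S \<noteq> 0" for d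
  proof -
    define l k where "l = (S + d * C) / (C + d * S)" and "k = 1 / c\<^sup>2"
    have l: "l * (C + d * S) = S + d * C" using d by (simp add: l_def)
    have k: "k * d\<^sup>2 = 1" using d p(1) by (simp add: k_def c_def)
    \<comment> \<open>With \<open>C\<^sup>2 - S\<^sup>2 = 1\<close>, the \<open>h\<close>-length is \<open>k * (l\<^sup>2 - 1) + (k - 1) * (C - S * l)\<^sup>2\<close> up to a factor.\<close>
    have "(C - S * l) * (C + d * S) = C * (C + d * S) - S * (l * (C + d * S))"
      by (simp add: algebra_simps)
    also have "\<dots> = 1" unfolding l using CS by (simp add: algebra_simps power2_eq_square)
    finally have 1: "(C - S * l) * (C + d * S) = 1" .
    have "(l\<^sup>2 - 1) * (C + d * S)\<^sup>2 = (l * (C + d * S))\<^sup>2 - (C + d * S)\<^sup>2"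
      by (simp only: power_mult_distrib left_diff_distrib mult_1)
    also have "\<dots> = (d\<^sup>2 - 1) * (C\<^sup>2 - S\<^sup>2)"
      unfolding l by (simp add: algebra_simps power2_eq_square)
    finally have 2: "(l\<^sup>2 - 1) * (C + d * S)\<^sup>2 = d\<^sup>2 - 1" using CS by simp
    have "(k * (l\<^sup>2 - 1) + (k - 1) * (C - S * l)\<^sup>2) * (C + d * S)\<^sup>2
        = k * ((l\<^sup>2 - 1) * (C + d * S)\<^sup>2) + (k - 1) * ((C - S * l) * (C + d * S))\<^sup>2"
      by (simp only: power_mult_distrib distrib_right mult.assoc)
    also have "\<dots> = 0" unfolding 1 2 using k by (simp add: algebra_simps)
    finally have z: "k * (l\<^sup>2 - 1) + (k - 1) * (C - S * l)\<^sup>2 = 0"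
      using d(2) by simp
    have kk: "1 / (csnd E R)\<^sup>2 = k" "- 1 / (csnd E R)\<^sup>2 = - k" by (simp_all add: k_def c_def)
    have "hprod E R (1, l) (1, l) = nfac E R * (k * (l\<^sup>2 - 1) + (k - 1) * (C - S * l)\<^sup>2)"
      unfolding hprod_eq hmat_nth kk S_def[symmetric] C_def[symmetric]
      by (simp add: power2_eq_square algebra_simps)
    then show ?thesis using z by (simp add: l_def)
  qed
  show "hprod E R (L_rect E R) (L_rect E R) = 0"
    unfolding L_rect_def L1_eq using gen[of c] p(2) by (simp add: c_def S_def C_def)
  show "hprod E R (Lb_rect E R) (Lb_rect E R) = 0"
    unfolding Lb_rect_def Lb1_eq using gen[of "- c"] p(3) by (simp add: c_def S_def C_def)
qed

text \<open>A covector is null for the inverse metric if it annihilates the null vector \<open>L\<close>, since in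
  dimension two its index-raised form is then a multiple of \<open>L\<close>.\<close>

lemma inverse_metric_null:
  assumes "R \<in> Rdom E" "p = - L1 E R * q"
  shows "(\<Sum>\<alpha>\<in>UNIV. \<Sum>\<beta>\<in>UNIV. matrix_inv (hmat E R) $ \<alpha> $ \<beta> * vec2 (p, q) $ \<alpha> * vec2 (p, q) $ \<beta>) = 0"
proof -
  have d: "hmat E R $ 1 $ 1 * hmat E R $ 2 $ 2 - hmat E R $ 1 $ 2 * hmat E R $ 2 $ 1 \<noteq> 0" (is "?d \<noteq> 0")
    using det_hmat[OF assms(1)] fluid_pos[OF assms(1)] by simp
  have "(\<Sum>\<alpha>\<in>UNIV. \<Sum>\<beta>\<in>UNIV. matrix_inv (hmat E R) $ \<alpha> $ \<beta> * vec2 (p, q) $ \<alpha> * vec2 (p, q) $ \<beta>)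
      = hprod E R (L_rect E R) (L_rect E R) * (q\<^sup>2 / ?d)"
    unfolding hprod_eq sum_2 matrix_inv_2[OF d] assms(2)
    by (simp add: vec2_def L_rect_def divide_inverse power2_eq_square hmat_nth(2,3) algebra_simps)
  then show ?thesis using hprod_null(1)[OF assms(1)] by simp
qed

text \<open>The enthalpy as a function of the Riemann invariant solves an autonomous equation.\<close>

lemma higher_differentiable_on_enthalpy: "higher_differentiable_on n (Rdom E) (enthalpy E)"
proof (rule higher_differentiable_on_ode[where S = "Hdom E" and h = "\<lambda>H. H * sound E H / 2"])
  show o: "open (Hdom E)" "open (Rdom E)"
    using E open_Rdom[OF E] by (auto simp: equation_of_state_def)
  show "higher_differentiable_on k (Hdom E) (\<lambda>H. H * sound E H / 2)" for k
    using E o smooth_on_open_iff[OF o(1)]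
    by (intro higher_differentiable_on_intros) (auto simp: equation_of_state_def)
  show "enthalpy E ` Rdom E \<subseteq> Hdom E" using enthalpy_props(1)[OF E] by auto
  show "(enthalpy E has_real_derivative enthalpy E R * sound E (enthalpy E R) / 2) (at R)"
    if "R \<in> Rdom E" for R using enthalpy_props(3)[OF E that] by (simp add: csnd_def)
qed

lemma higher_differentiable_on_eos_compose:
  fixes f :: "real \<Rightarrow> real"
  assumes "\<And>k. higher_differentiable_on k (Hdom E) f"
  shows "higher_differentiable_on n (Rdom E) (\<lambda>R. f (enthalpy E R))"
  by (rule higher_differentiable_on_compose[of "Hdom E" _ _ f])
    (use E open_Rdom[OF E] enthalpy_props(1)[OF E] assms higher_differentiable_on_enthalpy in
      \<open>auto simp: equation_of_state_def\<close>)

lemma higher_differentiable_on_csnd: "higher_differentiable_on n (Rdom E) (csnd E)"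
  unfolding csnd_def[abs_def]
  using E smooth_on_open_iff[of "Hdom E" "sound E"]
  by (intro higher_differentiable_on_eos_compose) (auto simp: equation_of_state_def)

lemma higher_differentiable_on_fluid:
  "higher_differentiable_on n (Rdom E) (nfac E)"
  "higher_differentiable_on n (Rdom E) (L1 E)"
  "higher_differentiable_on n (Rdom E) (Lb1 E)"
  "higher_differentiable_on n (Rdom E) (Adens E)"
proof -
  have o: "open (Hdom E)" using E by (auto simp: equation_of_state_def)
  have s: "higher_differentiable_on k (Hdom E) (sound E)" for k
    using E o smooth_on_open_iff[of "Hdom E" "sound E"] by (auto simp: equation_of_state_def)
  have s': "higher_differentiable_on k (Hdom E) (deriv (sound E))" for k
    using s[of "Suc k"] higher_differentiable_on_Suc_real[OF o] by blast
  have u: "higher_differentiable_on k (Rdom E) u0" "higher_differentiable_on k (Rdom E) u1" for k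
    using higher_differentiable_on_u higher_differentiable_on_subset by blast+
  have "higher_differentiable_on k (Hdom E) (nonlin E)" for k
    unfolding nonlin_def[abs_def] by (intro higher_differentiable_on_intros s s' o)
  note i = u higher_differentiable_on_csnd open_Rdom[OF E] higher_differentiable_on_intros
    higher_differentiable_on_eos_compose[OF this]
  show "higher_differentiable_on n (Rdom E) (nfac E)"
    unfolding nfac_def[abs_def] by (intro i)
  have nz: "u0 R + csnd E R * u1 R \<noteq> 0" "u0 R - csnd E R * u1 R \<noteq> 0" if "R \<in> Rdom E" for R
    using fluid_pos(2,3)[OF that] by auto
  have "L1 E = (\<lambda>R. (u1 R + csnd E R * u0 R) / (u0 R + csnd E R * u1 R))"
    "Lb1 E = (\<lambda>R. (u1 R - csnd E R * u0 R) / (u0 R - csnd E R * u1 R))"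
    using L1_eq Lb1_eq by auto
  then show "higher_differentiable_on n (Rdom E) (L1 E)" "higher_differentiable_on n (Rdom E) (Lb1 E)"
    using nz by (auto intro!: i)
  show "higher_differentiable_on n (Rdom E) (Adens E)"
    unfolding Adens_def[abs_def] using nz by (intro i) auto
qed

lemma continuous_on_hmat: "continuous_on (Rdom E) (hmat E)"
proof -
  have "continuous_on (Rdom E) (csnd E)" "continuous_on (Rdom E) (nfac E)"
    using higher_differentiable_on_csnd[of 0] higher_differentiable_on_fluid(1)[of 0] by auto
  moreover have u: "continuous_on (Rdom E) u0" "continuous_on (Rdom E) u1"
    unfolding u0_def[abs_def] u1_def[abs_def] by (auto intro!: continuous_intros)
  moreover have "csnd E R \<noteq> 0" if "R \<in> Rdom E" for R using fluid_pos(1)[OF that] by simp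
  moreover have "continuous_on (Rdom E) (\<lambda>R. u_lower R $ \<alpha>)" for \<alpha>
    using exhaust_2[of \<alpha>]
    by (auto simp: u_lower_def minkowski_def matrix_vector_mult_def sum_2 intro!: continuous_intros u)
  ultimately show ?thesis
    unfolding hmat_def[abs_def] by (intro continuous_on_vec_lambda continuous_on_mult continuous_on_add continuous_on_diff
        continuous_on_divide continuous_on_const continuous_on_power) auto
qed

end

section \<open>Functions comparable up to positive constants\<close>

text \<open>The relation \<open>f = O_pos(1) g\<close> between functions on a set.\<close>

definition comparable :: "'a set \<Rightarrow> ('a \<Rightarrow> real) \<Rightarrow> ('a \<Rightarrow> real) \<Rightarrow> bool" where
  "comparable I f g \<longleftrightarrow> (\<exists>a b. 0 < a \<and> (\<forall>x\<in>I. Opos a b (f x) (g x)))"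

text \<open>Phrased as an eventual statement, finitely many comparisons yield a common constant.\<close>

lemma comparable_eventually:
  assumes "comparable I f g"
  shows "\<forall>\<^sub>F K in at_top. \<forall>x\<in>I. Opos (1 / K) K (f x) (g x)"
proof -
  obtain a b where ab: "0 < a" "\<And>x. x \<in> I \<Longrightarrow> Opos a b (f x) (g x)"
    using assms unfolding comparable_def by blast
  show ?thesis
    using eventually_ge_at_top[of "1 / a"] eventually_ge_at_top[of b]
  proof eventually_elim
    case (elim K)
    have "1 / K \<le> 1 / (1 / a)" using ab(1) elim(1) by (intro divide_left_mono mult_pos_pos)
        (auto intro: less_le_trans[of 0 "1 / a"])
    then have "1 / K \<le> a" by simp
    then show ?case using ab(2) elim(2) unfolding Opos_def by (meson order_trans)
  qed
qed

lemma comparable_sandwich: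
  assumes "0 < a" "\<And>x. x \<in> I \<Longrightarrow> 0 \<le> g x" "\<And>x. x \<in> I \<Longrightarrow> a * g x \<le> f x"
    "\<And>x. x \<in> I \<Longrightarrow> f x \<le> b * g x"
  shows "comparable I f g"
  unfolding comparable_def
proof (intro exI conjI ballI)
  fix x assume x: "x \<in> I"
  show "Opos a (max a b) (f x) (g x)"
  proof (cases "g x = 0")
    case True
    then show ?thesis using assms(3,4)[OF x] unfolding Opos_def by (intro exI[of _ a]) auto
  next
    case False
    then have "0 < g x" using assms(2)[OF x] by simp
    then show ?thesis
      using assms(3,4)[OF x] unfolding Opos_def
      by (intro exI[of _ "f x / g x"]) (auto simp: divide_simps le_max_iff_disj)
  qed
qed (use assms in auto)

lemma comparable_bounds:
  assumes "comparable I f g" "\<And>x. x \<in> I \<Longrightarrow> 0 \<le> g x"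
  obtains a b where "0 < a" "\<And>x. x \<in> I \<Longrightarrow> a * g x \<le> f x \<and> f x \<le> b * g x"
proof -
  obtain a b where ab: "0 < a" "\<And>x. x \<in> I \<Longrightarrow> Opos a b (f x) (g x)"
    using assms(1) unfolding comparable_def by blast
  have "a * g x \<le> f x \<and> f x \<le> b * g x" if x: "x \<in> I" for x
    using ab(2)[OF x] assms(2)[OF x] unfolding Opos_def by (auto intro: mult_right_mono)
  then show thesis using ab(1) that by blast
qed

text \<open>Factors that are continuous and positive on a compact set are absorbed by the constants.\<close>

lemma comparable_mult:
  assumes "comparable I f g" "compact I" "continuous_on I h" "\<And>x. x \<in> I \<Longrightarrow> 0 < h x"
    and "\<And>x. x \<in> I \<Longrightarrow> k x = h x * f x"
  shows "comparable I k g"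
proof (cases "I = {}")
  case True
  then show ?thesis unfolding comparable_def by (auto intro: exI[of _ 1])
next
  case False
  obtain m where m: "m \<in> I" "\<And>x. x \<in> I \<Longrightarrow> h m \<le> h x"
    using continuous_attains_inf[OF assms(2) False assms(3)] by blast
  obtain M where M: "M \<in> I" "\<And>x. x \<in> I \<Longrightarrow> h x \<le> h M"
    using continuous_attains_sup[OF assms(2) False assms(3)] by blast
  obtain a b where ab: "0 < a" "\<And>x. x \<in> I \<Longrightarrow> Opos a b (f x) (g x)"
    using assms(1) unfolding comparable_def by blast
  have "Opos (h m * a) (h M * b) (k x) (g x)" if x: "x \<in> I" for x
  proof -
    obtain c where c: "a \<le> c" "c \<le> b" "f x = c * g x" using ab(2)[OF x] by (auto simp: Opos_def)
    have "h m * a \<le> h x * c" "h x * c \<le> h M * b"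
      using m(2)[OF x] M(2)[OF x] assms(4)[OF x] assms(4)[OF m(1)] c ab(1)
      by (intro mult_mono; linarith)+
    then show ?thesis unfolding Opos_def using c assms(5)[OF x] by (intro exI[of _ "h x * c"]) auto
  qed
  then show ?thesis
    unfolding comparable_def using ab(1) assms(4)[OF m(1)]
    by (intro exI[of _ "h m * a"] exI[of _ "h M * b"]) auto
qed

lemma comparable_refl: "comparable I f f"
  unfolding comparable_def Opos_def
  by (rule exI[of _ 1], rule exI[of _ 1], auto intro!: exI[of _ 1])

lemma comparable_pos:
  assumes "compact I" "continuous_on I h" "\<And>x. x \<in> I \<Longrightarrow> 0 < h x"
    and "\<And>x. x \<in> I \<Longrightarrow> f x = h x * g x"
  shows "comparable I f g"
  by (rule comparable_mult[OF comparable_refl assms])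

lemma comparable_integral:
  assumes "comparable {0..u} f (\<lambda>x. x ^ n)" "F 0 = 0"
    and "\<And>x. x \<in> {0..u} \<Longrightarrow> (F has_real_derivative f x) (at x)"
  shows "comparable {0..u} F (\<lambda>x. x ^ Suc n)"
proof -
  obtain a b where ab: "0 < a" "\<And>x. x \<in> {0..u} \<Longrightarrow> a * x ^ n \<le> f x \<and> f x \<le> b * x ^ n"
    using comparable_bounds[OF assms(1)] by (metis atLeastAtMost_iff zero_le_power)
  define k where "k = real (Suc n)"
  have k: "k > 0" by (simp add: k_def)
  have d: "((\<lambda>x. d / k * x ^ Suc n) has_real_derivative d * x ^ n) (at x)" for d x
    using k by (auto intro!: derivative_eq_intros simp: k_def simp del: power_Suc of_nat_Suc)
  have "a / k * x ^ Suc n \<le> F x \<and> F x \<le> b / k * x ^ Suc n" if x: "x \<in> {0..u}" for x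
  proof
    have "F 0 - a / k * 0 ^ Suc n \<le> F x - a / k * x ^ Suc n"
    proof (rule DERIV_nonneg_imp_nondecreasing[where f = "\<lambda>x. F x - a / k * x ^ Suc n"])
      fix y assume "0 \<le> y" "y \<le> x"
      then have "y \<in> {0..u}" using x by auto
      then show "\<exists>z. ((\<lambda>x. F x - a / k * x ^ Suc n) has_real_derivative z) (at y) \<and> 0 \<le> z"
        using ab(2) by (intro exI[of _ "f y - a * y ^ n"] conjI DERIV_diff[OF assms(3) d]) auto
    qed (use x in auto)
    then show "a / k * x ^ Suc n \<le> F x" using assms(2) by simp
    have "b / k * 0 ^ Suc n - F 0 \<le> b / k * x ^ Suc n - F x"
    proof (rule DERIV_nonneg_imp_nondecreasing[where f = "\<lambda>x. b / k * x ^ Suc n - F x"])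
      fix y assume "0 \<le> y" "y \<le> x"
      then have "y \<in> {0..u}" using x by auto
      then show "\<exists>z. ((\<lambda>x. b / k * x ^ Suc n - F x) has_real_derivative z) (at y) \<and> 0 \<le> z"
        using ab(2) by (intro exI[of _ "b * y ^ n - f y"] conjI DERIV_diff[OF d assms(3)]) auto
    qed (use x in auto)
    then show "F x \<le> b / k * x ^ Suc n" using assms(2) by simp
  qed
  then show ?thesis
    by (intro comparable_sandwich[of "a / k" _ _ _ "b / k"]) (use ab(1) k in auto)
qed

section \<open>Tangent vectors\<close>

lemma tangent_vectors_minus: "- v \<in> tangent_vectors S q \<Longrightarrow> v \<in> tangent_vectors S q"
  unfolding tangent_vectors_def by auto

lemma tangent_vectorsE:
  assumes "v \<in> tangent_vectors S q"
  obtains \<sigma> e w where "0 < e" "\<sigma> 0 = q" "\<sigma> ` {0..<e} \<subseteq> S" "w = v \<or> w = - v"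
    "(\<sigma> has_vector_derivative w) (at 0 within {0..<e})"
  using assms unfolding tangent_vectors_def by blast

lemma tangent_vectorsI:
  assumes "0 < e" "\<sigma> 0 = q" "\<sigma> ` {0..<e} \<subseteq> S" "(\<sigma> has_vector_derivative v) (at 0 within {0..<e})"
  shows "v \<in> tangent_vectors S q"
  using assms unfolding tangent_vectors_def by blast

lemma at_within_Ico_neq_bot: "0 < e \<Longrightarrow> at (0::real) within {0..<e} \<noteq> bot"
  by (simp add: trivial_limit_within)

lemma tangent_vectors_image:
  assumes "v \<in> tangent_vectors S q" "(F has_derivative D) (at q)"
  shows "D v \<in> tangent_vectors (F ` S) (F q)"
proof -
  from assms(1) obtain \<sigma> e w where s: "0 < e" "\<sigma> 0 = q" "\<sigma> ` {0..<e} \<subseteq> S" "w = v \<or> w = - v"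
    "(\<sigma> has_vector_derivative w) (at 0 within {0..<e})" by (rule tangent_vectorsE)
  interpret D: bounded_linear D using assms(2) by (rule has_derivative_bounded_linear)
  have "(F has_derivative D) (at (\<sigma> 0))" using assms(2) s(2) by simp
  from has_derivative_compose[OF s(5)[unfolded has_vector_derivative_def] this]
  have "((\<lambda>x. F (\<sigma> x)) has_vector_derivative D w) (at 0 within {0..<e})"
    by (simp add: has_vector_derivative_def D.scaleR)
  then have "D w \<in> tangent_vectors (F ` S) (F q)"
    using s by (intro tangent_vectorsI[of e "\<lambda>x. F (\<sigma> x)"]) auto
  then show ?thesis using s(4) by (auto simp: linear_neg[OF D.linear] intro: tangent_vectors_minus)
qed

lemma tangent_vectors_derivative_unique:
  assumes "v \<in> tangent_vectors S q" "(f has_derivative D) (at q within S)"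
    "(f has_derivative D') (at q within S)"
  shows "D v = D' v"
proof -
  from assms(1) obtain \<sigma> e w where s: "0 < e" "\<sigma> 0 = q" "\<sigma> ` {0..<e} \<subseteq> S" "w = v \<or> w = - v"
    "(\<sigma> has_vector_derivative w) (at 0 within {0..<e})" by (rule tangent_vectorsE)
  have "((\<lambda>x. f (\<sigma> x)) has_vector_derivative A w) (at 0 within {0..<e})"
    if A: "(f has_derivative A) (at q within S)" for A
  proof -
    interpret A: bounded_linear A using A by (rule has_derivative_bounded_linear)
    have "(f has_derivative A) (at (\<sigma> 0) within \<sigma> ` {0..<e})"
      using has_derivative_subset[OF A s(3)] s(2) by simp
    from has_derivative_in_compose[OF s(5)[unfolded has_vector_derivative_def] this]
    show ?thesis by (simp add: has_vector_derivative_def A.scaleR)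
  qed
  then have "D w = D' w"
    using assms(2,3) vector_derivative_unique_within[OF at_within_Ico_neq_bot[OF s(1)]] by blast
  then show ?thesis
    using s(4) linear_neg[OF has_derivative_linear[OF assms(2)]]
      linear_neg[OF has_derivative_linear[OF assms(3)]] by auto
qed

text \<open>Two curves in the set with independent velocities determine a derivative within the set.  This
  makes the partial derivatives at boundary points and corners of the region well defined.\<close>

lemma frechet_derivative_within_plane:
  fixes f :: "real \<times> real \<Rightarrow> 'b::real_normed_vector"
  assumes "(f has_derivative D) (at q within S)" "v \<in> tangent_vectors S q" "w \<in> tangent_vectors S q"
    "fst v * snd w - snd v * fst w \<noteq> 0"
  shows "frechet_derivative f (at q within S) = D"
proof
  fix z
  define D' where "D' = frechet_derivative f (at q within S)"
  define k where "k = fst v * snd w - snd v * fst w"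
  have D': "(f has_derivative D') (at q within S)"
    using assms(1) frechet_derivative_works by (auto simp: D'_def differentiable_def)
  note e = tangent_vectors_derivative_unique[OF _ D' assms(1)]
  interpret D: linear D using assms(1) has_derivative_linear by blast
  interpret D': linear D' using D' has_derivative_linear by blast
  have "k *\<^sub>R z = (fst z * snd w - snd z * fst w) *\<^sub>R v + (fst v * snd z - snd v * fst z) *\<^sub>R w"
    by (auto simp: prod_eq_iff k_def algebra_simps)
  then have "k *\<^sub>R D' z = k *\<^sub>R D z"
    using e[OF assms(2)] e[OF assms(3)]
    by (simp flip: D.scaleR D'.scaleR) (simp add: D.add D'.add D.scaleR D'.scaleR)
  then show "D' z = D z" using assms(4) by (simp add: k_def)
qed

text \<open>If the velocity of a plane curve is everywhere \<open>a'\<close> times \<open>(1, l)\<close>, the curve is a graph over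
  its first coordinate with slope \<open>l\<close>, even where \<open>a'\<close> vanishes at an end point: by Cauchy's mean
  value theorem all chords have slope \<open>l \<xi>\<close>.\<close>

lemma reparametrised_slope:
  fixes a b a' l :: "real \<Rightarrow> real"
  assumes "\<alpha> < \<beta>"
    and a: "\<And>U. U \<in> {\<alpha>..\<beta>} \<Longrightarrow> (a has_real_derivative a' U) (at U)"
    and b: "\<And>U. U \<in> {\<alpha>..\<beta>} \<Longrightarrow> (b has_real_derivative l U * a' U) (at U)"
    and nz: "\<And>U. U \<in> {\<alpha><..<\<beta>} \<Longrightarrow> a' U \<noteq> 0"
    and l: "continuous_on {\<alpha>..\<beta>} l" and V: "V \<in> {\<alpha>..\<beta>}"
  shows "inj_on a {\<alpha>..\<beta>}"
    and "((b \<circ> the_inv_into {\<alpha>..\<beta>} a) has_real_derivative l V) (at (a V) within a ` {\<alpha>..\<beta>})"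
proof -
  have chord: "\<exists>\<xi>. U < \<xi> \<and> \<xi> < W \<and> b W - b U = l \<xi> * (a W - a U)"
    if UW: "U \<in> {\<alpha>..\<beta>}" "W \<in> {\<alpha>..\<beta>}" "U < W" for U W
  proof -
    have I: "z \<in> {\<alpha>..\<beta>}" if "U \<le> z" "z \<le> W" for z using UW that by auto
    have "\<exists>\<xi>>U. \<xi> < W \<and> (b W - b U) * a' \<xi> = (a W - a U) * (l \<xi> * a' \<xi>)"
      by (rule GMVT'[OF UW(3) DERIV_isCont[OF b[OF I]] DERIV_isCont[OF a[OF I]] a[OF I] b[OF I]])
        simp_all
    then obtain \<xi> where x: "U < \<xi>" "\<xi> < W" "(b W - b U) * a' \<xi> = (a W - a U) * (l \<xi> * a' \<xi>)"
      by blast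
    then have "a' \<xi> \<noteq> 0" using UW by (intro nz) auto
    then show ?thesis using x by (intro exI[of _ \<xi>]) auto
  qed
  show inj: "inj_on a {\<alpha>..\<beta>}"
  proof (rule linorder_inj_onI')
    fix U W assume UW: "U \<in> {\<alpha>..\<beta>}" "W \<in> {\<alpha>..\<beta>}" "U < W"
    obtain z where z: "U < z" "z < W" "a W - a U = (W - U) * a' z"
      using MVT2[OF UW(3), of a a'] a UW by (metis atLeastAtMost_iff order_trans)
    then show "a U \<noteq> a W" using nz[of z] UW by auto
  qed
  define g where "g = the_inv_into {\<alpha>..\<beta>} a"
  have g: "g (a U) = U" if "U \<in> {\<alpha>..\<beta>}" for U
    using that inj by (simp add: g_def the_inv_into_f_f)
  have "continuous_on {\<alpha>..\<beta>} a" by (intro continuous_at_imp_continuous_on ballI DERIV_isCont[OF a])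
  then have "continuous_on (a ` {\<alpha>..\<beta>}) g" by (rule continuous_on_inv) (use g in auto)
  then have gc: "(g \<longlongrightarrow> V) (at (a V) within a ` {\<alpha>..\<beta>})"
    using V g by (force simp: continuous_on_def)
  have "((\<lambda>y. (b (g y) - b (g (a V))) / (y - a V)) \<longlongrightarrow> l V) (at (a V) within a ` {\<alpha>..\<beta>})"
  proof (rule tendstoI)
    fix e :: real assume "e > 0"
    then obtain d where d: "d > 0" "\<And>U. U \<in> {\<alpha>..\<beta>} \<Longrightarrow> dist U V < d \<Longrightarrow> dist (l U) (l V) < e"
      using l V unfolding continuous_on_iff by blast
    have "\<forall>\<^sub>F y in at (a V) within a ` {\<alpha>..\<beta>}. y \<in> a ` {\<alpha>..\<beta>} \<and> y \<noteq> a V"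
      by (simp add: eventually_at_filter)
    with tendstoD[OF gc d(1)]
    show "\<forall>\<^sub>F y in at (a V) within a ` {\<alpha>..\<beta>}. dist ((b (g y) - b (g (a V))) / (y - a V)) (l V) < e"
    proof eventually_elim
      case (elim y)
      then obtain U where U: "U \<in> {\<alpha>..\<beta>}" "y = a U" by blast
      have "U \<noteq> V" using elim U by auto
      then obtain \<xi> where x: "min U V < \<xi>" "\<xi> < max U V" "b U - b V = l \<xi> * (a U - a V)"
        using chord[OF U(1) V] chord[OF V U(1)]
        by (cases "U < V") (fastforce simp: algebra_simps)+
      have "\<xi> \<in> {\<alpha>..\<beta>}" "dist \<xi> V < d" using x U V elim g by (auto simp: dist_real_def)
      then show ?case using d(2) x(3) U V g elim by simp
    qed
  qed
  then show "((b \<circ> the_inv_into {\<alpha>..\<beta>} a) has_real_derivative l V) (at (a V) within a ` {\<alpha>..\<beta>})"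
    by (simp add: has_field_derivative_iff g_def)
qed

text \<open>A curve inside a graph is determined by its first coordinate, so its velocity is fixed by the chain
  rule.\<close>

lemma tangent_vectors_graph:
  fixes f :: "real \<Rightarrow> real"
  assumes "(f has_real_derivative l) (at t within J)" "t \<in> J"
  shows "v \<in> tangent_vectors ((\<lambda>t. (t, f t)) ` J) (t, f t) \<Longrightarrow> v = fst v *\<^sub>R (1, l)"
    and "s \<noteq> t \<Longrightarrow> closed_segment t s \<subseteq> J \<Longrightarrow> (1, l) \<in> tangent_vectors ((\<lambda>t. (t, f t)) ` J) (t, f t)"
proof -
  show "v = fst v *\<^sub>R (1, l)" if "v \<in> tangent_vectors ((\<lambda>t. (t, f t)) ` J) (t, f t)"
  proof -
    from that obtain \<sigma> e w where s: "0 < e" "\<sigma> 0 = (t, f t)" "\<sigma> ` {0..<e} \<subseteq> (\<lambda>t. (t, f t)) ` J"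
      "w = v \<or> w = - v" "(\<sigma> has_vector_derivative w) (at 0 within {0..<e})" by (rule tangent_vectorsE)
    define \<tau> where "\<tau> = (\<lambda>x. fst (\<sigma> x))"
    have sd: "\<sigma> x = (\<tau> x, f (\<tau> x))" "\<tau> x \<in> J" if "x \<in> {0..<e}" for x
      using subsetD[OF s(3) imageI[OF that]] by (auto simp: \<tau>_def)
    have m: "(\<lambda>h. fst (h *\<^sub>R w)) = (*) (fst w)" "(\<lambda>h. snd (h *\<^sub>R w)) = (*) (snd w)"
      by (simp_all add: fun_eq_iff)
    have t0: "\<tau> 0 = t" by (simp add: \<tau>_def s(2))
    note s5 = s(5)[unfolded has_vector_derivative_def]
    have d1: "(\<tau> has_real_derivative fst w) (at 0 within {0..<e})"
      using has_derivative_fst[OF s5] unfolding \<tau>_def has_field_derivative_def m .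
    have d2: "((\<lambda>x. snd (\<sigma> x)) has_real_derivative snd w) (at 0 within {0..<e})"
      using has_derivative_snd[OF s5] unfolding has_field_derivative_def m .
    have "(f has_real_derivative l) (at (\<tau> 0) within \<tau> ` {0..<e})"
      using has_field_derivative_subset[OF assms(1), of "\<tau> ` {0..<e}"] sd(2) t0 by blast
    from DERIV_image_chain[OF this d1] have "((\<lambda>x. snd (\<sigma> x)) has_real_derivative l * fst w) (at 0 within {0..<e})"
      by (rule has_field_derivative_transform_within[OF _ zero_less_one]) (use s(1) in \<open>auto simp: sd(1)\<close>)
    then have "snd w = l * fst w"
      using d2 vector_derivative_unique_within[OF at_within_Ico_neq_bot[OF s(1)]]
      unfolding has_real_derivative_iff_has_vector_derivative by blast
    then show ?thesis using s(4) by (auto simp: prod_eq_iff mult.commute)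
  qed
  show "(1, l) \<in> tangent_vectors ((\<lambda>t. (t, f t)) ` J) (t, f t)"
    if st: "s \<noteq> t" "closed_segment t s \<subseteq> J"
  proof -
    define k where "k = sgn (s - t)"
    have k: "k = 1 \<or> k = - 1" using st by (auto simp: k_def sgn_if)
    define \<sigma> where "\<sigma> = (\<lambda>x. (t + k * x, f (t + k * x)))"
    have J: "t + k * x \<in> J" if "x \<in> {0..<\<bar>s - t\<bar>}" for x
      using that st by (intro subsetD[OF st(2)])
        (auto simp: closed_segment_eq_real_ivl k_def sgn_if split: if_splits)
    have d: "((\<lambda>x. t + k * x) has_real_derivative k) (at 0 within {0..<\<bar>s - t\<bar>})"
      by (auto intro!: derivative_eq_intros)
    have sub: "(\<lambda>x. t + k * x) ` {0..<\<bar>s - t\<bar>} \<subseteq> J" using J by blast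
    have "(f has_real_derivative l) (at (t + k * 0) within (\<lambda>x. t + k * x) ` {0..<\<bar>s - t\<bar>})"
      using has_field_derivative_subset[OF assms(1) sub] by simp
    from DERIV_image_chain[OF this d]
    have "((\<lambda>x. f (t + k * x)) has_real_derivative k * l) (at 0 within {0..<\<bar>s - t\<bar>})"
      by (simp add: o_def mult.commute)
    with d have "(\<sigma> has_vector_derivative (k, k * l)) (at 0 within {0..<\<bar>s - t\<bar>})"
      unfolding \<sigma>_def has_real_derivative_iff_has_vector_derivative
      by (rule has_vector_derivative_Pair)
    then have "k *\<^sub>R (1, l) \<in> tangent_vectors ((\<lambda>t. (t, f t)) ` J) (t, f t)"
      using st J by (intro tangent_vectorsI[of "\<bar>s - t\<bar>" \<sigma>]) (auto simp: \<sigma>_def)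
    then show ?thesis
      using k by (elim disjE) (auto intro: tangent_vectors_minus[of "(1, l)", simplified])
  qed
qed

lemma tangent_vectors_reparametrised:
  fixes a b a' l :: "real \<Rightarrow> real"
  assumes "\<alpha> < \<beta>"
    and a: "\<And>U. U \<in> {\<alpha>..\<beta>} \<Longrightarrow> (a has_real_derivative a' U) (at U)"
    and b: "\<And>U. U \<in> {\<alpha>..\<beta>} \<Longrightarrow> (b has_real_derivative l U * a' U) (at U)"
    and nz: "\<And>U. U \<in> {\<alpha><..<\<beta>} \<Longrightarrow> a' U \<noteq> 0"
    and l: "continuous_on {\<alpha>..\<beta>} l" and J: "J \<subseteq> {\<alpha>..\<beta>}" "is_interval J" "V \<in> J"
  shows "v \<in> tangent_vectors ((\<lambda>U. (a U, b U)) ` J) (a V, b V) \<Longrightarrow> v = fst v *\<^sub>R (1, l V)"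
    and "W \<in> J \<Longrightarrow> W \<noteq> V \<Longrightarrow> (1, l V) \<in> tangent_vectors ((\<lambda>U. (a U, b U)) ` J) (a V, b V)"
proof -
  have V: "V \<in> {\<alpha>..\<beta>}" using J by auto
  note R = reparametrised_slope[OF assms(1) a b nz l V]
  define g where "g = b \<circ> the_inv_into {\<alpha>..\<beta>} a"
  have g: "g (a U) = b U" if "U \<in> J" for U
    using R(1) that J(1) by (simp add: g_def the_inv_into_f_f subset_iff)
  have eq: "(\<lambda>U. (a U, b U)) ` J = (\<lambda>t. (t, g t)) ` (a ` J)" using g by (force simp: image_iff)
  have d: "(g has_real_derivative l V) (at (a V) within a ` J)"
    using has_field_derivative_subset[OF R(2) image_mono[OF J(1)]] by (simp add: g_def)
  have aV: "a V \<in> a ` J" using J by auto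
  note G = tangent_vectors_graph[OF d aV, folded eq, unfolded g[OF J(3)]]
  show "v \<in> tangent_vectors ((\<lambda>U. (a U, b U)) ` J) (a V, b V) \<Longrightarrow> v = fst v *\<^sub>R (1, l V)"
    by (rule G(1))
  assume W: "W \<in> J" "W \<noteq> V"
  have "continuous_on J a"
    by (intro continuous_at_imp_continuous_on ballI DERIV_isCont[OF a[OF subsetD[OF J(1)]]])
  then have "is_interval (a ` J)"
    using J(2) by (simp add: is_interval_connected_1 connected_continuous_image)
  then have "closed_segment (a V) (a W) \<subseteq> a ` J"
    using W J by (intro closed_segment_subset is_interval_convex) auto
  moreover have "a W \<noteq> a V" using R(1) W V J(1) by (auto dest!: inj_onD)
  ultimately show "(1, l V) \<in> tangent_vectors ((\<lambda>U. (a U, b U)) ` J) (a V, b V)" by (intro G(2))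
qed

section \<open>The fold\<close>

lemma higher_differentiable_on_DERIV:
  fixes f :: "real \<Rightarrow> real"
  assumes "\<And>n. higher_differentiable_on n UNIV f"
  shows "(f has_real_derivative deriv f x) (at x)" "higher_differentiable_on n UNIV (deriv f)"
    "isCont f x"
proof -
  have 1: "higher_differentiable_on (Suc n) UNIV f" by (rule assms)
  show d: "(f has_real_derivative deriv f x) (at x)"
    using 1 DERIV_deriv_iff_real_differentiable by auto
  then show "isCont f x" by (rule DERIV_isCont)
  show "higher_differentiable_on n UNIV (deriv f)"
    using 1 higher_differentiable_on_Suc_real[OF open_UNIV] by blast
qed

lemma antiderivative_exists:
  fixes f :: "real \<Rightarrow> real"
  assumes "\<And>x. isCont f x"
  shows "\<exists>F. \<forall>x. (F has_real_derivative f x) (at x)"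
  using einterval_antiderivative[of "- \<infinity>" "\<infinity>" f] assms
  by (auto simp: has_real_derivative_iff_has_vector_derivative)

text \<open>The data of the fold as functions of \<open>U\<close>: \<open>\<psi>\<close> is the derivative of the seed, \<open>\<l>\<close> the speed \<open>L1\<close> of the
  characteristic with label \<open>U\<close>, and \<open>N\<close> the ratio \<open>n / c\<close>, for which \<open>\<l> - 2 / N\<close> is the speed \<open>Lb1\<close>.\<close>

locale fold_profile =
  fixes \<psi> \<l> N :: "real \<Rightarrow> real" and \<delta> b :: real
  assumes smooth_\<psi>: "\<And>n. higher_differentiable_on n UNIV \<psi>"
    and smooth_\<l>: "\<And>n. higher_differentiable_on n UNIV \<l>"
    and smooth_N: "\<And>n. higher_differentiable_on n UNIV N"
    and \<l>_deriv: "\<And>U. (\<l> has_real_derivative - \<psi> U) (at U)"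
    and \<l>_pos: "\<And>U. 0 < \<l> U" and N_pos: "\<And>U. 0 < N U" and \<l>b_neg: "\<And>U. \<l> U - 2 / N U < 0"
    and \<delta>_pos: "0 < \<delta>" and b_pos: "0 < b"
    and \<psi>_0: "\<psi> 0 = - \<delta>" and \<psi>'_0: "deriv \<psi> 0 = 0"
    and \<psi>''_bounds: "\<And>U. \<bar>U\<bar> \<le> 1 \<Longrightarrow> b / 2 \<le> deriv (deriv \<psi>) U \<and> deriv (deriv \<psi>) U \<le> 2 * b"
begin

definition T :: real where "T = 1 / \<delta>"

text \<open>Below, \<open>m\<close> is the density \<open>\<mu>\<close> without its harmless factor \<open>N\<close>, and \<open>x\<close> is the rectangular coordinate.\<close>

definition m :: "real \<Rightarrow> real \<Rightarrow> real" where "m t U = 1 + t * \<psi> U"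

definition x :: "real \<Rightarrow> real \<Rightarrow> real" where "x t U = t * \<l> U - U"

definition tS :: "real \<Rightarrow> real" where "tS U = - 1 / \<psi> U"

text \<open>The logarithm of the integrating factor of the linear equation for the Cauchy horizon.\<close>

definition logfac :: "real \<Rightarrow> real" where
  "logfac = (SOME P. \<forall>U. (P has_real_derivative N U / 2 * \<psi> U) (at U))"

definition tCH :: "real \<Rightarrow> real" where
  "tCH = (SOME y. (\<forall>U. (y has_real_derivative N U / 2 * m (y U) U) (at U)) \<and> y 0 = T)"

lemma T_pos: "0 < T" using \<delta>_pos by (simp add: T_def)

lemma N_DERIV: "(N has_real_derivative deriv N U) (at U)"
  and \<psi>_DERIV: "(\<psi> has_real_derivative deriv \<psi> U) (at U)"
  and \<psi>'_DERIV: "(deriv \<psi> has_real_derivative deriv (deriv \<psi>) U) (at U)"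
  using higher_differentiable_on_DERIV smooth_N smooth_\<psi> by blast+

lemma continuous_on_profile [continuous_intros]:
  "continuous_on S N" "continuous_on S \<psi>" "continuous_on S \<l>" "continuous_on S (deriv \<psi>)"
  by (intro continuous_at_imp_continuous_on ballI DERIV_isCont[OF N_DERIV] DERIV_isCont[OF \<psi>_DERIV]
      DERIV_isCont[OF \<psi>'_DERIV] DERIV_isCont[OF \<l>_deriv])+

lemma logfac_DERIV: "(logfac has_real_derivative N U / 2 * \<psi> U) (at U)"
proof -
  have "isCont (\<lambda>U. N U / 2 * \<psi> U) U" for U
    by (intro continuous_mult continuous_divide continuous_const DERIV_isCont[OF N_DERIV]
        DERIV_isCont[OF \<psi>_DERIV]) simp
  from antiderivative_exists[of "\<lambda>U. N U / 2 * \<psi> U", OF this] show ?thesis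
    unfolding logfac_def by (rule someI2_ex) blast
qed

lemma exp_logfac_DERIV:
  "((\<lambda>U. exp (c * logfac U)) has_real_derivative c * (N U / 2 * \<psi> U) * exp (c * logfac U)) (at U)"
  by (rule derivative_eq_intros logfac_DERIV refl)+ (simp add: algebra_simps)

lemma tCH_DERIV: "(tCH has_real_derivative N U / 2 * m (tCH U) U) (at U)" and tCH_0: "tCH 0 = T"
proof -
  have "isCont (\<lambda>U. N U / 2 * exp (- 1 * logfac U)) U" for U
    by (intro continuous_mult continuous_divide continuous_const DERIV_isCont[OF N_DERIV]
        DERIV_isCont[OF exp_logfac_DERIV]) simp
  from antiderivative_exists[of "\<lambda>U. N U / 2 * exp (- 1 * logfac U)", OF this]
  obtain K where K: "(K has_real_derivative N U / 2 * exp (- 1 * logfac U)) (at U)" for U by blast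
  \<comment> \<open>Variation of constants.\<close>
  define y where "y = (\<lambda>U. exp (1 * logfac U) * (K U + (T * exp (- logfac 0) - K 0)))"
  have "(y has_real_derivative N U / 2 * m (y U) U) (at U)" for U
  proof -
    have "(y has_real_derivative 1 * (N U / 2 * \<psi> U) * exp (1 * logfac U) * (K U + (T * exp (- logfac 0) - K 0))
        + (N U / 2 * exp (- 1 * logfac U) + 0) * exp (1 * logfac U)) (at U)"
      unfolding y_def by (intro DERIV_mult exp_logfac_DERIV DERIV_add K DERIV_const)
    moreover have e: "(N U / 2 * exp (- 1 * logfac U) + 0) * exp (1 * logfac U) = N U / 2"
      by (simp add: exp_minus)
    ultimately show ?thesis
      unfolding e by (elim DERIV_cong)
        (simp add: y_def m_def algebra_simps add_divide_distrib diff_divide_distrib)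
  qed
  moreover have "y 0 = T" by (simp add: y_def exp_minus)
  ultimately have "\<exists>y. (\<forall>U. (y has_real_derivative N U / 2 * m (y U) U) (at U)) \<and> y 0 = T" by blast
  then have "(\<forall>U. (tCH has_real_derivative N U / 2 * m (tCH U) U) (at U)) \<and> tCH 0 = T"
    unfolding tCH_def by (rule someI_ex)
  then show "(tCH has_real_derivative N U / 2 * m (tCH U) U) (at U)" "tCH 0 = T" by auto
qed

text \<open>The difference of two solutions solves the homogeneous equation, so it is constant after division by
  the integrating factor.\<close>

lemma tCH_unique:
  assumes "\<And>U. U \<in> {0..u} \<Longrightarrow> (z has_real_derivative N U / 2 * m (z U) U) (at U within {0..u})"
    "z 0 = T" "U \<in> {0..u}"
  shows "z U = tCH U"
proof -
  define w where "w = (\<lambda>U. exp (- 1 * logfac U) * (z U - tCH U))"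
  have "(w has_real_derivative 0) (at U within {0..u})" if U: "U \<in> {0..u}" for U
  proof -
    have "(w has_real_derivative - 1 * (N U / 2 * \<psi> U) * exp (- 1 * logfac U) * (z U - tCH U)
        + (N U / 2 * m (z U) U - N U / 2 * m (tCH U) U) * exp (- 1 * logfac U)) (at U within {0..u})"
      unfolding w_def
      by (intro DERIV_mult DERIV_diff assms(1) U has_field_derivative_at_within[OF tCH_DERIV]
          has_field_derivative_at_within[OF exp_logfac_DERIV])
    then show ?thesis by (rule DERIV_cong) (simp add: m_def algebra_simps diff_divide_distrib)
  qed
  from has_field_derivative_zero_constant[OF _ this]
  obtain c where "w U = c" if "U \<in> {0..u}" for U by (metis convex_real_interval(5))
  then have "w U = w 0" using assms(3) by auto
  then show ?thesis using assms(2) tCH_0 by (simp add: w_def)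
qed

lemma isCont_tCH: "isCont tCH U" using tCH_DERIV by (rule DERIV_isCont)

lemma continuous_on_tCH [continuous_intros]: "continuous_on S tCH"
  by (simp add: continuous_at_imp_continuous_on isCont_tCH)

lemma x_along_DERIV:
  assumes "(a has_real_derivative a') (at U)"
  shows "((\<lambda>U. x (a U) U) has_real_derivative a' * \<l> U - m (a U) U) (at U)"
proof -
  have "((\<lambda>U. x (a U) U) has_real_derivative (a' * \<l> U + - \<psi> U * a U) - 1) (at U)"
    unfolding x_def by (intro DERIV_diff DERIV_mult assms \<l>_deriv DERIV_ident)
  then show ?thesis by (simp add: m_def algebra_simps)
qed

lemma x_DERIV: "(x t has_real_derivative - m t U) (at U)"
  using x_along_DERIV[of "\<lambda>_. t" 0 U] by simp

lemma x_strict_decreasing: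
  assumes "U < W" "\<And>V. U < V \<Longrightarrow> V < W \<Longrightarrow> 0 < m t V"
  shows "x t W < x t U"
proof (rule DERIV_neg_imp_decreasing_open[OF assms(1)])
  show "\<exists>y. DERIV (x t) V :> y \<and> y < 0" if "U < V" "V < W" for V
    using x_DERIV[of t V] assms(2)[OF that] by auto
  show "continuous_on {U..W} (x t)"
    by (intro continuous_at_imp_continuous_on ballI DERIV_isCont[OF x_DERIV])
qed

text \<open>Near its minimum \<open>\<psi>\<close> is a quadratic well up to constants: Taylor's formula.\<close>

lemma \<psi>_taylor:
  assumes "\<bar>U\<bar> \<le> 1"
  shows "\<exists>c. b / 2 \<le> c \<and> c \<le> 2 * b \<and> \<psi> U + \<delta> = c / 2 * U\<^sup>2"
    and "\<exists>c. b / 2 \<le> c \<and> c \<le> 2 * b \<and> deriv \<psi> U = c * U"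
proof -
  let ?d = "\<lambda>n. (deriv ^^ n) \<psi>"
  have d: "DERIV (?d k) t :> ?d (Suc k) t" if "k < 2" for k t
    using that \<psi>_DERIV \<psi>'_DERIV by (cases k) auto
  have "\<exists>t. \<bar>t\<bar> \<le> \<bar>U\<bar> \<and> \<psi> U = (\<Sum>k<2. ?d k 0 / fact k * U ^ k) + ?d 2 t / fact 2 * U ^ 2"
    by (rule Maclaurin_bi_le) (use d in auto)
  then obtain t where "\<bar>t\<bar> \<le> \<bar>U\<bar>" "\<psi> U = \<psi> 0 + deriv \<psi> 0 * U + deriv (deriv \<psi>) t / 2 * U\<^sup>2"
    by (auto simp: numeral_2_eq_2)
  then show "\<exists>c. b / 2 \<le> c \<and> c \<le> 2 * b \<and> \<psi> U + \<delta> = c / 2 * U\<^sup>2"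
    using \<psi>''_bounds[of t] assms \<psi>_0 \<psi>'_0 by (intro exI[of _ "deriv (deriv \<psi>) t"]) auto
  have "\<exists>t. \<bar>t\<bar> \<le> \<bar>U\<bar> \<and> deriv \<psi> U = (\<Sum>k<1. ?d (Suc k) 0 / fact k * U ^ k) + ?d (Suc 1) t / fact 1 * U ^ 1"
    by (rule Maclaurin_bi_le) (use d[of 1] in auto)
  then obtain t where "\<bar>t\<bar> \<le> \<bar>U\<bar>" "deriv \<psi> U = deriv \<psi> 0 + deriv (deriv \<psi>) t * U" by auto
  then show "\<exists>c. b / 2 \<le> c \<and> c \<le> 2 * b \<and> deriv \<psi> U = c * U"
    using \<psi>''_bounds[of t] assms \<psi>'_0 by (intro exI[of _ "deriv (deriv \<psi>) t"]) auto
qed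

lemma \<psi>'_sign:
  assumes "\<bar>U\<bar> \<le> 1"
  shows "0 < deriv \<psi> U \<longleftrightarrow> 0 < U" "deriv \<psi> U < 0 \<longleftrightarrow> U < 0" "deriv \<psi> U = 0 \<longleftrightarrow> U = 0"
proof -
  obtain c where "b / 2 \<le> c" "deriv \<psi> U = c * U" using \<psi>_taylor(2)[OF assms] by blast
  then show "0 < deriv \<psi> U \<longleftrightarrow> 0 < U" "deriv \<psi> U < 0 \<longleftrightarrow> U < 0" "deriv \<psi> U = 0 \<longleftrightarrow> U = 0"
    using b_pos by (auto simp: zero_less_mult_iff mult_less_0_iff)
qed

lemma comparable_\<psi>:
  assumes "I \<subseteq> {-1..1}"
  shows "comparable I (deriv \<psi>) (\<lambda>U. U)" "comparable I (\<lambda>U. \<psi> U + \<delta>) (\<lambda>U. U\<^sup>2)"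
proof -
  have I: "\<bar>U\<bar> \<le> 1" if "U \<in> I" for U using subsetD[OF assms that] by auto
  show "comparable I (deriv \<psi>) (\<lambda>U. U)"
    unfolding comparable_def Opos_def
    using \<psi>_taylor(2)[OF I] b_pos by (intro exI[of _ "b / 2"] exI[of _ "2 * b"]) auto
  have "Opos (b / 4) b (\<psi> U + \<delta>) (U\<^sup>2)" if U: "U \<in> I" for U
  proof -
    obtain c where "b / 2 \<le> c \<and> c \<le> 2 * b \<and> \<psi> U + \<delta> = c / 2 * U\<^sup>2"
      using \<psi>_taylor(1)[OF I[OF U]] by blast
    then show ?thesis unfolding Opos_def by (intro exI[of _ "c / 2"]) auto
  qed
  then show "comparable I (\<lambda>U. \<psi> U + \<delta>) (\<lambda>U. U\<^sup>2)"
    unfolding comparable_def using b_pos by (intro exI[of _ "b / 4"] exI[of _ b]) auto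
qed

lemma fold_region_exists:
  "\<exists>Us. 0 < Us \<and> Us < 1 \<and> (\<forall>U\<in>{-Us..Us}. \<psi> U < 0) \<and> (\<forall>U\<in>{-Us..Us}. 0 < tCH U)"
proof -
  have "isCont \<psi> 0" using \<psi>_DERIV by (rule DERIV_isCont)
  then have "\<forall>\<^sub>F U in nhds 0. \<psi> U < 0"
    using \<psi>_0 \<delta>_pos unfolding isCont_def tendsto_at_iff_tendsto_nhds
    by (intro order_tendstoD(2)[where y = "\<psi> 0"]) auto
  moreover have "\<forall>\<^sub>F U in nhds 0. 0 < tCH U"
    using isCont_tCH[of 0] tCH_0 T_pos unfolding isCont_def tendsto_at_iff_tendsto_nhds
    by (intro order_tendstoD(1)[where y = "tCH 0"]) auto
  ultimately have "\<forall>\<^sub>F U in nhds 0. \<psi> U < 0 \<and> 0 < tCH U" by (rule eventually_conj)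
  then obtain e where e: "e > 0" "\<And>U. \<bar>U\<bar> < e \<Longrightarrow> \<psi> U < 0 \<and> 0 < tCH U"
    by (auto simp: eventually_nhds_metric dist_real_def)
  show ?thesis by (rule exI[of _ "min (e / 2) (1 / 2)"]) (use e in auto)
qed

end

text \<open>The width \<open>Us\<close> of the region is so small that \<open>\<psi>\<close> stays negative, as at its minimum, and the Cauchy
  horizon stays at positive times.\<close>

locale fold_region = fold_profile +
  fixes Us :: real
  assumes Us: "0 < Us" "Us < 1"
    and \<psi>_neg: "\<And>U. U \<in> {-Us..Us} \<Longrightarrow> \<psi> U < 0"
    and tCH_pos: "\<And>U. U \<in> {-Us..Us} \<Longrightarrow> 0 < tCH U"
begin

lemma tS_pos: "U \<in> {-Us..Us} \<Longrightarrow> 0 < tS U"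
  using \<psi>_neg by (simp add: tS_def divide_neg_neg)

lemma m_tS: "U \<in> {-Us..Us} \<Longrightarrow> m (tS U) U = 0"
  using \<psi>_neg[of U] by (simp add: tS_def m_def)

lemma m_pos_iff: "U \<in> {-Us..Us} \<Longrightarrow> 0 < m t U \<longleftrightarrow> t < tS U"
  and m_zero_iff: "U \<in> {-Us..Us} \<Longrightarrow> m t U = 0 \<longleftrightarrow> t = tS U"
  using \<psi>_neg[of U] by (auto simp: m_def tS_def field_simps)

lemma tS_DERIV:
  assumes "U \<in> {-Us..Us}"
  shows "(tS has_real_derivative deriv \<psi> U / (\<psi> U)\<^sup>2) (at U)"
  unfolding tS_def using \<psi>_neg[OF assms]
  by (auto intro!: derivative_eq_intros \<psi>_DERIV simp: power2_eq_square)

lemma tS_0: "tS 0 = T" by (simp add: tS_def \<psi>_0 T_def)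

lemma continuous_on_tS [continuous_intros]: "S \<subseteq> {-Us..Us} \<Longrightarrow> continuous_on S tS"
  by (intro continuous_at_imp_continuous_on ballI DERIV_isCont[OF tS_DERIV]) auto

lemma tS_strict_decreasing:
  assumes "-Us \<le> U" "U < W" "W \<le> 0"
  shows "tS W < tS U"
proof (rule DERIV_neg_imp_decreasing_open[OF assms(2)])
  show "\<exists>y. DERIV tS V :> y \<and> y < 0" if "U < V" "V < W" for V
  proof -
    have "V \<in> {-Us..Us}" using that assms Us by auto
    moreover have "deriv \<psi> V / (\<psi> V)\<^sup>2 < 0"
      using \<psi>'_sign[of V] \<psi>_neg[OF \<open>V \<in> _\<close>] that assms Us by (intro divide_neg_pos) auto
    ultimately show ?thesis using tS_DERIV by blast
  qed
  show "continuous_on {U..W} tS" using assms Us by (intro continuous_intros) auto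
qed

lemma tS_ge_T: "U \<in> {-Us..0} \<Longrightarrow> T \<le> tS U"
  using tS_strict_decreasing[of U 0] tS_0 by (cases "U = 0") auto

lemma comparable_tS:
  "comparable {-Us..0} (\<lambda>U. deriv \<psi> U / (\<psi> U)\<^sup>2) (\<lambda>U. U)"
  "comparable {-Us..0} (\<lambda>U. tS U - T) (\<lambda>U. U\<^sup>2)"
  "comparable {-Us..0} (\<lambda>U. \<l> U * (deriv \<psi> U / (\<psi> U)\<^sup>2)) (\<lambda>U. U)"
proof -
  have I: "{-Us..0} \<subseteq> {-1..1}" and neg: "\<psi> U < 0" if "U \<in> {-Us..0}" for U
    using Us that \<psi>_neg[of U] by auto
  have I: "{-Us..0} \<subseteq> {-1..1}" using Us by auto
  show 1: "comparable {-Us..0} (\<lambda>U. deriv \<psi> U / (\<psi> U)\<^sup>2) (\<lambda>U. U)"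
    by (rule comparable_mult[OF comparable_\<psi>(1)[OF I], where h = "\<lambda>U. 1 / (\<psi> U)\<^sup>2"])
      (use neg in \<open>force intro!: continuous_intros\<close>)+
  show "comparable {-Us..0} (\<lambda>U. tS U - T) (\<lambda>U. U\<^sup>2)"
  proof (rule comparable_mult[OF comparable_\<psi>(2)[OF I], where h = "\<lambda>U. 1 / (- \<psi> U * \<delta>)"])
    show "continuous_on {-Us..0} (\<lambda>U. 1 / (- \<psi> U * \<delta>))"
      using neg \<delta>_pos by (intro continuous_intros) force
    show "tS U - T = 1 / (- \<psi> U * \<delta>) * (\<psi> U + \<delta>)" if "U \<in> {-Us..0}" for U
      using neg[OF that] \<delta>_pos by (simp add: tS_def T_def field_simps)
    show "0 < 1 / (- \<psi> U * \<delta>)" if "U \<in> {-Us..0}" for U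
      using neg[OF that] \<delta>_pos by (simp add: mult_neg_pos)
  qed simp
  show "comparable {-Us..0} (\<lambda>U. \<l> U * (deriv \<psi> U / (\<psi> U)\<^sup>2)) (\<lambda>U. U)"
    by (rule comparable_mult[OF 1, where h = \<l>]) (auto intro!: continuous_intros \<l>_pos)
qed

text \<open>Along the Cauchy horizon \<open>m\<close> solves a linear equation with source \<open>tCH U * \<psi>' U\<close>, which is
  comparable to \<open>U\<close>; integrating, \<open>m\<close> is comparable to \<open>U^2\<close> and \<open>tCH U - T\<close> to \<open>U^3\<close>.\<close>

lemma comparable_tCH:
  "comparable {0..Us} (\<lambda>U. m (tCH U) U) (\<lambda>U. U\<^sup>2)"
  "comparable {0..Us} (\<lambda>U. N U / 2 * m (tCH U) U) (\<lambda>U. U\<^sup>2)"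
  "comparable {0..Us} (\<lambda>U. tCH U - T) (\<lambda>U. U ^ 3)"
proof -
  have I: "{0..Us} \<subseteq> {-1..1}" using Us by auto
  define w where "w = (\<lambda>U. exp (- 1 * logfac U) * m (tCH U) U)"
  have cP: "continuous_on S logfac" for S
    by (intro continuous_at_imp_continuous_on ballI DERIV_isCont[OF logfac_DERIV])
  have mD: "((\<lambda>U. m (tCH U) U) has_real_derivative
      N U / 2 * \<psi> U * m (tCH U) U + tCH U * deriv \<psi> U) (at U)" for U
    unfolding m_def
    by (rule derivative_eq_intros tCH_DERIV \<psi>_DERIV refl)+ (simp add: m_def algebra_simps)
  have "(w has_real_derivative exp (- 1 * logfac U) * tCH U * deriv \<psi> U) (at U)" for U
  proof -
    have "(w has_real_derivative - 1 * (N U / 2 * \<psi> U) * exp (- 1 * logfac U) * m (tCH U) U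
        + (N U / 2 * \<psi> U * m (tCH U) U + tCH U * deriv \<psi> U) * exp (- 1 * logfac U)) (at U)"
      unfolding w_def by (intro DERIV_mult exp_logfac_DERIV mD)
    then show ?thesis by (simp add: algebra_simps)
  qed
  moreover have "comparable {0..Us} (\<lambda>U. exp (- 1 * logfac U) * tCH U * deriv \<psi> U) (\<lambda>U. U ^ 1)"
    unfolding power_one_right
    by (rule comparable_mult[OF comparable_\<psi>(1)[OF I], where h = "\<lambda>U. exp (- 1 * logfac U) * tCH U"])
      (use tCH_pos Us in \<open>auto intro!: continuous_intros cP\<close>)
  moreover have "w 0 = 0" using \<delta>_pos by (simp add: w_def m_def tCH_0 \<psi>_0 T_def)
  ultimately have "comparable {0..Us} w (\<lambda>U. U ^ Suc 1)"
    by (intro comparable_integral[where f = "\<lambda>U. exp (- 1 * logfac U) * tCH U * deriv \<psi> U"])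
  then have w: "comparable {0..Us} w (\<lambda>U. U\<^sup>2)" by (simp add: numeral_2_eq_2)
  show 1: "comparable {0..Us} (\<lambda>U. m (tCH U) U) (\<lambda>U. U\<^sup>2)"
    by (rule comparable_mult[OF w, where h = "\<lambda>U. exp (logfac U)"])
      (auto intro!: continuous_intros cP simp: w_def exp_minus)
  show 2: "comparable {0..Us} (\<lambda>U. N U / 2 * m (tCH U) U) (\<lambda>U. U\<^sup>2)"
    by (rule comparable_mult[OF 1, where h = "\<lambda>U. N U / 2"])
      (auto intro!: continuous_intros N_pos)
  have "((\<lambda>U. tCH U - T) has_real_derivative N U / 2 * m (tCH U) U) (at U)" for U
    using DERIV_diff[OF tCH_DERIV DERIV_const] by simp
  then have "comparable {0..Us} (\<lambda>U. tCH U - T) (\<lambda>U. U ^ Suc 2)"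
    by (intro comparable_integral[OF 2]) (simp_all add: tCH_0)
  then show "comparable {0..Us} (\<lambda>U. tCH U - T) (\<lambda>U. U ^ 3)" by (simp add: eval_nat_numeral)
qed

lemma m_tCH_pos: "U \<in> {0<..Us} \<Longrightarrow> 0 < m (tCH U) U"
proof -
  obtain a where a: "0 < a" "\<And>U. U \<in> {0..Us} \<Longrightarrow> a * U\<^sup>2 \<le> m (tCH U) U"
    using comparable_bounds[OF comparable_tCH(1)] by (metis zero_le_power2)
  show "0 < m (tCH U) U" if "U \<in> {0<..Us}"
    by (rule less_le_trans[OF _ a(2)]) (use that a(1) in auto)
qed

lemma tCH_strict_increasing:
  assumes "0 \<le> U" "U < W" "W \<le> Us"
  shows "tCH U < tCH W"
proof (rule DERIV_pos_imp_increasing_open[OF assms(2)])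
  show "\<exists>y. DERIV tCH V :> y \<and> 0 < y" if "U < V" "V < W" for V
    using tCH_DERIV[of V] m_tCH_pos[of V] N_pos[of V] that assms by auto
qed (intro continuous_intros)

text \<open>Along the Cauchy horizon \<open>dx / dU\<close> is the speed \<open>\<l> - 2 / N\<close> times \<open>tCH'\<close>.\<close>

lemma xCH_DERIV:
  "((\<lambda>U. x (tCH U) U) has_real_derivative (\<l> U - 2 / N U) * (N U / 2 * m (tCH U) U)) (at U)"
  using x_along_DERIV[OF tCH_DERIV, of U]
  by (rule DERIV_cong) (use N_pos[of U] in \<open>simp add: field_simps\<close>)

lemma comparable_xCH:
  "comparable {0..Us} (\<lambda>U. - ((\<l> U - 2 / N U) * (N U / 2 * m (tCH U) U))) (\<lambda>U. U\<^sup>2)"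
proof (rule comparable_mult[OF comparable_tCH(2), where h = "\<lambda>U. - (\<l> U - 2 / N U)"])
  show "continuous_on {0..Us} (\<lambda>U. - (\<l> U - 2 / N U))"
    using N_pos by (intro continuous_intros) (metis less_irrefl)
  show "0 < - (\<l> U - 2 / N U)" for U using \<l>b_neg[of U] by simp
qed (simp_all only: mult_minus_left compact_Icc)

lemma xCH_strict_decreasing:
  assumes "0 \<le> U" "U < W" "W \<le> Us"
  shows "x (tCH W) W < x (tCH U) U"
proof (rule DERIV_neg_imp_decreasing_open[OF assms(2), where f = "\<lambda>U. x (tCH U) U"])
  show "\<exists>y. DERIV (\<lambda>U. x (tCH U) U) V :> y \<and> y < 0" if "U < V" "V < W" for V
  proof -
    have "0 < N V / 2 * m (tCH V) V" using m_tCH_pos[of V] N_pos[of V] that assms by simp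
    then show ?thesis using xCH_DERIV[of V] \<l>b_neg[of V] mult_neg_pos by blast
  qed
  show "continuous_on {U..W} (\<lambda>U. x (tCH U) U)" unfolding x_def by (intro continuous_intros)
qed

end

section \<open>The region, its closure, and the inverse of the change of variables\<close>

text \<open>The region under a graph is the image of a rectangle.\<close>

lemma compact_subgraph:
  fixes f :: "real \<Rightarrow> real"
  assumes "continuous_on {\<alpha>..\<beta>} f" "\<And>U. U \<in> {\<alpha>..\<beta>} \<Longrightarrow> 0 \<le> f U"
  shows "compact {(t, U). U \<in> {\<alpha>..\<beta>} \<and> 0 \<le> t \<and> t \<le> f U}" (is "compact ?S")
proof -
  have "?S = (\<lambda>p. (fst p * f (snd p), snd p)) ` ({0..1} \<times> {\<alpha>..\<beta>})" (is "_ = ?g ` ?B")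
  proof
    show "?S \<subseteq> ?g ` ?B"
    proof clarify
      fix t U assume *: "U \<in> {\<alpha>..\<beta>}" "0 \<le> t" "t \<le> f U"
      show "(t, U) \<in> ?g ` ?B"
        by (rule image_eqI[of _ _ "(t / f U, U)"]) (use * in \<open>auto simp: divide_simps\<close>)
    qed
    show "?g ` ?B \<subseteq> ?S" using assms(2) by (auto intro!: mult_left_le_one_le)
  qed
  moreover have "continuous_on ?B ?g"
    by (intro continuous_intros continuous_on_compose2[OF assms(1)]) auto
  ultimately show ?thesis by (simp add: compact_continuous_image compact_Times)
qed

text \<open>Within a level set of \<open>snd\<close> both \<open>snd\<close> and \<open>0\<close> are derivatives of \<open>snd\<close>; they agree on tangent vectors.\<close>

lemma tangent_vectors_level_set:
  assumes "v \<in> tangent_vectors {q :: real \<times> real. snd q = c} p" "snd p = c"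
  shows "snd v = 0"
proof -
  have A: "(snd has_derivative snd) (at p within {q. snd q = c})"
    by (rule bounded_linear_imp_has_derivative[OF bounded_linear_snd])
  have B: "(snd has_derivative (\<lambda>_. 0)) (at p within {q. snd q = c})"
    by (rule has_derivative_transform[OF _ _ has_derivative_const[of c]]) (use assms(2) in auto)
  show ?thesis using tangent_vectors_derivative_unique[OF assms(1) A B] by simp
qed

context fold_region
begin

definition x1 :: "real \<times> real \<Rightarrow> real" where "x1 p = x (fst p) (snd p)"

definition mu :: "real \<times> real \<Rightarrow> real" where "mu p = N (snd p) * m (fst p) (snd p)"

abbreviation "M \<equiv> M_star tS tCH Us"

abbreviation "Y \<equiv> Upsilon x1"

abbreviation "Yinv \<equiv> the_inv_into (closure M) Y"

lemma mem_M: "(t, U) \<in> M \<longleftrightarrow>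
    0 \<le> t \<and> (U \<in> {-Us..0} \<and> t < tS U \<or> U \<in> {0<..Us} \<and> t \<le> tCH U)"
  by (auto simp: M_star_def M_sing_def M_reg_def)

lemma m_antimono: "U \<in> {-Us..Us} \<Longrightarrow> s \<le> t \<Longrightarrow> m t U \<le> m s U"
  using \<psi>_neg[of U] by (auto simp: m_def intro!: mult_right_mono_neg)

lemma m_pos_M: "p \<in> M \<Longrightarrow> 0 < m (fst p) (snd p)"
proof (cases p)
  case (Pair t U)
  assume "p \<in> M"
  then have p: "0 \<le> t" "U \<in> {-Us..0} \<and> t < tS U \<or> U \<in> {0<..Us} \<and> t \<le> tCH U"
    using Pair mem_M by auto
  from p(2) have "0 < m t U"
  proof
    assume "U \<in> {-Us..0} \<and> t < tS U"
    then show ?thesis using m_pos_iff[of U t] Us by auto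
  next
    assume "U \<in> {0<..Us} \<and> t \<le> tCH U"
    then show ?thesis
      using m_tCH_pos[of U] m_antimono[of U t "tCH U"] Us by auto
  qed
  then show ?thesis by (simp add: Pair)
qed

text \<open>The closed region, as a union of two regions under graphs; they overlap over \<open>U = 0\<close>.\<close>

definition Mbar :: "(real \<times> real) set" where
  "Mbar = {(t, U). U \<in> {-Us..0} \<and> 0 \<le> t \<and> t \<le> tS U} \<union> {(t, U). U \<in> {0..Us} \<and> 0 \<le> t \<and> t \<le> tCH U}"

lemma mem_Mbar: "(t, U) \<in> Mbar \<longleftrightarrow>
    0 \<le> t \<and> (U \<in> {-Us..0} \<and> t \<le> tS U \<or> U \<in> {0..Us} \<and> t \<le> tCH U)"
  by (auto simp: Mbar_def)

lemma compact_Mbar: "compact Mbar"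
  unfolding Mbar_def
proof (intro compact_Un compact_subgraph)
  show "continuous_on {-Us..0} tS" using Us by (intro continuous_intros) auto
  show "0 \<le> tS U" if "U \<in> {-Us..0}" for U using tS_pos[of U] that Us by auto
  show "0 \<le> tCH U" if "U \<in> {0..Us}" for U using tCH_pos[of U] that Us by auto
qed (intro continuous_intros)

lemma Mbar_eq: "Mbar = M \<union> (\<lambda>U. (tS U, U)) ` {-Us..0}"
proof (rule set_eqI)
  fix p :: "real \<times> real"
  obtain t U where p: "p = (t, U)" by (cases p)
  have "0 < tS U" if "U \<in> {-Us..0}" using tS_pos[of U] that Us by auto
  then show "p \<in> Mbar \<longleftrightarrow> p \<in> M \<union> (\<lambda>U. (tS U, U)) ` {-Us..0}"
    unfolding p using tS_0 tCH_0 Us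
    by (cases "U = 0") (auto simp: mem_Mbar mem_M image_iff)
qed

lemma M_disjoint_sing: "M \<inter> (\<lambda>U. (tS U, U)) ` {-Us..0} = {}"
  by (auto simp: mem_M)

lemma closure_M: "closure M = Mbar"
proof (rule antisym)
  show "closure M \<subseteq> Mbar"
    by (rule closure_minimal) (use compact_Mbar compact_imp_closed Mbar_eq in auto)
  show "Mbar \<subseteq> closure M"
  proof
    fix p assume p: "p \<in> Mbar"
    show "p \<in> closure M"
    proof (cases "p \<in> M")
      case True
      then show ?thesis using closure_subset by auto
    next
      case False
      then obtain U where U: "U \<in> {-Us..0}" "p = (tS U, U)" using p Mbar_eq by auto
      have pos: "0 < tS U" using U Us tS_pos by auto
      show ?thesis
        unfolding closure_approachable
      proof (intro allI impI)
        fix e :: real assume e: "0 < e"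
        show "\<exists>y\<in>M. dist y p < e"
          by (rule bexI[of _ "(tS U - min (e / 2) (tS U), U)"])
            (use e pos U in \<open>auto simp: dist_Pair_Pair dist_real_def mem_M\<close>)
      qed
    qed
  qed
qed

lemma M_subset_Mbar: "M \<subseteq> Mbar" using Mbar_eq by auto

subsection \<open>Injectivity\<close>

lemma x_strict_left:
  assumes "(t, U) \<in> Mbar" "(t, W) \<in> Mbar" "U < W" "W \<le> 0"
  shows "x t W < x t U"
proof (rule x_strict_decreasing[OF assms(3)])
  fix V assume V: "U < V" "V < W"
  have "U \<in> {-Us..0}" using assms Us by (auto simp: mem_Mbar)
  moreover have "t \<le> tS W" using assms tS_0 tCH_0 by (auto simp: mem_Mbar)
  moreover have "tS W < tS V" using V assms calculation by (intro tS_strict_decreasing) auto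
  ultimately show "0 < m t V" using V assms Us by (subst m_pos_iff) auto
qed

lemma x_strict_right:
  assumes "(t, U) \<in> Mbar" "(t, W) \<in> Mbar" "U < W" "0 \<le> U"
  shows "x t W < x t U"
proof (rule x_strict_decreasing[OF assms(3)])
  fix V assume V: "U < V" "V < W"
  have W: "W \<in> {0..Us}" using assms Us by (auto simp: mem_Mbar)
  have "t \<le> tCH U" using assms tS_0 tCH_0 by (auto simp: mem_Mbar)
  moreover have "tCH U < tCH V" using V assms W by (intro tCH_strict_increasing) auto
  ultimately have "m (tCH V) V \<le> m t V" using V assms W by (intro m_antimono) auto
  moreover have "0 < m (tCH V) V" using V assms W by (intro m_tCH_pos) auto
  ultimately show "0 < m t V" by simp
qed

text \<open>After the crease time a horizontal line meets the region on both sides of the crease.  The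
  value \<open>x T 0\<close> separates the two parts: to the left one flows up from time \<open>T\<close> along a
  characteristic, which has positive speed \<open>\<l>\<close>; to the right one first moves to the Cauchy horizon,
  which has negative speed \<open>\<l> - 2 / N\<close>.\<close>

lemma x_strict:
  assumes p: "(t, U) \<in> Mbar" "(t, W) \<in> Mbar" and "U < W"
  shows "x t W < x t U"
proof -
  consider "W \<le> 0" | "0 \<le> U" | "U < 0" "0 < W" by linarith
  then show ?thesis
  proof cases
    case 1
    then show ?thesis using assms by (intro x_strict_left)
  next
    case 2
    then show ?thesis using assms by (intro x_strict_right)
  next
    case 3
    have U: "U \<in> {-Us..0}" "0 \<le> t" "t \<le> tS U" and W: "W \<in> {0..Us}" "t \<le> tCH W"
      using p 3 by (auto simp: mem_Mbar)
    show ?thesis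
    proof (cases "t \<le> T")
      case True
      then have "(t, 0) \<in> Mbar" using Us U tS_0 by (auto simp: mem_Mbar)
      then have "x t W < x t 0" "x t 0 < x t U"
        using p 3 by (auto intro: x_strict_left x_strict_right)
      then show ?thesis by simp
    next
      case False
      have "(T, U) \<in> Mbar" "(T, 0) \<in> Mbar"
        using U tS_ge_T T_pos tS_0 Us by (auto simp: mem_Mbar)
      then have "x T 0 < x T U" using 3 by (intro x_strict_left) auto
      also have "x T U \<le> x t U" using False \<l>_pos[of U] by (simp add: x_def)
      finally have left: "x T 0 < x t U" .
      have "\<exists>\<beta>. 0 \<le> \<beta> \<and> \<beta> \<le> W \<and> tCH \<beta> = t"
        using False W tCH_0 by (intro IVT') (auto intro!: continuous_intros)
      then obtain \<beta> where \<beta>: "0 \<le> \<beta>" "\<beta> \<le> W" "tCH \<beta> = t" by blast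
      have "(t, \<beta>) \<in> Mbar" using \<beta> W U by (auto simp: mem_Mbar)
      then have "x t W \<le> x t \<beta>"
        using \<beta> p x_strict_right[of t \<beta> W] by (cases "\<beta> = W") auto
      also have "\<beta> \<noteq> 0" using \<beta> False tCH_0 by auto
      then have "x t \<beta> < x T 0"
        using xCH_strict_decreasing[of 0 \<beta>] \<beta> W tCH_0 by simp
      finally show ?thesis using left by simp
    qed
  qed
qed

lemma Y_Pair: "Y (t, U) = (t, x t U)" by (simp add: Upsilon_def x1_def)

lemma fst_Y: "fst (Y p) = fst p" by (simp add: Upsilon_def)

lemma inj_Y: "inj_on Y Mbar"
proof (rule inj_onI)
  fix p q assume "p \<in> Mbar" "q \<in> Mbar" "Y p = Y q"
  then show "p = q"
    using x_strict[of "fst p" "snd p" "snd q"] x_strict[of "fst p" "snd q" "snd p"]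
    by (cases p; cases q) (force simp: Y_Pair)
qed

lemma x1_has_derivative:
  "(x1 has_derivative (\<lambda>v. \<l> (snd p) * fst v - m (fst p) (snd p) * snd v)) (at p within S)"
proof -
  have "(x1 has_derivative (\<lambda>v. (fst p * (snd v * - \<psi> (snd p)) + fst v * \<l> (snd p)) - snd v)) (at p within S)"
    unfolding x1_def[abs_def] x_def
    by (intro has_derivative_diff has_derivative_mult DERIV_compose_FDERIV[OF \<l>_deriv]
        bounded_linear_imp_has_derivative[OF bounded_linear_fst]
        bounded_linear_imp_has_derivative[OF bounded_linear_snd])
  then show ?thesis by (simp add: m_def algebra_simps)
qed

lemma Y_has_derivative:
  "(Y has_derivative (\<lambda>v. (fst v, \<l> (snd p) * fst v - m (fst p) (snd p) * snd v))) (at p within S)"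
  unfolding Upsilon_def[abs_def]
  by (intro has_derivative_Pair x1_has_derivative bounded_linear_imp_has_derivative[OF bounded_linear_fst])

lemma continuous_on_Y: "continuous_on S Y"
  by (intro continuous_at_imp_continuous_on ballI has_derivative_continuous[OF Y_has_derivative])

lemma smooth_x1: "higher_differentiable_on n UNIV x1"
  unfolding x1_def[abs_def] x_def
  by (intro higher_differentiable_on_intros higher_differentiable_on_compose[OF _ _ smooth_\<l>]) auto

lemma smooth_mu: "higher_differentiable_on n UNIV mu"
  unfolding mu_def[abs_def] m_def
  by (intro higher_differentiable_on_intros higher_differentiable_on_compose[OF _ _ smooth_N]
      higher_differentiable_on_compose[OF _ _ smooth_\<psi>]) auto

lemma Yinv_Y: "p \<in> Mbar \<Longrightarrow> Yinv (Y p) = p"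
  using inj_Y by (simp add: closure_M the_inv_into_f_f)

lemma homeomorphism_Y: "homeomorphism Mbar (Y ` Mbar) Y Yinv"
  unfolding homeomorphism_def
proof (intro conjI)
  show "continuous_on (Y ` Mbar) Yinv"
    by (rule continuous_on_inv[OF continuous_on_Y compact_Mbar]) (use Yinv_Y in auto)
qed (use Yinv_Y in \<open>auto simp: continuous_on_Y image_image\<close>)

subsection \<open>The inverse is smooth up to the Cauchy horizon\<close>

text \<open>Where \<open>m\<close> is positive the inverse extends past the boundary of the region.  Its \<open>U\<close>-component
  satisfies an equation that expresses its differential through itself, so it is as smooth as
  the profile.\<close>

lemma local_inverse:
  assumes "0 < m (fst p0) (snd p0)"
  obtains A g where "open A" "p0 \<in> A" "open (Y ` A)" "\<forall>p\<in>A. g (Y p) = p"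
    "\<forall>n. higher_differentiable_on n (Y ` A) (\<lambda>q. snd (g q))"
    "\<forall>p\<in>A. ((\<lambda>q. snd (g q)) has_derivative
       (\<lambda>v. (\<l> (snd p) * fst v - snd v) / m (fst p) (snd p))) (at (Y p))"
proof -
  have "continuous_on UNIV (\<lambda>p. m (fst p) (snd p))"
    unfolding m_def by (intro continuous_intros continuous_on_compose2[OF continuous_on_profile(2)]) auto
  then have "open {p. 0 < m (fst p) (snd p)}"
    by (intro open_Collect_less continuous_on_const)
  then obtain d where d: "d > 0" "ball p0 d \<subseteq> {p. 0 < m (fst p) (snd p)}"
    by (rule openE[of _ p0]) (use assms in auto)
  define A where "A = ball p0 d"
  have mpos: "0 < m (fst p) (snd p)" if "p \<in> A" for p using d that by (auto simp: A_def)
  have strict: "x t W < x t U" if "(t, U) \<in> A" "(t, W) \<in> A" "U < W" for t U W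
  proof (rule x_strict_decreasing[OF that(3)])
    fix V assume V: "U < V" "V < W"
    have "V \<in> closed_segment U W" using V by (simp add: closed_segment_eq_real_ivl)
    then obtain u where u: "0 \<le> u" "u \<le> 1" "V = (1 - u) *\<^sub>R U + u *\<^sub>R W"
      unfolding closed_segment_def by blast
    have "(1 - u) *\<^sub>R (t, U) + u *\<^sub>R (t, W) \<in> A"
      using that u unfolding A_def by (intro convexD[OF convex_ball]) auto
    moreover have "(1 - u) *\<^sub>R (t, U) + u *\<^sub>R (t, W) = (t, V)"
      using u(3) by (simp add: left_diff_distrib)
    ultimately have "(t, V) \<in> A" by simp
    then show "0 < m t V" using mpos by fastforce
  qed
  have inj: "inj_on Y A"
  proof (rule inj_onI)
    fix p q assume "p \<in> A" "q \<in> A" "Y p = Y q"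
    then show "p = q"
      using strict[of "fst p" "snd p" "snd q"] strict[of "fst p" "snd q" "snd p"]
      by (cases p; cases q) (force simp: Y_Pair)
  qed
  have oA: "open A" by (simp add: A_def)
  have oYA: "open (Y ` A)" by (rule invariance_of_domain[OF continuous_on_Y oA inj])
  obtain g where g: "homeomorphism A (Y ` A) Y g"
    by (rule invariance_of_domain_homeomorphism[OF oA continuous_on_Y order_refl inj])
  have gY: "g (Y p) = p" if "p \<in> A" for p using g that by (auto simp: homeomorphism_def)
  have gd: "((\<lambda>q. snd (g q)) has_derivative
       (\<lambda>v. (\<l> (snd p) * fst v - snd v) / m (fst p) (snd p))) (at (Y p))" if p: "p \<in> A" for p
  proof -
    let ?D = "\<lambda>v. (fst v, \<l> (snd p) * fst v - m (fst p) (snd p) * snd v)"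
    let ?G = "\<lambda>v. (fst v, (\<l> (snd p) * fst v - snd v) / m (fst p) (snd p))"
    have "(g has_derivative ?G) (at (Y p))"
      by (rule has_derivative_inverse_strong[OF oA p continuous_on_Y gY Y_has_derivative])
        (use mpos[OF p] in \<open>auto simp: fun_eq_iff\<close>)
    from has_derivative_snd[OF this] show ?thesis by simp
  qed
  have gs: "higher_differentiable_on n (Y ` A) (\<lambda>q. snd (g q))" for n
  proof (induction n)
    case 0
    have "continuous_on (Y ` A) g" using g by (auto simp: homeomorphism_def)
    then show ?case by (auto intro!: continuous_intros)
  next
    case (Suc n)
    show ?case
    proof (rule higher_differentiable_on_SucI[OF oYA, where
          D = "\<lambda>q v. (\<l> (snd (g q)) * fst v - snd v) / (1 + fst q * \<psi> (snd (g q)))"])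
      show "((\<lambda>q. snd (g q)) has_derivative
          (\<lambda>v. (\<l> (snd (g q)) * fst v - snd v) / (1 + fst q * \<psi> (snd (g q))))) (at q)"
        if "q \<in> Y ` A" for q
        using gd that gY by (auto simp: fst_Y m_def)
      have nz: "1 + fst q * \<psi> (snd (g q)) \<noteq> 0" if "q \<in> Y ` A" for q
        using mpos that gY by (fastforce simp: fst_Y m_def)
      show "higher_differentiable_on n (Y ` A)
          (\<lambda>q. (\<l> (snd (g q)) * fst v - snd v) / (1 + fst q * \<psi> (snd (g q))))" for v
        by (intro higher_differentiable_on_intros oYA nz
            higher_differentiable_on_compose[OF open_UNIV oYA smooth_\<l> Suc]
            higher_differentiable_on_compose[OF open_UNIV oYA smooth_\<psi> Suc]) auto
    qed
  qed
  have "p0 \<in> A" using d(1) by (simp add: A_def)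
  show thesis
  proof (rule that[of A g])
    show "\<forall>p\<in>A. ((\<lambda>q. snd (g q)) has_derivative
        (\<lambda>v. (\<l> (snd p) * fst v - snd v) / m (fst p) (snd p))) (at (Y p))"
      using gd by blast
    show "\<forall>n. higher_differentiable_on n (Y ` A) (\<lambda>q. snd (g q))" using gs by blast
    show "\<forall>p\<in>A. g (Y p) = p" using gY by blast
  qed fact+
qed

text \<open>Near an image point the local inverse coincides with the global one, since the global inverse is
  continuous and therefore takes values in the domain of the local inverse.\<close>

lemma Yinv_local:
  assumes "p0 \<in> M"
  obtains S g where "open S" "Y p0 \<in> S" "\<forall>y \<in> Y ` M \<inter> S. Yinv y = (fst y, g y)"
    "\<forall>n. higher_differentiable_on n S g"
    "(g has_derivative (\<lambda>v. (\<l> (snd p0) * fst v - snd v) / m (fst p0) (snd p0))) (at (Y p0))"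
    "g (Y p0) = snd p0"
proof -
  obtain A g where A: "open A" "p0 \<in> A" "open (Y ` A)" "\<forall>p\<in>A. g (Y p) = p"
    "\<forall>n. higher_differentiable_on n (Y ` A) (\<lambda>q. snd (g q))"
    "\<forall>p\<in>A. ((\<lambda>q. snd (g q)) has_derivative
       (\<lambda>v. (\<l> (snd p) * fst v - snd v) / m (fst p) (snd p))) (at (Y p))"
    by (rule local_inverse[OF m_pos_M[OF assms]])
  have "continuous_on (Y ` Mbar) Yinv" using homeomorphism_Y by (simp add: homeomorphism_def)
  then obtain B where B: "open B" "B \<inter> Y ` Mbar = Yinv -` A \<inter> Y ` Mbar"
    using A(1) unfolding continuous_on_open_invariant by blast
  have p0: "p0 \<in> Mbar" using assms M_subset_Mbar by auto
  show thesis
  proof (rule that[of "B \<inter> Y ` A" "\<lambda>q. snd (g q)"])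
    show "open (B \<inter> Y ` A)" using A B by auto
    show "Y p0 \<in> B \<inter> Y ` A" using B(2) A(2) p0 Yinv_Y[OF p0] by blast
    show "\<forall>n. higher_differentiable_on n (B \<inter> Y ` A) (\<lambda>q. snd (g q))"
      using A(5) higher_differentiable_on_subset by blast
    show "\<forall>y\<in>Y ` M \<inter> (B \<inter> Y ` A). Yinv y = (fst y, snd (g y))"
    proof
      fix y assume y: "y \<in> Y ` M \<inter> (B \<inter> Y ` A)"
      obtain p where p: "p \<in> M" "y = Y p" using y by blast
      then have pM: "p \<in> Mbar" using M_subset_Mbar by auto
      have "y \<in> B \<inter> Y ` Mbar" using y p pM by blast
      then have "p \<in> A" using B(2) p(2) Yinv_Y[OF pM] by auto
      then show "Yinv y = (fst y, snd (g y))"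
        using A(4) Yinv_Y[OF pM] p(2) fst_Y[of p] by (metis prod.collapse)
    qed
  qed (use A in auto)
qed

lemma smooth_on_Yinv: "smooth_on (Y ` M) Yinv"
  unfolding smooth_on_def
proof
  fix y0 assume "y0 \<in> Y ` M"
  then obtain p where p: "p \<in> M" "y0 = Y p" by blast
  obtain S g where S: "open S" "Y p \<in> S" "\<forall>y \<in> Y ` M \<inter> S. Yinv y = (fst y, g y)"
    "\<forall>n. higher_differentiable_on n S g"
    "(g has_derivative (\<lambda>v. (\<l> (snd p) * fst v - snd v) / m (fst p) (snd p))) (at (Y p))"
    "g (Y p) = snd p" by (rule Yinv_local[OF p(1)])
  then show "\<exists>T g. open T \<and> y0 \<in> T \<and> (\<forall>n. higher_differentiable_on n T g) \<and>
      (\<forall>y\<in>Y ` M \<inter> T. Yinv y = g y)"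
    by (intro exI[of _ S] exI[of _ "\<lambda>y. (fst y, g y)"])
      (auto simp: p(2) intro!: higher_differentiable_on_Pair higher_differentiable_on_fst)
qed

lemma smooth_on_pullback:
  fixes h :: "real \<Rightarrow> real"
  assumes h: "\<And>n. higher_differentiable_on n UNIV h" and f: "\<And>q. q \<in> Y ` M \<Longrightarrow> f q = h (snd (Yinv q))"
  shows "smooth_on (Y ` M) f"
  unfolding smooth_on_def
proof
  fix y0 assume "y0 \<in> Y ` M"
  then obtain p where p: "p \<in> M" "y0 = Y p" by blast
  obtain S g where S: "open S" "Y p \<in> S" "\<forall>y \<in> Y ` M \<inter> S. Yinv y = (fst y, g y)"
    "\<forall>n. higher_differentiable_on n S g"
    "(g has_derivative (\<lambda>v. (\<l> (snd p) * fst v - snd v) / m (fst p) (snd p))) (at (Y p))"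
    "g (Y p) = snd p" by (rule Yinv_local[OF p(1)])
  have "higher_differentiable_on n S (\<lambda>y. h (g y))" for n
    by (rule higher_differentiable_on_compose[OF open_UNIV S(1) h S(4)[rule_format]]) auto
  then show "\<exists>T g. open T \<and> y0 \<in> T \<and> (\<forall>n. higher_differentiable_on n T g) \<and>
      (\<forall>y\<in>Y ` M \<inter> T. f y = g y)"
    using S f by (intro exI[of _ S] exI[of _ "\<lambda>y. h (g y)"]) (auto simp: p(2))
qed

lemma pullback_has_derivative:
  assumes p: "p \<in> M" and h: "\<And>U. (h has_real_derivative h' U) (at U)"
    and f: "\<And>q. q \<in> Y ` M \<Longrightarrow> f q = h (snd (Yinv q))"
  shows "(f has_derivative
    (\<lambda>v. (\<l> (snd p) * fst v - snd v) / m (fst p) (snd p) * h' (snd p))) (at (Y p) within Y ` M)"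
proof -
  obtain S g where S: "open S" "Y p \<in> S" "\<forall>y \<in> Y ` M \<inter> S. Yinv y = (fst y, g y)"
    "\<forall>n. higher_differentiable_on n S g"
    "(g has_derivative (\<lambda>v. (\<l> (snd p) * fst v - snd v) / m (fst p) (snd p))) (at (Y p))"
    "g (Y p) = snd p" by (rule Yinv_local[OF p])
  have "(h has_real_derivative h' (snd p)) (at (g (Y p)))" using h S(6) by simp
  from DERIV_compose_FDERIV[OF this S(5)]
  have d: "((\<lambda>y. h (g y)) has_derivative
      (\<lambda>v. (\<l> (snd p) * fst v - snd v) / m (fst p) (snd p) * h' (snd p))) (at (Y p) within Y ` M)"
    by (rule has_derivative_at_withinI)
  obtain e where e: "e > 0" "ball (Y p) e \<subseteq> S" using S(1,2) open_contains_ball by blast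
  show ?thesis
  proof (rule has_derivative_transform_within[OF d e(1)])
    fix y assume y: "y \<in> Y ` M" "dist y (Y p) < e"
    then have "y \<in> S" using e(2) by (intro subsetD[OF e(2)]) (simp add: dist_commute)
    then have "Yinv y = (fst y, g y)" using S(3) y(1) by blast
    then show "h (g y) = f y" using f[OF y(1)] by simp
  qed (use p in blast)
qed

text \<open>Vertical segments give the first direction at every point.  For the second one a horizontal segment
  serves when \<open>U \<le> 0\<close>; at the corner on the Cauchy horizon there is none inside the region, and a
  vertically rescaled copy of the horizon is used instead.\<close>

lemma tangent_vectors_M:
  assumes "p \<in> M"
  shows "(1, 0) \<in> tangent_vectors M p" "\<exists>w\<in>tangent_vectors M p. snd w \<noteq> 0"
proof -
  obtain t U where p: "p = (t, U)" by (cases p)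
  have tU: "0 \<le> t" "U \<in> {-Us..0} \<and> t < tS U \<or> U \<in> {0<..Us} \<and> t \<le> tCH U"
    using assms p mem_M by auto
  show "(1, 0) \<in> tangent_vectors M p"
  proof (cases "t = 0")
    case True
    define e where "e = (if U \<le> 0 then tS U else tCH U)"
    have "0 < e" using tU(2) Us tS_pos[of U] tCH_pos[of U] by (auto simp: e_def)
    then show ?thesis
      unfolding p using tU True
      by (intro tangent_vectorsI[where \<sigma> = "\<lambda>s. (s, U)" and e = e])
        (auto simp: e_def mem_M has_vector_derivative_def intro!: derivative_eq_intros split: if_splits)
  next
    case False
    have "- (1, 0) \<in> tangent_vectors M p"
      unfolding p using tU False
      by (intro tangent_vectorsI[where \<sigma> = "\<lambda>s. (t - s, U)" and e = t])
        (auto simp: mem_M has_vector_derivative_def intro!: derivative_eq_intros)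
    then show ?thesis by (rule tangent_vectors_minus)
  qed
  consider "U < 0" | "U = 0" | "0 < U" by linarith
  then show "\<exists>w\<in>tangent_vectors M p. snd w \<noteq> 0"
  proof cases
    case 1
    have "isCont tS U" using tS_DERIV[of U] tU 1 Us by (auto intro: DERIV_isCont)
    then have "\<forall>\<^sub>F V in nhds U. t < tS V"
      unfolding isCont_def tendsto_at_iff_tendsto_nhds by (rule order_tendstoD(1)) (use tU 1 in auto)
    then obtain e where e: "e > 0" "\<And>V. \<bar>V - U\<bar> < e \<Longrightarrow> t < tS V"
      by (auto simp: eventually_nhds_metric dist_real_def)
    have "(0, 1) \<in> tangent_vectors M p"
      unfolding p using tU 1 e
      by (intro tangent_vectorsI[where \<sigma> = "\<lambda>s. (t, U + s)" and e = "min e (- U)"])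
        (auto simp: mem_M has_vector_derivative_def intro!: derivative_eq_intros)
    then show ?thesis by force
  next
    case 2
    have "t < tS (- s)" if "0 \<le> s" "s < Us" for s
      using tS_ge_T[of "- s"] tU 2 tS_0 that by auto
    then have "(0, - 1) \<in> tangent_vectors M p"
      unfolding p using tU 2 Us
      by (intro tangent_vectorsI[where \<sigma> = "\<lambda>s. (t, U - s)" and e = Us])
        (auto simp: mem_M has_vector_derivative_def intro!: derivative_eq_intros)
    then show ?thesis by force
  next
    case 3
    have U: "U \<in> {0<..Us}" "t \<le> tCH U" using tU 3 by auto
    have pos: "0 < tCH V" if "V \<in> {0<..Us}" for V using tCH_pos[of V] that Us by auto
    define c where "c = t * (N U / 2 * m (tCH U) U) / tCH U"
    have "((\<lambda>s. t / tCH U * tCH (U - s)) has_real_derivative - c) (at 0)"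
    proof -
      have "((\<lambda>s. tCH (U - s)) has_real_derivative N (U - 0) / 2 * m (tCH (U - 0)) (U - 0) * (0 - 1)) (at 0)"
        by (rule DERIV_chain2[OF tCH_DERIV DERIV_diff[OF DERIV_const DERIV_ident]])
      from DERIV_cmult[OF this, of "t / tCH U"] show ?thesis by (rule DERIV_cong) (simp add: c_def)
    qed
    then have d1: "((\<lambda>s. t / tCH U * tCH (U - s)) has_vector_derivative - c) (at 0)"
      by (simp only: has_real_derivative_iff_has_vector_derivative)
    have "((\<lambda>s. U - s) has_real_derivative 0 - 1) (at 0)"
      by (rule DERIV_diff[OF DERIV_const DERIV_ident])
    then have d2: "((\<lambda>s. U - s) has_vector_derivative - 1) (at 0)"
      by (simp only: has_real_derivative_iff_has_vector_derivative diff_0)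
    have "((\<lambda>s. (t / tCH U * tCH (U - s), U - s)) has_vector_derivative (- c, - 1)) (at 0 within {0..<U})"
      by (rule has_vector_derivative_at_within[OF has_vector_derivative_Pair[OF d1 d2]])
    moreover have "(t / tCH U * tCH (U - s), U - s) \<in> M" if "s \<in> {0..<U}" for s
      using that U tU(1) pos[of "U - s"] pos[OF U(1)]
        mult_right_mono[of t "tCH U" "tCH (U - s)"]
      by (auto simp: mem_M pos_divide_le_eq mult.commute)
    ultimately have "(- c, - 1) \<in> tangent_vectors M p"
      unfolding p using 3 pos[OF U(1)]
      by (intro tangent_vectorsI[where \<sigma> = "\<lambda>s. (t / tCH U * tCH (U - s), U - s)" and e = U]) auto
    then show ?thesis by force
  qed
qed

lemma frechet_derivative_within_image:
  fixes f :: "real \<times> real \<Rightarrow> real"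
  assumes "p \<in> M" "(f has_derivative D) (at (Y p) within Y ` M)"
  shows "frechet_derivative f (at (Y p) within Y ` M) = D"
proof -
  obtain w where w: "w \<in> tangent_vectors M p" "snd w \<noteq> 0" using tangent_vectors_M(2)[OF assms(1)] by blast
  note i = tangent_vectors_image[OF _ Y_has_derivative]
  show ?thesis
    by (rule frechet_derivative_within_plane[OF assms(2) i[OF tangent_vectors_M(1)[OF assms(1)]] i[OF w(1)]])
      (use w(2) m_pos_M[OF assms(1)] in \<open>simp add: algebra_simps\<close>)
qed

subsection \<open>The singular curve, the crease and the Cauchy horizon\<close>

lemma dX_mu: "dX mu (t, U) = deriv N U * m t U + N U * (t * deriv \<psi> U)"
proof -
  have "((\<lambda>u. N u * m t u) has_real_derivative deriv N U * m t U + t * deriv \<psi> U * N U) (at U)"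
    unfolding m_def by (rule derivative_eq_intros N_DERIV \<psi>_DERIV refl)+ simp
  then show ?thesis unfolding dX_def mu_def by (simp add: DERIV_imp_deriv)
qed

lemma mu_zero_iff: "U \<in> {-Us..Us} \<Longrightarrow> mu (t, U) = 0 \<longleftrightarrow> t = tS U"
  using m_zero_iff N_pos[of U] by (simp add: mu_def)

text \<open>Where \<open>m\<close> vanishes, the \<open>U\<close>-derivative of the density is a positive multiple of \<open>\<psi>'\<close>, which has the sign of
  \<open>U\<close>.  This selects the half \<open>U \<le> 0\<close> of the zero set and isolates the crease.\<close>

lemma dX_mu_sing:
  assumes "U \<in> {-Us..Us}"
  shows "dX mu (tS U, U) \<le> 0 \<longleftrightarrow> U \<le> 0" "dX mu (tS U, U) = 0 \<longleftrightarrow> U = 0"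
proof -
  have a: "\<bar>U\<bar> \<le> 1" using assms Us by auto
  have "dX mu (tS U, U) = (N U * tS U) * deriv \<psi> U" using m_tS[OF assms] by (simp add: dX_mu)
  then show "dX mu (tS U, U) \<le> 0 \<longleftrightarrow> U \<le> 0" "dX mu (tS U, U) = 0 \<longleftrightarrow> U = 0"
    using \<psi>'_sign[OF a] N_pos[of U] tS_pos[OF assms]
    by (auto simp: mult_le_0_iff zero_less_mult_iff not_less mult_less_0_iff dest: leD)
qed

lemma sing_curve_eq: "I \<subseteq> {-Us..0} \<Longrightarrow> sing_curve mu I = (\<lambda>U. (tS U, U)) ` I"
proof (intro set_eqI)
  fix p :: "real \<times> real" assume I: "I \<subseteq> {-Us..0}"
  obtain t U where p: "p = (t, U)" by (cases p)
  have "U \<in> I \<Longrightarrow> U \<in> {-Us..Us} \<and> U \<le> 0" using I Us by auto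
  then show "p \<in> sing_curve mu I \<longleftrightarrow> p \<in> (\<lambda>U. (tS U, U)) ` I"
    unfolding p using mu_zero_iff[of U t] dX_mu_sing[of U] tS_pos[of U]
    by (auto simp: sing_curve_def intro: less_imp_le)
qed

lemma crease_eq: "crease mu Us = {(T, 0)}"
proof
  show "crease mu Us \<subseteq> {(T, 0)}"
  proof clarify
    fix t U assume "(t, U) \<in> crease mu Us"
    then have U: "U \<in> {-Us..Us}" and z: "mu (t, U) = 0" "dX mu (t, U) = 0" by (auto simp: crease_def)
    then have t: "t = tS U" using mu_zero_iff[OF U] by simp
    then have "U = 0" using z(2) dX_mu_sing(2)[OF U] by simp
    then show "t = T \<and> U = 0" using t tS_0 by simp
  qed
  have 0: "0 \<in> {-Us..Us}" using Us by simp
  have "mu (T, 0) = 0" using mu_zero_iff[OF 0] tS_0 by simp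
  moreover have "dX mu (T, 0) = 0" using dX_mu_sing(2)[OF 0] tS_0 by simp
  ultimately show "{(T, 0)} \<subseteq> crease mu Us" using 0 T_pos by (simp add: crease_def)
qed

text \<open>On the singular curve \<open>m = 0\<close>, so the velocity of its image is \<open>tS'\<close> times \<open>(1, \<l>)\<close>.  The parameter
  interval is closed at \<open>0\<close> for the reparametrisation and then cut down.\<close>

lemma tangent_vectors_sing_image:
  assumes "V \<in> {-Us..<0}"
  shows "v \<in> tangent_vectors (Y ` (\<lambda>U. (tS U, U)) ` {-Us..<0}) (Y (tS V, V)) \<Longrightarrow> v = fst v *\<^sub>R (1, \<l> V)"
    and "(1, \<l> V) \<in> tangent_vectors (Y ` (\<lambda>U. (tS U, U)) ` {-Us..<0}) (Y (tS V, V))"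
proof -
  have eq: "Y ` (\<lambda>U. (tS U, U)) ` {-Us..<0} = (\<lambda>U. (tS U, x (tS U) U)) ` {-Us..<0}"
    by (simp add: image_image Y_Pair)
  have sub: "U \<in> {-Us..Us}" if "U \<in> {-Us..0}" for U using that Us by auto
  have xd: "((\<lambda>U. x (tS U) U) has_real_derivative \<l> U * (deriv \<psi> U / (\<psi> U)\<^sup>2)) (at U)"
    if "U \<in> {-Us..0}" for U
    using x_along_DERIV[OF tS_DERIV[OF sub[OF that]]] m_tS[OF sub[OF that]]
    by (simp add: mult.commute)
  have nz: "deriv \<psi> U / (\<psi> U)\<^sup>2 \<noteq> 0" if "U \<in> {-Us<..<0}" for U
    using \<psi>'_sign(3)[of U] \<psi>_neg[of U] that Us by auto
  define W where "W = (if V = -Us then -Us / 2 else -Us)"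
  have W: "W \<in> {-Us..<0}" "W \<noteq> V" using Us by (auto simp: W_def)
  have i: "is_interval {-Us..<0}" by (simp add: is_interval_1)
  note R = tangent_vectors_reparametrised[of "-Us" 0 tS "\<lambda>U. deriv \<psi> U / (\<psi> U)\<^sup>2" "\<lambda>U. x (tS U) U" \<l>
      "{-Us..<0}" V, OF _ tS_DERIV[OF sub] xd nz continuous_on_profile(3) _ i assms]
  show "v \<in> tangent_vectors (Y ` (\<lambda>U. (tS U, U)) ` {-Us..<0}) (Y (tS V, V)) \<Longrightarrow> v = fst v *\<^sub>R (1, \<l> V)"
    unfolding eq Y_Pair by (rule R(1)) (use Us in auto)
  show "(1, \<l> V) \<in> tangent_vectors (Y ` (\<lambda>U. (tS U, U)) ` {-Us..<0}) (Y (tS V, V))"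
    unfolding eq Y_Pair by (rule R(2)[OF _ _ _ _ _ W]) (use Us in auto)
qed

text \<open>The velocity of the image of the Cauchy horizon is \<open>tCH'\<close> times \<open>(1, \<l> - 2 / N)\<close>; at the crease \<open>tCH' = 0\<close>
  but the slope persists.\<close>

lemma tangent_vectors_CH_image:
  assumes "V \<in> {0..Us}"
  shows "v \<in> tangent_vectors (Y ` (\<lambda>U. (tCH U, U)) ` {0..Us}) (Y (tCH V, V)) \<Longrightarrow>
      v = fst v *\<^sub>R (1, \<l> V - 2 / N V)"
    and "(1, \<l> V - 2 / N V) \<in> tangent_vectors (Y ` (\<lambda>U. (tCH U, U)) ` {0..Us}) (Y (tCH V, V))"
proof -
  have eq: "Y ` (\<lambda>U. (tCH U, U)) ` {0..Us} = (\<lambda>U. (tCH U, x (tCH U) U)) ` {0..Us}"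
    by (simp add: image_image Y_Pair)
  have nz: "N U / 2 * m (tCH U) U \<noteq> 0" if "U \<in> {0<..<Us}" for U
    using m_tCH_pos[of U] N_pos[of U] that by auto
  have c: "continuous_on {0..Us} (\<lambda>U. \<l> U - 2 / N U)"
    using less_imp_neq[OF N_pos] by (intro continuous_intros) force
  define W where "W = (if V = 0 then Us else 0)"
  have W: "W \<in> {0..Us}" "W \<noteq> V" using Us by (auto simp: W_def)
  have i: "is_interval {0..Us}" by (simp add: is_interval_1)
  note R = tangent_vectors_reparametrised[of 0 Us tCH "\<lambda>U. N U / 2 * m (tCH U) U" "\<lambda>U. x (tCH U) U"
      "\<lambda>U. \<l> U - 2 / N U" "{0..Us}" V, OF Us(1) tCH_DERIV xCH_DERIV nz c order_refl i assms]
  show "v \<in> tangent_vectors (Y ` (\<lambda>U. (tCH U, U)) ` {0..Us}) (Y (tCH V, V)) \<Longrightarrow>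
      v = fst v *\<^sub>R (1, \<l> V - 2 / N V)"
    unfolding eq Y_Pair by (rule R(1))
  show "(1, \<l> V - 2 / N V) \<in> tangent_vectors (Y ` (\<lambda>U. (tCH U, U)) ` {0..Us}) (Y (tCH V, V))"
    unfolding eq Y_Pair by (rule R(2)[OF _ W])
qed

lemma tangent_vectors_sing:
  assumes "V \<in> {-Us..<0}"
  shows "(1, (\<psi> V)\<^sup>2 / deriv \<psi> V) \<in> tangent_vectors ((\<lambda>U. (tS U, U)) ` {-Us..<0}) (tS V, V)"
proof -
  have V: "V \<in> {-Us..Us}" "\<bar>V\<bar> \<le> 1" using assms Us by auto
  define k where "k = (\<psi> V)\<^sup>2 / deriv \<psi> V"
  have k: "deriv \<psi> V / (\<psi> V)\<^sup>2 * k = 1"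
    using \<psi>'_sign(3)[OF V(2)] \<psi>_neg[OF V(1)] assms by (simp add: k_def)
  \<comment> \<open>Moving to the right from \<open>V\<close> with speed \<open>\<bar>k\<bar>\<close> stays left of \<open>0\<close> for this long.\<close>
  define e where "e = - V / (\<bar>k\<bar> + 1)"
  have e: "0 < e" "(\<bar>k\<bar> + 1) * e = - V" using assms by (simp_all add: e_def divide_neg_pos)
  have "V + \<bar>k\<bar> * s \<in> {-Us..<0}" if "s \<in> {0..<e}" for s
  proof -
    have "\<bar>k\<bar> * s \<le> (\<bar>k\<bar> + 1) * s" using that by (simp add: distrib_right)
    also have "\<dots> < (\<bar>k\<bar> + 1) * e" using that by (intro mult_strict_left_mono) auto
    finally have "\<bar>k\<bar> * s < - V" unfolding e(2) .
    moreover have "0 \<le> \<bar>k\<bar> * s" using that by simp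
    ultimately show ?thesis using assms by simp
  qed
  moreover have "((\<lambda>s. V + \<bar>k\<bar> * s) has_vector_derivative 0 + \<bar>k\<bar>) (at 0 within {0..<e})"
    using DERIV_add[OF DERIV_const DERIV_cmult_Id, of V "\<bar>k\<bar>" 0 "{0..<e}"]
    by (simp only: has_real_derivative_iff_has_vector_derivative)
  ultimately have "\<bar>k\<bar> \<in> tangent_vectors {-Us..<0} V"
    using e(1) by (intro tangent_vectorsI[where \<sigma> = "\<lambda>s. V + \<bar>k\<bar> * s" and e = e]) auto
  then have "k \<in> tangent_vectors {-Us..<0} V"
    by (cases "0 \<le> k") (auto intro: tangent_vectors_minus)
  moreover have "((\<lambda>U. (tS U, U)) has_derivative (\<lambda>h. (deriv \<psi> V / (\<psi> V)\<^sup>2 * h, h))) (at V)"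
    by (intro has_derivative_Pair has_derivative_ident tS_DERIV[OF V(1), unfolded has_field_derivative_def])
  ultimately have "(deriv \<psi> V / (\<psi> V)\<^sup>2 * k, k) \<in> tangent_vectors ((\<lambda>U. (tS U, U)) ` {-Us..<0}) (tS V, V)"
    by (rule tangent_vectors_image[where F = "\<lambda>U. (tS U, U)"])
  then show ?thesis unfolding k by (simp add: k_def)
qed

end

section \<open>The simple wave generated by the seed\<close>

locale simple_wave =
  fixes E :: eos and \<phi> :: "real \<Rightarrow> real" and U1 U2 \<delta> b p :: real
  assumes eos: "equation_of_state E" and nondeg: "nondegenerate E"
    and seed: "admissible_seed \<phi> U1 U2 \<delta> b p" and small: "amplitude_small E \<phi> U1 U2"
begin

abbreviation "R0 \<equiv> initial_data E \<phi>"

lemma smooth_\<phi>: "higher_differentiable_on n UNIV \<phi>"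
  using seed by (simp add: admissible_seed_def smooth_on_open_iff)

lemma zero_Adom: "0 \<in> Adom E"
  using zero_Rdom[OF eos] nondeg
  by (simp add: Adom_def connected_component_refl_eq Adens_def enthalpy_zero[OF eos] nondegenerate_def
      u0_def u1_def)

lemma R0_Adom: "R0 U \<in> Adom E" and Afun_R0: "Afun E (R0 U) = \<phi> U"
proof -
  have "\<phi> U \<in> Afun E ` Adom E" using small by (simp add: amplitude_small_def)
  then show "R0 U \<in> Adom E" "Afun E (R0 U) = \<phi> U"
    using Afun_inj[OF eos zero_Adom]
    by (auto simp: initial_data_def Ainv_def the_inv_into_f_f)
qed

lemma R0_Rdom: "R0 U \<in> Rdom E" and Adens_R0: "Adens E (R0 U) \<noteq> 0"
  using R0_Adom Adom_props(3)[OF eos] by auto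

text \<open>The inverse of \<open>\<AA>\<close> solves the autonomous equation \<open>y' = 1 / Adens y\<close>.\<close>

lemma smooth_R0: "higher_differentiable_on n UNIV R0"
proof -
  note inj = Afun_inj[OF eos zero_Adom]
  note D = Afun_has_derivative[OF eos zero_Adom]
  have oA: "open (Adom E)" by (rule Adom_props[OF eos])
  have c: "continuous_on (Adom E) (Afun E)"
    by (intro continuous_at_imp_continuous_on ballI DERIV_isCont[OF D])
  have o: "open (Afun E ` Adom E)" by (rule invariance_of_domain[OF c oA inj])
  have nz: "Adens E R \<noteq> 0" if "R \<in> Adom E" for R using that Adom_props(3)[OF eos] by auto
  have inv: "Ainv E (Afun E R) = R" if "R \<in> Adom E" for R
    using that inj by (simp add: Ainv_def the_inv_into_f_f)
  have "higher_differentiable_on n (Afun E ` Adom E) (Ainv E)" for n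
  proof (rule higher_differentiable_on_ode[OF oA o])
    show "higher_differentiable_on k (Adom E) (\<lambda>R. 1 / Adens E R)" for k
      using nz higher_differentiable_on_subset[OF higher_differentiable_on_fluid(4)[OF eos], of "Adom E" k]
        Adom_props(3)[OF eos] by (intro higher_differentiable_on_intros oA) auto
    show "Ainv E ` Afun E ` Adom E \<subseteq> Adom E" using inv by auto
    fix y assume "y \<in> Afun E ` Adom E"
    then obtain R where R: "R \<in> Adom E" "y = Afun E R" by auto
    have "(Ainv E has_derivative (*) (1 / Adens E R)) (at (Afun E R))"
      by (rule has_derivative_inverse_strong[OF oA R(1) c inv D[OF R(1), unfolded has_field_derivative_def]])
        (use nz[OF R(1)] in \<open>auto simp: fun_eq_iff\<close>)
    then show "(Ainv E has_real_derivative 1 / Adens E (Ainv E y)) (at y)"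
      using R inv by (simp add: has_field_derivative_def)
  qed
  then show ?thesis
    unfolding initial_data_def[abs_def]
    by (rule higher_differentiable_on_compose[OF o open_UNIV _ smooth_\<phi>])
      (use small in \<open>auto simp: amplitude_small_def\<close>)
qed

lemma R0_DERIV: "(R0 has_real_derivative deriv R0 U) (at U)"
  by (rule higher_differentiable_on_DERIV[OF smooth_R0])

text \<open>The chain rule for \<open>\<AA> \<circ> R0 = \<phi>\<close>: the source term is the derivative of the seed.\<close>

lemma Gsrc_R0: "Gsrc E R0 U = deriv \<phi> U"
proof -
  have "((\<lambda>U. Afun E (R0 U)) has_real_derivative Adens E (R0 U) * deriv R0 U) (at U)"
    by (rule DERIV_chain2[OF Afun_has_derivative[OF eos zero_Adom R0_Adom] R0_DERIV])
  then show ?thesis unfolding Afun_R0 by (simp add: Gsrc_def DERIV_imp_deriv)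
qed

definition lam :: "real \<Rightarrow> real" where "lam U = L1 E (R0 U)"

definition Nf :: "real \<Rightarrow> real" where "Nf U = nfac E (R0 U) / csnd E (R0 U)"

lemma Lb1_R0: "Lb1 E (R0 U) = lam U - 2 / Nf U"
  using L1_minus_Lb1[OF eos R0_Rdom] by (simp add: lam_def Nf_def)

lemma smooth_fluid_R0:
  "higher_differentiable_on n UNIV lam" "higher_differentiable_on n UNIV Nf"
  "higher_differentiable_on n UNIV (\<lambda>U. Lb1 E (R0 U))"
proof -
  have c: "higher_differentiable_on n UNIV (\<lambda>U. f (R0 U))"
    if "higher_differentiable_on n (Rdom E) f" for f :: "real \<Rightarrow> real"
    by (rule higher_differentiable_on_compose[OF open_Rdom[OF eos] open_UNIV that smooth_R0])
      (use R0_Rdom in auto)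
  note f = higher_differentiable_on_fluid[OF eos]
  show "higher_differentiable_on n UNIV lam"
    unfolding lam_def[abs_def] by (rule c[OF f(2)])
  show "higher_differentiable_on n UNIV (\<lambda>U. Lb1 E (R0 U))" by (rule c[OF f(3)])
  show "higher_differentiable_on n UNIV Nf"
    unfolding Nf_def[abs_def] using fluid_pos(1)[OF eos R0_Rdom]
    by (intro higher_differentiable_on_divide c[OF f(1)] c[OF higher_differentiable_on_csnd[OF eos]])
      (auto simp: less_imp_neq[symmetric])
qed

sublocale fold_profile "deriv \<phi>" lam Nf \<delta> b
proof
  show "higher_differentiable_on n UNIV (deriv \<phi>)" for n
    by (rule higher_differentiable_on_DERIV[OF smooth_\<phi>])
  show "(lam has_real_derivative - deriv \<phi> U) (at U)" for U
    using DERIV_chain2[OF L1_has_derivative[OF eos R0_Rdom] R0_DERIV, of U] Gsrc_R0[of U]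
    by (simp add: lam_def[abs_def] Gsrc_def)
  have sub: "\<bar>u1 (R0 U) / u0 (R0 U)\<bar> < csnd E (R0 U)" for U
    using small by (simp add: amplitude_small_def)
  show "0 < lam U" for U unfolding lam_def by (rule subsonic_signs[OF eos R0_Rdom sub])
  show "lam U - 2 / Nf U < 0" for U
    unfolding Lb1_R0[symmetric] by (rule subsonic_signs[OF eos R0_Rdom sub])
  show "0 < Nf U" for U using fluid_pos[OF eos R0_Rdom, of U] by (simp add: Nf_def)
  show "0 < \<delta>" "0 < b" "deriv \<phi> 0 = - \<delta>" "deriv (deriv \<phi>) 0 = 0"
    using seed by (auto simp: admissible_seed_def eval_nat_numeral)
  show "b / 2 \<le> deriv (deriv (deriv \<phi>)) U \<and> deriv (deriv (deriv \<phi>)) U \<le> 2 * b" if "\<bar>U\<bar> \<le> 1" for U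
    using seed that by (auto simp: admissible_seed_def eval_nat_numeral)
qed (rule smooth_fluid_R0)+

end

locale simple_wave_region = simple_wave E \<phi> U1 U2 \<delta> b p
  + fold_region "deriv \<phi>" "simple_wave.lam E \<phi>" "simple_wave.Nf E \<phi>" \<delta> b Us
  for E \<phi> U1 U2 \<delta> b p Us
begin

definition Rs :: "real \<times> real \<Rightarrow> real" where "Rs q = R0 (snd q)"

abbreviation "r \<equiv> Rs \<circ> Yinv"

lemma r_Y: "q \<in> Mbar \<Longrightarrow> r (Y q) = R0 (snd q)"
  by (simp add: Rs_def Yinv_Y)

lemma csnd_nfac: "csnd E (R0 U) / nfac E (R0 U) = 1 / Nf U" "nfac E (R0 U) / csnd E (R0 U) = Nf U"
  by (simp_all add: Nf_def)

lemma Nf_nz: "Nf U \<noteq> 0" using N_pos[of U] by simp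

lemma x1_t_DERIV: "((\<lambda>s. x1 (s, U)) has_real_derivative lam U) (at t)"
  unfolding x1_def x_def by (auto intro!: derivative_eq_intros)

lemma x1_U_DERIV: "((\<lambda>u. x1 (t, u)) has_real_derivative - m t U) (at U)"
  using x_DERIV[of t U] by (simp add: x1_def)

lemma mu_Pair: "mu (t, U) = Nf U * m t U" by (simp add: mu_def)

lemma geometric_solution_exists: "geometric_solution E R0 Rs x1 mu"
  unfolding geometric_solution_def
proof (intro allI conjI)
  fix t U
  show "((\<lambda>s. x1 (s, U)) has_real_derivative L1 E (Rs (t, U))) (at t)"
    using x1_t_DERIV by (simp add: Rs_def lam_def)
  show "((\<lambda>u. x1 (t, u)) has_real_derivative - (csnd E (Rs (t, U)) / nfac E (Rs (t, U))) * mu (t, U)) (at U)"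
    using x1_U_DERIV[of t U] Nf_nz[of U] by (simp add: Rs_def csnd_nfac mu_Pair)
qed (auto simp: Rs_def R0_Rdom x1_def x_def)

text \<open>Along each characteristic \<open>R\<close> is constant, so \<open>x1\<close> is affine in \<open>t\<close>; then \<open>mu\<close> is read off
  from the \<open>U\<close>-derivative of \<open>x1\<close>.\<close>

lemma geometric_solution_unique:
  assumes "geometric_solution E R0 R x1' \<mu>'"
  shows "R = Rs" "x1' = x1" "\<mu>' = mu"
proof -
  have R: "R (t, U) = R0 U" for t U
  proof -
    have "R (t, U) = R (0, U)"
      by (rule DERIV_isconst_all[where f = "\<lambda>s. R (s, U)", OF allI]) (use assms in \<open>auto simp: geometric_solution_def\<close>)
    then show ?thesis using assms by (simp add: geometric_solution_def)
  qed
  then show "R = Rs" by (auto simp: Rs_def fun_eq_iff)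
  have x: "x1' (t, U) = x1 (t, U)" for t U
  proof -
    have "((\<lambda>s. x1' (s, U)) has_real_derivative lam U) (at s)" for s
      using assms unfolding geometric_solution_def R lam_def by blast
    from DERIV_diff[OF this x1_t_DERIV[of U]]
    have "((\<lambda>s. x1' (s, U) - x1 (s, U)) has_real_derivative 0) (at s)" for s by simp
    then have "x1' (t, U) - x1 (t, U) = x1' (0, U) - x1 (0, U)"
      by (intro DERIV_isconst_all[where f = "\<lambda>s. x1' (s, U) - x1 (s, U)", OF allI])
    then show ?thesis using assms by (simp add: geometric_solution_def x1_def x_def)
  qed
  then show xx: "x1' = x1" by (auto simp: fun_eq_iff)
  have "\<mu>' (t, U) = mu (t, U)" for t U
  proof -
    have "((\<lambda>u. x1 (t, u)) has_real_derivative - (1 / Nf U) * \<mu>' (t, U)) (at U)"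
      using assms unfolding xx geometric_solution_def R csnd_nfac by blast
    from DERIV_unique[OF this x1_U_DERIV] show ?thesis
      using Nf_nz[of U] by (simp add: mu_Pair field_simps)
  qed
  then show "\<mu>' = mu" by (auto simp: fun_eq_iff)
qed

lemma dL_x1: "dL x1 (t, U) = lam U" and dX_x1: "dX x1 (t, U) = - m t U"
  using DERIV_imp_deriv[OF x1_t_DERIV] DERIV_imp_deriv[OF x1_U_DERIV]
  by (auto simp: dL_def dX_def)

lemma dL_mu: "dL mu (t, U) = Nf U * deriv \<phi> U"
proof -
  have "((\<lambda>s. mu (s, U)) has_real_derivative Nf U * deriv \<phi> U) (at t)"
    unfolding mu_Pair m_def by (auto intro!: derivative_eq_intros)
  then show ?thesis by (simp add: dL_def DERIV_imp_deriv)
qed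

lemma dX_Rs: "dX Rs q = deriv R0 (snd q)"
  by (cases q) (simp add: dX_def Rs_def)

lemma cn_mu_eq: "cn_mu E Rs mu = (\<lambda>q. m (fst q) (snd q))"
  using Nf_nz by (auto simp: cn_mu_def Rs_def csnd_nfac mu_def fun_eq_iff)

lemma smooth_on_geometric:
  "smooth_on UNIV Rs" "smooth_on UNIV mu" "smooth_on UNIV x1"
  "smooth_on UNIV (\<lambda>q. L_rect E (Rs q))"
  "smooth_on UNIV (\<lambda>q. mu q *\<^sub>R Lb_rect E (Rs q))"
  "smooth_on UNIV (\<lambda>q. mu q *\<^sub>R X_rect E (Rs q))"
proof -
  have c: "higher_differentiable_on n UNIV (\<lambda>q :: real \<times> real. f (snd q))"
    if "higher_differentiable_on n UNIV f" for n and f :: "real \<Rightarrow> real"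
    by (rule higher_differentiable_on_compose[OF open_UNIV open_UNIV that higher_differentiable_on_snd]) auto
  note s = c[OF smooth_fluid_R0(1)] c[OF smooth_fluid_R0(3)] smooth_mu
  note [simp] = smooth_on_open_iff[OF open_UNIV] Rs_def lam_def[symmetric]
  show "smooth_on UNIV Rs" using c[OF smooth_R0] by (simp add: Rs_def[abs_def])
  show "smooth_on UNIV mu" "smooth_on UNIV x1" using smooth_mu smooth_x1 by auto
  show "smooth_on UNIV (\<lambda>q. L_rect E (Rs q))"
    using s by (auto simp: L_rect_def intro!: higher_differentiable_on_intros)
  show "smooth_on UNIV (\<lambda>q. mu q *\<^sub>R Lb_rect E (Rs q))"
    using s by (auto simp: Lb_rect_def intro!: higher_differentiable_on_intros)
  show "smooth_on UNIV (\<lambda>q. mu q *\<^sub>R X_rect E (Rs q))"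
    using s by (auto simp: X_rect_def L_rect_def Lb_rect_def intro!: higher_differentiable_on_intros)
qed

lemma pushforward_eq:
  "pushforward x1 q v = (fst v, lam (snd q) * fst v - m (fst q) (snd q) * snd v)"
  unfolding pushforward_def
  by (simp add: frechet_derivative_at[OF Y_has_derivative, symmetric])

lemma pushforward_frame:
  "Y differentiable (at q)" "pushforward x1 q (L_geo q) = L_rect E (Rs q)"
  "pushforward x1 q (X_geo q) = mu q *\<^sub>R X_rect E (Rs q)"
  "pushforward x1 q (Lb_geo mu q) = mu q *\<^sub>R Lb_rect E (Rs q)"
  using Y_has_derivative[of q UNIV] Nf_nz[of "snd q"]
  by (auto simp: differentiable_def pushforward_eq L_geo_def X_geo_def Lb_geo_def L_rect_def
      Lb_rect_def X_rect_def Rs_def Lb1_R0 lam_def[symmetric] mu_def field_simps)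

text \<open>Outside the support of the seed the fluid is at rest with enthalpy \<open>Hbar\<close>.\<close>

lemma trivial_outside:
  assumes "U \<notin> {-U1..U2}"
  shows "Rs (t, U) = 0" "dL x1 (t, U) = sound E (Hbar E)"
    "dLb mu x1 (t, U) / mu (t, U) = - sound E (Hbar E)" "mu (t, U) = 1 / sound E (Hbar E)"
    "0 < sound E (Hbar E)"
proof -
  have z: "\<phi> V = 0" if "V \<notin> {-U1..U2}" for V using seed that by (auto simp: admissible_seed_def)
  have "Afun E 0 = 0" by (simp add: Afun_def zero_ereal_def)
  then have R: "R0 U = 0"
    using the_inv_into_f_f[OF Afun_inj[OF eos zero_Adom] zero_Adom] z[OF assms]
    by (simp add: initial_data_def Ainv_def)
  have "(\<phi> has_real_derivative 0) (at U)"
    by (rule has_field_derivative_transform_within_open[OF DERIV_const[of 0], of "- {-U1..U2}"])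
      (use assms z in auto)
  then have d: "deriv \<phi> U = 0" by (rule DERIV_imp_deriv)
  show c: "0 < sound E (Hbar E)" using eos by (auto simp: equation_of_state_def)
  have l: "lam U = sound E (Hbar E)" "Nf U = 1 / sound E (Hbar E)"
    by (simp_all add: lam_def Nf_def R fluid_zero[OF eos])
  have m: "m t U = 1" by (simp add: m_def d)
  show "Rs (t, U) = 0" by (simp add: Rs_def R)
  show "dL x1 (t, U) = sound E (Hbar E)" by (simp add: dL_x1 l)
  show "mu (t, U) = 1 / sound E (Hbar E)" by (simp add: mu_Pair l m)
  show "dLb mu x1 (t, U) / mu (t, U) = - sound E (Hbar E)"
    using c by (simp add: dLb_def dL_x1 dX_x1 mu_Pair l m field_simps)
qed

subsection \<open>The Cauchy horizon as an integral curve\<close>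

definition gam :: "real \<Rightarrow> real \<times> real" where "gam U = (tCH U, U)"

lemma gam_has_vector_derivative:
  "(gam has_vector_derivative (mu (gam U) / 2, 1)) (at U within S)"
proof -
  have "(tCH has_vector_derivative Nf U / 2 * m (tCH U) U) (at U within S)"
    using has_field_derivative_at_within[OF tCH_DERIV]
    by (simp only: has_real_derivative_iff_has_vector_derivative)
  from has_vector_derivative_Pair[OF this has_vector_derivative_id]
  show ?thesis by (simp add: gam_def[abs_def] mu_Pair)
qed

lemma CH_curve_gam: "CH_curve mu T Us gam"
  using gam_has_vector_derivative
  by (simp add: CH_curve_def integral_curve_def Lb_geo_def gam_def tCH_0)

text \<open>The second component has unit speed, hence equals the parameter; the first one then satisfies the
  linear equation.\<close>

lemma CH_curve_unique:
  assumes "CH_curve mu T Us \<gamma>" "U \<in> {0..Us}"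
  shows "\<gamma> U = gam U"
proof -
  have d: "(\<gamma> has_vector_derivative (mu (\<gamma> V) / 2, 1)) (at V within {0..Us})" if "V \<in> {0..Us}" for V
    using assms(1) that by (simp add: CH_curve_def integral_curve_def Lb_geo_def)
  have 0: "\<gamma> 0 = (T, 0)" using assms(1) by (simp add: CH_curve_def)
  have d1: "((\<lambda>V. fst (\<gamma> V)) has_real_derivative mu (\<gamma> V) / 2) (at V within {0..Us})"
    and d2: "((\<lambda>V. snd (\<gamma> V)) has_real_derivative 1) (at V within {0..Us})" if V: "V \<in> {0..Us}" for V
    using has_derivative_fst[OF d[OF V, unfolded has_vector_derivative_def]]
      has_derivative_snd[OF d[OF V, unfolded has_vector_derivative_def]]
    by (simp_all add: has_real_derivative_iff_has_vector_derivative has_vector_derivative_def)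
  have "((\<lambda>V. snd (\<gamma> V) - V) has_real_derivative 0) (at V within {0..Us})" if "V \<in> {0..Us}" for V
    using DERIV_diff[OF d2[OF that] DERIV_ident] by simp
  from has_field_derivative_zero_constant[OF convex_real_interval(5) this]
  obtain c where "snd (\<gamma> V) - V = c" if "V \<in> {0..Us}" for V by auto
  then have s: "snd (\<gamma> V) = V" if "V \<in> {0..Us}" for V
    using that 0 Us by (metis atLeastAtMost_iff diff_0_right eq_iff_diff_eq_0 less_eq_real_def snd_conv)
  have "fst (\<gamma> U) = tCH U"
  proof (rule tCH_unique[OF _ _ assms(2)])
    fix V assume V: "V \<in> {0..Us}"
    have "mu (\<gamma> V) / 2 = Nf V / 2 * m (fst (\<gamma> V)) V" using s[OF V] by (simp add: mu_def)
    with d1[OF V] show "((\<lambda>V. fst (\<gamma> V)) has_real_derivative Nf V / 2 * m (fst (\<gamma> V)) V) (at V within {0..Us})"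
      by simp
  qed (simp add: 0)
  then show ?thesis using s[OF assms(2)] by (simp add: gam_def prod_eq_iff)
qed

lemma gam_mem_Mbar: "U \<in> {0..Us} \<Longrightarrow> gam U \<in> Mbar"
  using tCH_pos[of U] Us by (auto simp: gam_def mem_Mbar)

lemma mu_pos_M: "q \<in> M \<Longrightarrow> 0 < mu q"
  using m_pos_M N_pos by (simp add: mu_def)

subsection \<open>The solution in rectangular coordinates\<close>

text \<open>A function of \<open>U\<close> alone is annihilated by \<open>L = \<partial>\<^sub>t + L1 \<partial>\<^sub>1\<close>, and its \<open>x\<^sup>1\<close>-derivative carries the factor
  \<open>\<partial>U / \<partial>x\<^sup>1 = - 1 / m\<close>.\<close>

lemma rectangular_derivatives:
  assumes q: "q \<in> Y ` M" and h: "\<And>U. (h has_real_derivative h' U) (at U)"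
    and f: "\<And>q. q \<in> Y ` M \<Longrightarrow> f q = h (snd (Yinv q))"
  shows "f differentiable (at q within Y ` M)"
    "pt (Y ` M) f q = - lam (snd (Yinv q)) * px (Y ` M) f q"
    "px (Y ` M) f q = - h' (snd (Yinv q)) / m (fst (Yinv q)) (snd (Yinv q))"
proof -
  obtain z where z: "z \<in> M" "q = Y z" using q by blast
  have Yz: "Yinv (Y z) = z" using z M_subset_Mbar Yinv_Y by blast
  have D: "(f has_derivative (\<lambda>v. (lam (snd z) * fst v - snd v) / m (fst z) (snd z) * h' (snd z)))
      (at (Y z) within Y ` M)"
    by (rule pullback_has_derivative[OF z(1) h f])
  note F = frechet_derivative_within_image[OF z(1) D]
  show "f differentiable (at q within Y ` M)" using D z(2) by (auto simp: differentiable_def)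
  show "px (Y ` M) f q = - h' (snd (Yinv q)) / m (fst (Yinv q)) (snd (Yinv q))"
    unfolding px_def z(2) F Yz by simp
  show "pt (Y ` M) f q = - lam (snd (Yinv q)) * px (Y ` M) f q"
    unfolding px_def pt_def z(2) F Yz by simp
qed

lemma r_eq: "r q = R0 (snd (Yinv q))" by (simp add: Rs_def)

lemma px_r: "q \<in> Y ` M \<Longrightarrow> px (Y ` M) r q = - deriv R0 (snd (Yinv q)) / m (fst (Yinv q)) (snd (Yinv q))"
  by (rule rectangular_derivatives(3)[OF _ R0_DERIV r_eq])

lemma initial_slice: "(0, y) \<in> Y ` M \<Longrightarrow> Yinv (0, y) = (0, - y)"
proof -
  assume "(0, y) \<in> Y ` M"
  then obtain z where z: "z \<in> M" "(0, y) = Y z" by blast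
  then have "Yinv (0, y) = z" using M_subset_Mbar Yinv_Y by (metis subsetD)
  moreover have "fst z = 0" "y = - snd z" using z(2) by (auto simp: Upsilon_def x1_def x_def)
  ultimately show ?thesis by (simp add: prod_eq_iff)
qed

lemma classical_solution_r: "classical_solution E (Y ` M) R0 r"
  unfolding classical_solution_def
proof (intro conjI ballI allI impI)
  show "smooth_on (Y ` M) r" by (rule smooth_on_pullback[OF smooth_R0 r_eq])
  fix q assume q: "q \<in> Y ` M"
  note D = rectangular_derivatives[OF q R0_DERIV r_eq]
  show "r q \<in> Rdom E" by (simp add: Rs_def R0_Rdom)
  show "r differentiable (at q within Y ` M)" by (rule D)
  show "L_op E (Y ` M) r r q = 0" unfolding L_op_def D(2) by (simp add: Rs_def lam_def)
next
  fix y assume "(0, y) \<in> Y ` M"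
  then show "r (0, y) = R0 (- y)" by (simp add: Rs_def initial_slice)
qed

lemma eikonal_function_U: "eikonal_function E (Y ` M) r (snd \<circ> Yinv)"
  unfolding eikonal_function_def
proof (intro conjI ballI allI impI)
  show "smooth_on (Y ` M) (snd \<circ> Yinv)"
    by (rule smooth_on_pullback[of "\<lambda>U. U"]) (simp_all add: higher_differentiable_on_ident)
  fix q assume q: "q \<in> Y ` M"
  then obtain z where z: "z \<in> M" "q = Y z" by blast
  have Yz: "Yinv q = z" using z M_subset_Mbar Yinv_Y by blast
  have D: "(snd \<circ> Yinv) differentiable (at q within Y ` M)"
    "pt (Y ` M) (snd \<circ> Yinv) q = - lam (snd (Yinv q)) * px (Y ` M) (snd \<circ> Yinv) q"
    "px (Y ` M) (snd \<circ> Yinv) q = - 1 / m (fst (Yinv q)) (snd (Yinv q))"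
    by (rule rectangular_derivatives[OF q DERIV_ident]; simp)+
  show "(snd \<circ> Yinv) differentiable (at q within Y ` M)" by (rule D)
  show "(\<Sum>\<alpha>\<in>UNIV. \<Sum>\<beta>\<in>UNIV. matrix_inv (hmat E (r q)) $ \<alpha> $ \<beta> *
      vec2 (pt (Y ` M) (snd \<circ> Yinv) q, px (Y ` M) (snd \<circ> Yinv) q) $ \<alpha> *
      vec2 (pt (Y ` M) (snd \<circ> Yinv) q, px (Y ` M) (snd \<circ> Yinv) q) $ \<beta>) = 0"
    by (rule inverse_metric_null[OF eos]) (simp_all only: r_eq R0_Rdom D(2) lam_def)
  show "0 < pt (Y ` M) (snd \<circ> Yinv) q"
    unfolding D(2,3) Yz using m_pos_M[OF z(1)] \<l>_pos[of "snd z"] by (simp add: divide_neg_pos)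
next
  fix y assume "(0, y) \<in> Y ` M"
  then show "(snd \<circ> Yinv) (0, y) = - y" by (simp add: initial_slice)
qed

lemma density_eq:
  assumes "q \<in> Y ` M"
  shows "mu (Yinv q) = - inverse (csnd E (r q) / nfac E (r q) * px (Y ` M) (snd \<circ> Yinv) q)"
proof -
  have "px (Y ` M) (snd \<circ> Yinv) q = - 1 / m (fst (Yinv q)) (snd (Yinv q))"
    by (rule rectangular_derivatives(3)[OF assms DERIV_ident]) simp
  then show ?thesis by (simp add: Rs_def csnd_nfac mu_def)
qed

end

context simple_wave_region
begin

subsection \<open>Uniform estimates\<close>

lemma deriv_R0_nz: "U \<in> {-Us..Us} \<Longrightarrow> deriv R0 U \<noteq> 0"
  using \<psi>_neg[of U] Gsrc_R0[of U] by (auto simp: Gsrc_def)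

text \<open>By the previous lemma the right-hand side of \<open>\<partial>\<^sub>1 R = - N * R0' / \<mu>\<close> has no zero on the region.\<close>

lemma comparable_gradient: "comparable {-Us..Us} (\<lambda>U. Nf U * \<bar>deriv R0 U\<bar>) (\<lambda>_. 1)"
proof (rule comparable_pos)
  have "continuous_on {-Us..Us} (deriv R0)"
    using higher_differentiable_on_DERIV(2)[OF smooth_R0, of 0]
    by (auto intro: continuous_on_subset)
  then show "continuous_on {-Us..Us} (\<lambda>U. Nf U * \<bar>deriv R0 U\<bar>)" by (intro continuous_intros)
qed (use N_pos deriv_R0_nz in auto)

lemma comparable_dL_mu: "comparable {-Us..Us} (\<lambda>U. - (Nf U * deriv \<phi> U)) (\<lambda>_. \<delta>)"
proof (rule comparable_pos[where h = "\<lambda>U. Nf U * (- deriv \<phi> U) / \<delta>"])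
  show "continuous_on {-Us..Us} (\<lambda>U. Nf U * (- deriv \<phi> U) / \<delta>)"
    using \<delta>_pos by (intro continuous_intros) auto
  show "0 < Nf U * (- deriv \<phi> U) / \<delta>" if "U \<in> {-Us..Us}" for U
    using N_pos[of U] \<psi>_neg[OF that] \<delta>_pos by (intro divide_pos_pos mult_pos_pos) simp_all
qed (use \<delta>_pos in auto)

lemma comparable_mu_tCH: "comparable {0..Us} (\<lambda>U. mu (tCH U, U)) (\<lambda>U. U\<^sup>2)"
  by (rule comparable_mult[OF comparable_tCH(1), where h = Nf])
    (auto intro!: continuous_intros N_pos simp: mu_Pair)

lemma snd_Mbar: "q \<in> Mbar \<Longrightarrow> snd q \<in> {-Us..Us}"
  using Us by (cases q) (auto simp: mem_Mbar)

text \<open>The estimates behind all the \<open>O_pos\<close> statements, with one constant for all of them.\<close>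

definition uniform_bounds :: "real \<Rightarrow> bool" where
  "uniform_bounds K \<longleftrightarrow> 1 \<le> K \<and>
    (\<forall>t. \<forall>U\<in>{-Us..Us}. Opos (1 / K) K (- dL mu (t, U)) \<delta>) \<and>
    (\<forall>U\<in>{-Us..0}. Opos (1 / K) K (deriv (deriv \<phi>) U / (deriv \<phi> U)\<^sup>2) U) \<and>
    (\<forall>U\<in>{-Us..0}. Opos (1 / K) K (tS U - T) (U\<^sup>2)) \<and>
    (\<forall>U\<in>{-Us..0}. Opos (1 / K) K (lam U * (deriv (deriv \<phi>) U / (deriv \<phi> U)\<^sup>2)) U) \<and>
    (\<forall>U\<in>{0..Us}. Opos (1 / K) K (Nf U / 2 * m (tCH U) U) (U\<^sup>2)) \<and>
    (\<forall>U\<in>{0..Us}. Opos (1 / K) K (tCH U - T) (U ^ 3)) \<and>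
    (\<forall>U\<in>{0..Us}. Opos (1 / K) K (mu (tCH U, U)) (U\<^sup>2)) \<and>
    (\<forall>U\<in>{0..Us}. Opos (1 / K) K (- ((lam U - 2 / Nf U) * (Nf U / 2 * m (tCH U) U))) (U\<^sup>2)) \<and>
    (\<forall>U\<in>{-Us..Us}. Opos (1 / K) K (Nf U * \<bar>deriv R0 U\<bar>) 1)"

text \<open>Finitely many eventual statements hold simultaneously.\<close>

lemma uniform_bounds_exist: "\<exists>K. uniform_bounds K"
proof -
  have "\<forall>\<^sub>F K in at_top. \<forall>t. \<forall>U\<in>{-Us..Us}. Opos (1 / K) K (- dL mu (t, U)) \<delta>"
    unfolding dL_mu by (rule eventually_mono[OF comparable_eventually[OF comparable_dL_mu]]) simp
  note e = eventually_ge_at_top[of "1 :: real"] this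
    comparable_eventually[OF comparable_tS(1)] comparable_eventually[OF comparable_tS(2)]
    comparable_eventually[OF comparable_tS(3)] comparable_eventually[OF comparable_tCH(2)]
    comparable_eventually[OF comparable_tCH(3)] comparable_eventually[OF comparable_mu_tCH]
    comparable_eventually[OF comparable_xCH] comparable_eventually[OF comparable_gradient]
  from eventually_happens'[OF trivial_limit_at_top_linorder, OF eventually_conj[OF e(1)
      eventually_conj[OF e(2) eventually_conj[OF e(3) eventually_conj[OF e(4) eventually_conj[OF e(5)
      eventually_conj[OF e(6) eventually_conj[OF e(7) eventually_conj[OF e(8)
      eventually_conj[OF e(9) e(10)]]]]]]]]]]
  show ?thesis unfolding uniform_bounds_def[abs_def] .
qed

subsection \<open>Blow-up of the gradient and regularity up to the singular curve\<close>

lemma Yinv_M: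
  assumes "q \<in> Y ` M"
  shows "Yinv q \<in> M"
proof -
  obtain z where "z \<in> M" "q = Y z" using assms by blast
  then show ?thesis using Yinv_Y[OF subsetD[OF M_subset_Mbar]] by simp
qed

lemma abs_px_r:
  assumes "q \<in> Y ` M"
  shows "\<bar>px (Y ` M) r q\<bar> = 1 / mu (Yinv q) * \<bar>nfac E (r q) / csnd E (r q) * dX Rs (Yinv q)\<bar>"
    "Opos (1 / K) K (Nf (snd (Yinv q)) * \<bar>deriv R0 (snd (Yinv q))\<bar>) 1 \<Longrightarrow>
      Opos (1 / K) K \<bar>px (Y ` M) r q\<bar> (1 / mu (Yinv q))"
proof -
  note z = Yinv_M[OF assms]
  note m = m_pos_M[OF z] and N = N_pos[of "snd (Yinv q)"]
  have eq: "\<bar>px (Y ` M) r q\<bar> = Nf (snd (Yinv q)) * \<bar>deriv R0 (snd (Yinv q))\<bar> * (1 / mu (Yinv q))"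
    using m N by (simp add: px_r[OF assms] mu_def abs_divide)
  show "\<bar>px (Y ` M) r q\<bar> = 1 / mu (Yinv q) * \<bar>nfac E (r q) / csnd E (r q) * dX Rs (Yinv q)\<bar>"
    unfolding eq dX_Rs r_eq csnd_nfac using N by (simp add: abs_mult)
  show "Opos (1 / K) K \<bar>px (Y ` M) r q\<bar> (1 / mu (Yinv q))"
    if "Opos (1 / K) K (Nf (snd (Yinv q)) * \<bar>deriv R0 (snd (Yinv q))\<bar>) 1"
    unfolding eq using that unfolding Opos_def by auto
qed

text \<open>The gradient is bounded below by a multiple of \<open>1 / \<mu>\<close>, and \<open>\<mu>\<close> is continuous up to the singular curve.\<close>

lemma gradient_blowup:
  assumes q: "q \<in> Mbar" "mu q = 0" and s: "\<And>n. s n \<in> Y ` M" "s \<longlonglongrightarrow> Y q"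
    and K: "1 \<le> K" "\<forall>U\<in>{-Us..Us}. Opos (1 / K) K (Nf U * \<bar>deriv R0 U\<bar>) 1"
  shows "filterlim (\<lambda>n. \<bar>px (Y ` M) r (s n)\<bar>) at_top sequentially"
proof -
  have z: "Yinv (s n) \<in> M" for n by (rule Yinv_M[OF s(1)])
  have "continuous_on (Y ` Mbar) Yinv" using homeomorphism_Y by (simp add: homeomorphism_def)
  then have "(\<lambda>n. Yinv (s n)) \<longlonglongrightarrow> Yinv (Y q)"
    by (rule continuous_on_tendsto_compose[OF _ s(2)])
      (use q s(1) M_subset_Mbar in \<open>blast intro: always_eventually\<close>)+
  then have l: "(\<lambda>n. Yinv (s n)) \<longlonglongrightarrow> q" using Yinv_Y[OF q(1)] by simp
  have "continuous_on UNIV mu" using smooth_mu[of 0] by simp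
  from continuous_on_tendsto_compose[OF this l] have "(\<lambda>n. mu (Yinv (s n))) \<longlonglongrightarrow> 0"
    using q(2) by simp
  then have "filterlim (\<lambda>n. inverse (mu (Yinv (s n)))) at_top sequentially"
    using mu_pos_M[OF z] by (intro filterlim_inverse_at_top) auto
  then have "filterlim (\<lambda>n. 1 / K * inverse (mu (Yinv (s n)))) at_top sequentially"
    using K(1) by (intro filterlim_tendsto_pos_mult_at_top[OF tendsto_const]) auto
  then show ?thesis
  proof (rule filterlim_at_top_mono, intro always_eventually allI)
    fix n
    have "snd (Yinv (s n)) \<in> {-Us..Us}" using z M_subset_Mbar snd_Mbar by blast
    then have "Opos (1 / K) K \<bar>px (Y ` M) r (s n)\<bar> (1 / mu (Yinv (s n)))"
      using K(2) abs_px_r(2)[OF s(1)] by blast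
    then show "1 / K * inverse (mu (Yinv (s n))) \<le> \<bar>px (Y ` M) r (s n)\<bar>"
      using mu_pos_M[OF z, of n] by (auto simp: Opos_def divide_inverse intro: mult_right_mono)
  qed
qed

lemma continuous_on_Yinv: "continuous_on (Y ` Mbar) Yinv"
  using homeomorphism_Y by (simp add: homeomorphism_def)

lemma continuous_on_r: "continuous_on (Y ` Mbar) r"
proof -
  have "continuous_on UNIV R0" using smooth_R0[of 0] by simp
  then have "continuous_on (Y ` Mbar) (\<lambda>q. R0 (snd (Yinv q)))"
    by (rule continuous_on_compose2) (auto intro!: continuous_intros continuous_on_Yinv)
  then show ?thesis by (simp add: Rs_def[abs_def] o_def)
qed

lemma continuous_on_hmat_r: "continuous_on (Y ` Mbar) (\<lambda>q. hmat E (r q))"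
  by (rule continuous_on_compose2[OF continuous_on_hmat[OF eos] continuous_on_r])
    (auto simp: Rs_def R0_Rdom)

lemma dL_power_Rs: "(dL ^^ Suc k) Rs = (\<lambda>_. 0)"
proof (induction k)
  case 0
  show ?case by (auto simp: dL_def Rs_def fun_eq_iff)
next
  case (Suc k)
  then show ?case by (simp add: dL_def fun_eq_iff)
qed

text \<open>From the first power on both sides vanish identically on the region.\<close>

lemma L_op_power_r:
  "continuous_on (Y ` Mbar) ((dL ^^ k) Rs \<circ> Yinv)"
  "q \<in> Y ` M \<Longrightarrow> (L_op E (Y ` M) r ^^ k) r q = ((dL ^^ k) Rs \<circ> Yinv) q"
proof -
  show "continuous_on (Y ` Mbar) ((dL ^^ k) Rs \<circ> Yinv)"
  proof (cases k)
    case 0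
    then show ?thesis using continuous_on_r by simp
  next
    case (Suc j)
    then show ?thesis by (simp only: dL_power_Rs o_def continuous_on_const)
  qed
  show "(L_op E (Y ` M) r ^^ k) r q = ((dL ^^ k) Rs \<circ> Yinv) q" if "q \<in> Y ` M"
    using that
  proof (induction k arbitrary: q)
    case 0
    then show ?case by simp
  next
    case (Suc k)
    have step: "(f ^^ Suc k) y = f ((f ^^ k) y)"
      for f :: "(real \<times> real \<Rightarrow> real) \<Rightarrow> real \<times> real \<Rightarrow> real" and y by simp
    have zero: "((dL ^^ Suc k) Rs \<circ> Yinv) q = 0" by (simp only: dL_power_Rs o_def)
    show ?case
    proof (cases k)
      case 0
      have "L_op E (Y ` M) r r q = 0"
        using classical_solution_r Suc.prems unfolding classical_solution_def by blast
      then show ?thesis unfolding zero unfolding step unfolding 0 by (simp only: funpow_0)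
    next
      case (Suc j)
      let ?f = "(L_op E (Y ` M) r ^^ k) r"
      have f: "?f y = 0" if "y \<in> Y ` M" for y
        using Suc.IH[OF that] unfolding Suc by (simp only: dL_power_Rs o_def)
      have "px (Y ` M) ?f q = - 0 / m (fst (Yinv q)) (snd (Yinv q))"
        "pt (Y ` M) ?f q = - lam (snd (Yinv q)) * px (Y ` M) ?f q"
        using rectangular_derivatives(2,3)[OF Suc.prems DERIV_const[of 0], of ?f] f by blast+
      then have "L_op E (Y ` M) r ?f q = 0" by (simp add: L_op_def[of E "Y ` M" r ?f q])
      then show ?thesis unfolding zero unfolding step .
    qed
  qed
qed

subsection \<open>Causal structure\<close>

lemma hprod_CH:
  assumes "U \<in> {0..Us}"
  shows "hprod E (Rs (gam U)) (pushforward x1 (gam U) (mu (gam U) / 2, 1))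
    (pushforward x1 (gam U) (mu (gam U) / 2, 1)) = 0"
proof -
  have "pushforward x1 (gam U) (mu (gam U) / 2, 1) = (mu (gam U) / 2) *\<^sub>R Lb_rect E (R0 U)"
    using Nf_nz[of U]
    by (simp add: pushforward_eq gam_def Lb_rect_def Lb1_R0 mu_Pair field_simps)
  then show ?thesis
    using hprod_null(2)[OF eos R0_Rdom, of U]
    by (simp only: hprod_scale Rs_def gam_def snd_conv mult_zero_right)
qed

lemma gam_image: "gam ` I = (\<lambda>U. (tCH U, U)) ` I" by (simp add: gam_def)

lemma CH_null:
  assumes "q \<in> Y ` gam ` {0..Us}"
  shows "Lb_rect E (r q) \<in> tangent_vectors (Y ` gam ` {0..Us}) q"
    "v \<in> tangent_vectors (Y ` gam ` {0..Us}) q \<Longrightarrow> hprod E (r q) v v = 0"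
proof -
  obtain U where U: "U \<in> {0..Us}" "q = Y (gam U)" using assms by blast
  have rq: "r q = R0 U" unfolding U(2) r_Y[OF gam_mem_Mbar[OF U(1)]] by (simp add: gam_def)
  have L: "Lb_rect E (r q) = (1, lam U - 2 / Nf U)" by (simp add: Lb_rect_def rq Lb1_R0 del: o_apply)
  note t = tangent_vectors_CH_image[OF U(1), folded gam_image gam_def, folded U(2)]
  show "Lb_rect E (r q) \<in> tangent_vectors (Y ` gam ` {0..Us}) q" unfolding L by (rule t(2))
  assume "v \<in> tangent_vectors (Y ` gam ` {0..Us}) q"
  then have v: "v = fst v *\<^sub>R Lb_rect E (r q)" unfolding L by (rule t(1))
  have "hprod E (r q) (fst v *\<^sub>R Lb_rect E (r q)) (fst v *\<^sub>R Lb_rect E (r q)) = 0"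
    unfolding hprod_scale rq hprod_null(2)[OF eos R0_Rdom] by simp
  then show "hprod E (r q) v v = 0" using v by simp
qed

lemma sing_curve_open: "sing_curve mu {-Us..<0} = (\<lambda>U. (tS U, U)) ` {-Us..<0}"
  by (rule sing_curve_eq) auto

lemma sing_curve_closed: "sing_curve mu {-Us..0} = (\<lambda>U. (tS U, U)) ` {-Us..0}"
  by (rule sing_curve_eq) auto

lemma cn_mu_derivatives:
  "dL (cn_mu E Rs mu) (t, U) = deriv \<phi> U" "dX (cn_mu E Rs mu) (t, U) = t * deriv (deriv \<phi>) U"
proof -
  have "((\<lambda>s. m s U) has_real_derivative deriv \<phi> U) (at t)"
    unfolding m_def by (auto intro!: derivative_eq_intros)
  then show "dL (cn_mu E Rs mu) (t, U) = deriv \<phi> U"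
    by (simp add: cn_mu_eq dL_def DERIV_imp_deriv)
  have "(m t has_real_derivative t * deriv (deriv \<phi>) U) (at U)"
    unfolding m_def by (rule derivative_eq_intros \<psi>_DERIV refl)+ simp
  then show "dX (cn_mu E Rs mu) (t, U) = t * deriv (deriv \<phi>) U"
    by (simp add: cn_mu_eq dX_def DERIV_imp_deriv)
qed

lemma cn_mu_differentiable: "cn_mu E Rs mu differentiable (at q)"
proof -
  have "higher_differentiable_on (Suc 0) UNIV (\<lambda>q. m (fst q) (snd q))"
    unfolding m_def
    by (intro higher_differentiable_on_intros higher_differentiable_on_compose[OF _ _ smooth_\<psi>]) auto
  from higher_differentiable_on_has_derivative[OF this UNIV_I]
  show ?thesis unfolding cn_mu_eq differentiable_def by blast
qed

lemma singular_curve_point: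
  assumes U: "U \<in> {-Us..<0}" and q: "q = (tS U, U)"
  shows "q \<in> Mbar" "dX (cn_mu E Rs mu) q \<noteq> 0"
    "Qvec E Rs mu q = (1, (deriv \<phi> U)\<^sup>2 / deriv (deriv \<phi>) U)" "deriv (deriv \<phi>) U < 0"
    "r (Y q) = R0 U" "pushforward x1 q (Qvec E Rs mu q) = (1, lam U)" "L_rect E (r (Y q)) = (1, lam U)"
proof -
  have U': "U \<in> {-Us..Us}" "\<bar>U\<bar> \<le> 1" using U Us by auto
  note t = tS_pos[OF U'(1)]
  show d: "deriv (deriv \<phi>) U < 0" using \<psi>'_sign(2)[OF U'(2)] U by auto
  show qM: "q \<in> Mbar" using U t by (simp add: q mem_Mbar)
  show "dX (cn_mu E Rs mu) q \<noteq> 0" using d t by (simp add: q cn_mu_derivatives)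
  show Q: "Qvec E Rs mu q = (1, (deriv \<phi> U)\<^sup>2 / deriv (deriv \<phi>) U)"
    using \<psi>_neg[OF U'(1)] d
    by (simp add: Qvec_def q cn_mu_derivatives L_geo_def X_geo_def tS_def power2_eq_square)
  show rY: "r (Y q) = R0 U" using r_Y[OF qM] by (simp add: q)
  show "L_rect E (r (Y q)) = (1, lam U)" unfolding rY by (simp add: L_rect_def lam_def)
  show "pushforward x1 q (Qvec E Rs mu q) = (1, lam U)"
    unfolding Q pushforward_eq by (simp add: q m_tS[OF U'(1)])
qed

lemma singular_curve_tangents:
  assumes U: "U \<in> {-Us..<0}" and q: "q = (tS U, U)"
  shows "Qvec E Rs mu q \<in> tangent_vectors (sing_curve mu {-Us..<0}) q"
    "0 < fst (Qvec E Rs mu q)" "snd (Qvec E Rs mu q) < 0"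
    "Qvec E Rs mu q \<notin> tangent_vectors {q'. snd q' = snd q} q"
    "pushforward x1 q (Qvec E Rs mu q) \<in> tangent_vectors (Y ` sing_curve mu {-Us..<0}) (Y q)"
    "v \<in> tangent_vectors (Y ` sing_curve mu {-Us..<0}) (Y q) \<Longrightarrow> v = fst v *\<^sub>R L_rect E (r (Y q))"
proof -
  note P = singular_curve_point[OF U q]
  have U': "U \<in> {-Us..Us}" using U Us by auto
  show "Qvec E Rs mu q \<in> tangent_vectors (sing_curve mu {-Us..<0}) q"
    unfolding P(3) sing_curve_open unfolding q by (rule tangent_vectors_sing[OF U])
  show "0 < fst (Qvec E Rs mu q)" unfolding P(3) by simp
  show neg: "snd (Qvec E Rs mu q) < 0"
    unfolding P(3) using P(4) \<psi>_neg[OF U'] by (simp add: divide_pos_neg)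
  show "Qvec E Rs mu q \<notin> tangent_vectors {q'. snd q' = snd q} q"
    using tangent_vectors_level_set[OF _ refl, of "Qvec E Rs mu q" q] neg by auto
  show "pushforward x1 q (Qvec E Rs mu q) \<in> tangent_vectors (Y ` sing_curve mu {-Us..<0}) (Y q)"
    unfolding P(6) sing_curve_open unfolding q by (rule tangent_vectors_sing_image(2)[OF U])
  show "v \<in> tangent_vectors (Y ` sing_curve mu {-Us..<0}) (Y q) \<Longrightarrow> v = fst v *\<^sub>R L_rect E (r (Y q))"
    unfolding P(7) sing_curve_open unfolding q by (rule tangent_vectors_sing_image(1)[OF U])
qed

lemma hprod_L: "hprod E (r q) (L_rect E (r q)) (L_rect E (r q)) = 0"
  unfolding r_eq by (rule hprod_null(1)[OF eos R0_Rdom])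

lemma hprod_L_scaled:
  "hprod E (r q) (a *\<^sub>R L_rect E (r q)) (c *\<^sub>R L_rect E (r q)) = 0"
  unfolding hprod_scale hprod_L by simp

text \<open>The integral curves are the characteristics \<open>U = const\<close> from time \<open>0\<close> up to the singular curve; they are
  disjoint because the change of variables is injective.\<close>

lemma null_foliation:
  "\<exists>\<sigma>. (\<forall>q\<in>sing_curve mu {-Us..<0}. integral_curve (\<lambda>y. L_rect E (r y)) (\<sigma> q) {0..fst q} \<and>
          \<sigma> q ` {0..fst q} \<subseteq> Y ` Mbar \<and> \<sigma> q (fst q) = Y q) \<and>
      (\<forall>q\<in>sing_curve mu {-Us..<0}. \<forall>q'\<in>sing_curve mu {-Us..<0}. q \<noteq> q' \<longrightarrow>
          \<sigma> q ` {0..fst q} \<inter> \<sigma> q' ` {0..fst q'} = {})"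
proof -
  define \<sigma> :: "real \<times> real \<Rightarrow> real \<Rightarrow> real \<times> real" where "\<sigma> = (\<lambda>q s. Y (s, snd q))"
  have mem: "(s, snd q) \<in> Mbar" if "q \<in> sing_curve mu {-Us..<0}" "s \<in> {0..fst q}" for q s
    using that by (auto simp: sing_curve_open mem_Mbar)
  show ?thesis
  proof (intro exI[of _ \<sigma>] conjI ballI impI)
    fix q assume q: "q \<in> sing_curve mu {-Us..<0}"
    show "integral_curve (\<lambda>y. L_rect E (r y)) (\<sigma> q) {0..fst q}"
      unfolding integral_curve_def
    proof
      fix s assume s: "s \<in> {0..fst q}"
      have "r (\<sigma> q s) = R0 (snd q)" unfolding \<sigma>_def r_Y[OF mem[OF q s]] by simp
      moreover have "((\<lambda>s. x s (snd q)) has_vector_derivative lam (snd q)) (at s within {0..fst q})"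
        using has_field_derivative_at_within[OF x1_t_DERIV[of "snd q" s]]
        by (simp add: x1_def has_real_derivative_iff_has_vector_derivative)
      from has_vector_derivative_Pair[OF has_vector_derivative_id this]
      have "(\<sigma> q has_vector_derivative (1, lam (snd q))) (at s within {0..fst q})"
        by (simp add: \<sigma>_def Y_Pair)
      ultimately show "(\<sigma> q has_vector_derivative L_rect E (r (\<sigma> q s))) (at s within {0..fst q})"
        by (simp only: L_rect_def lam_def)
    qed
    show "\<sigma> q ` {0..fst q} \<subseteq> Y ` Mbar" using mem[OF q] by (auto simp: \<sigma>_def)
    show "\<sigma> q (fst q) = Y q" by (simp add: \<sigma>_def)
    fix q' assume q': "q' \<in> sing_curve mu {-Us..<0}" and ne: "q \<noteq> q'"
    have "snd q \<noteq> snd q'" using ne q q' by (auto simp: sing_curve_open)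
    then show "\<sigma> q ` {0..fst q} \<inter> \<sigma> q' ` {0..fst q'} = {}"
      using inj_onD[OF inj_Y _ mem[OF q] mem[OF q']] by (fastforce simp: \<sigma>_def)
  qed
qed

lemma diffeomorphism_Y: "diffeomorphism M (Y ` M) Y Yinv"
  unfolding diffeomorphism_def
proof (intro conjI)
  have Yz: "Yinv (Y z) = z" if "z \<in> M" for z using that M_subset_Mbar Yinv_Y by blast
  then show "Yinv ` Y ` M = M" "\<forall>z\<in>M. Yinv (Y z) = z" "\<forall>y\<in>Y ` M. Y (Yinv y) = y"
    by (auto simp: image_image)
  have "higher_differentiable_on n UNIV Y" for n
    unfolding Upsilon_def[abs_def]
    by (intro higher_differentiable_on_Pair higher_differentiable_on_fst smooth_x1 open_UNIV)
  then show "smooth_on M Y"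
    unfolding smooth_on_def by (intro ballI exI[of _ UNIV] exI[of _ Y]) auto
qed (simp_all add: smooth_on_Yinv)

end

context simple_wave_region
begin

section \<open>The maximal development\<close>

lemma tS_eq_t_sing: "t_sing E R0 = tS"
  by (simp add: fun_eq_iff t_sing_def tS_def Gsrc_R0)

text \<open>The solution is unique, so a property of all solutions is a property of the explicit one.\<close>

lemma geometric_solution_all:
  assumes "P Rs x1 mu"
  shows "\<forall>R x1 \<mu>. geometric_solution E R0 R x1 \<mu> \<longrightarrow> P R x1 \<mu>"
proof (intro allI impI)
  fix R y \<mu> assume "geometric_solution E R0 R y \<mu>"
  from geometric_solution_unique[OF this] show "P R y \<mu>" using assms by simp
qed

lemma solution_exists: "\<exists>R x1 \<mu>. geometric_solution E R0 R x1 \<mu>"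
  using geometric_solution_exists by blast

lemma fst_gam: "fst (gam U) = tCH U"
  by (simp add: gam_def)

lemma classical_existence:
  shows "smooth_on UNIV R0" and "\<forall>t U. Rs (t, U) = R0 U"
    and "\<forall>q. Y differentiable (at q) \<and> pushforward x1 q (L_geo q) = L_rect E (Rs q) \<and>
          pushforward x1 q (X_geo q) = mu q *\<^sub>R X_rect E (Rs q) \<and>
          pushforward x1 q (Lb_geo mu q) = mu q *\<^sub>R Lb_rect E (Rs q)"
    and "\<forall>t U. U \<notin> {-U1..U2} \<longrightarrow>
         Rs (t, U) = 0 \<and> dL x1 (t, U) = sound E (Hbar E) \<and>
         dLb mu x1 (t, U) / mu (t, U) = - sound E (Hbar E) \<and>
         mu (t, U) = 1 / sound E (Hbar E) \<and> 0 < sound E (Hbar E)"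
  using smooth_R0 pushforward_frame trivial_outside
  by (auto simp: smooth_on_open_iff Rs_def)

lemma region_boundary:
  shows "closure M = M \<union> sing_curve mu {-Us..0}" and "M \<inter> sing_curve mu {-Us..0} = {}"
    and "\<forall>q\<in>M. 0 < mu q" and "\<forall>q\<in>sing_curve mu {-Us..0}. mu q = 0"
    and "\<forall>q\<in>gam ` {0<..Us}. 0 < mu q"
    and "\<forall>q\<in>crease mu Us. mu q = 0" and "crease mu Us \<subseteq> gam ` {0..Us}"
proof -
  show "closure M = M \<union> sing_curve mu {-Us..0}" "M \<inter> sing_curve mu {-Us..0} = {}"
    using closure_M Mbar_eq M_disjoint_sing by (simp_all only: sing_curve_closed)
  show "\<forall>q\<in>M. 0 < mu q" using mu_pos_M by blast
  show "\<forall>q\<in>sing_curve mu {-Us..0}. mu q = 0" by (simp add: sing_curve_def)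
  show "\<forall>q\<in>gam ` {0<..Us}. 0 < mu q"
    using m_tCH_pos N_pos by (auto simp: gam_def mu_Pair)
  show "\<forall>q\<in>crease mu Us. mu q = 0" by (simp add: crease_def)
  have "gam 0 = (T, 0)" by (simp add: gam_def tCH_0)
  then show "crease mu Us \<subseteq> gam ` {0..Us}" unfolding crease_eq using Us by force
qed

lemma cauchy_horizon:
  shows "CH_curve mu T Us gam" and "\<forall>\<gamma>. CH_curve mu T Us \<gamma> \<longrightarrow> (\<forall>U\<in>{0..Us}. \<gamma> U = gam U)"
    and "\<forall>U\<in>{0..Us}. gam U = (tCH U, U)" and "gam ` {0..Us} = {(tCH U, U) | U. U \<in> {0..Us}}"
proof -
  show "CH_curve mu T Us gam" by (rule CH_curve_gam)
  show "\<forall>\<gamma>. CH_curve mu T Us \<gamma> \<longrightarrow> (\<forall>U\<in>{0..Us}. \<gamma> U = gam U)"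
    by (intro allI impI ballI) (rule CH_curve_unique)
qed (auto simp: gam_def)

lemma curve_estimates:
  fixes K :: real
  defines "cmp \<equiv> Opos (1 / K) K"
  assumes "uniform_bounds K"
  shows "\<forall>t. \<forall>U\<in>{-Us..Us}. cmp (- dL mu (t, U)) \<delta>"
    and "\<forall>U\<in>{0..Us}. cmp (mu (tCH U, U)) (U\<^sup>2)"
    and "\<forall>q\<in>closure M. cmp (- dL mu q) \<delta>"
    and "\<forall>U\<in>{-Us..0}. (\<exists>d. (tS has_real_derivative d) (at U) \<and> cmp d U) \<and> cmp (tS U - T) (U\<^sup>2)"
    and "\<forall>U\<in>{-Us..0}. \<exists>d. ((\<lambda>u. x1 (tS u, u)) has_real_derivative d) (at U) \<and> cmp d U"
    and "\<forall>U\<in>{0..Us}. (\<exists>d. (tCH has_real_derivative d) (at U within {0..Us}) \<and> cmp d (U\<^sup>2)) \<and>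
            cmp (tCH U - T) (U ^ 3)"
    and "\<forall>U\<in>{0..Us}. \<exists>d. ((\<lambda>u. x1 (tCH u, u)) has_real_derivative d) (at U within {0..Us}) \<and>
            cmp (- d) (U\<^sup>2)"
proof -
  have K: "\<forall>t. \<forall>U\<in>{-Us..Us}. cmp (- dL mu (t, U)) \<delta>"
    "\<forall>U\<in>{-Us..0}. cmp (deriv (deriv \<phi>) U / (deriv \<phi> U)\<^sup>2) U"
    "\<forall>U\<in>{-Us..0}. cmp (tS U - T) (U\<^sup>2)"
    "\<forall>U\<in>{-Us..0}. cmp (lam U * (deriv (deriv \<phi>) U / (deriv \<phi> U)\<^sup>2)) U"
    "\<forall>U\<in>{0..Us}. cmp (Nf U / 2 * m (tCH U) U) (U\<^sup>2)"
    "\<forall>U\<in>{0..Us}. cmp (tCH U - T) (U ^ 3)"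
    "\<forall>U\<in>{0..Us}. cmp (- ((lam U - 2 / Nf U) * (Nf U / 2 * m (tCH U) U))) (U\<^sup>2)"
    "\<forall>U\<in>{0..Us}. cmp (mu (tCH U, U)) (U\<^sup>2)"
    using assms(2) unfolding uniform_bounds_def cmp_def by blast+
  show "\<forall>t. \<forall>U\<in>{-Us..Us}. cmp (- dL mu (t, U)) \<delta>" "\<forall>U\<in>{0..Us}. cmp (mu (tCH U, U)) (U\<^sup>2)"
    by (fact K)+
  have sub: "U \<in> {-Us..Us}" if "U \<in> {-Us..0}" for U using that Us by auto
  show "\<forall>q\<in>closure M. cmp (- dL mu q) \<delta>"
  proof
    fix q assume "q \<in> closure M"
    then have "snd q \<in> {-Us..Us}" unfolding closure_M by (rule snd_Mbar)
    then have "cmp (- dL mu (fst q, snd q)) \<delta>" using K(1) by blast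
    then show "cmp (- dL mu q) \<delta>" by simp
  qed
  show "\<forall>U\<in>{-Us..0}. (\<exists>d. (tS has_real_derivative d) (at U) \<and> cmp d U) \<and> cmp (tS U - T) (U\<^sup>2)"
    using tS_DERIV[OF sub] K(2,3) by blast
  show "\<forall>U\<in>{-Us..0}. \<exists>d. ((\<lambda>u. x1 (tS u, u)) has_real_derivative d) (at U) \<and> cmp d U"
  proof
    fix U assume U: "U \<in> {-Us..0}"
    have "((\<lambda>u. x1 (tS u, u)) has_real_derivative lam U * (deriv (deriv \<phi>) U / (deriv \<phi> U)\<^sup>2)) (at U)"
      using x_along_DERIV[OF tS_DERIV[OF sub[OF U]]] m_tS[OF sub[OF U]]
      by (simp add: x1_def mult.commute)
    then show "\<exists>d. ((\<lambda>u. x1 (tS u, u)) has_real_derivative d) (at U) \<and> cmp d U" using K(4) U by blast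
  qed
  show "\<forall>U\<in>{0..Us}. (\<exists>d. (tCH has_real_derivative d) (at U within {0..Us}) \<and> cmp d (U\<^sup>2)) \<and>
            cmp (tCH U - T) (U ^ 3)"
    using has_field_derivative_at_within[OF tCH_DERIV] K(5,6) by blast
  show "\<forall>U\<in>{0..Us}. \<exists>d. ((\<lambda>u. x1 (tCH u, u)) has_real_derivative d) (at U within {0..Us}) \<and>
            cmp (- d) (U\<^sup>2)"
  proof
    fix U assume U: "U \<in> {0..Us}"
    have "((\<lambda>u. x1 (tCH u, u)) has_real_derivative
        (lam U - 2 / Nf U) * (Nf U / 2 * m (tCH U) U)) (at U within {0..Us})"
      using has_field_derivative_at_within[OF xCH_DERIV] by (simp add: x1_def)
    then show "\<exists>d. ((\<lambda>u. x1 (tCH u, u)) has_real_derivative d) (at U within {0..Us}) \<and> cmp (- d) (U\<^sup>2)"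
      using K(7) U by blast
  qed
qed

lemma rectangular_picture:
  shows "homeomorphism (closure M) (Y ` closure M) Y Yinv"
    and "\<forall>q\<in>Y ` M. mu (Yinv q) =
             - inverse (csnd E (r q) / nfac E (r q) * px (Y ` M) (snd \<circ> Yinv) q)"
    and "continuous_on (Y ` closure M) r"
    and "\<forall>k::nat. continuous_on (Y ` closure M) ((dL ^^ k) Rs \<circ> Yinv) \<and>
            (\<forall>q\<in>Y ` M. (L_op E (Y ` M) r ^^ k) r q = ((dL ^^ k) Rs \<circ> Yinv) q)"
    and "continuous_on (Y ` closure M) (\<lambda>q. hmat E (r q))"
    and "\<forall>q\<in>Y ` closure M. invertible (hmat E (r q)) \<and> lorentzian (hmat E (r q))"
proof -
  show "homeomorphism (closure M) (Y ` closure M) Y Yinv"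
    using homeomorphism_Y by (simp only: closure_M)
  show "\<forall>q\<in>Y ` M. mu (Yinv q) =
             - inverse (csnd E (r q) / nfac E (r q) * px (Y ` M) (snd \<circ> Yinv) q)"
    using density_eq by blast
  show "continuous_on (Y ` closure M) r" "continuous_on (Y ` closure M) (\<lambda>q. hmat E (r q))"
    using continuous_on_r continuous_on_hmat_r by (simp_all only: closure_M)
  have "continuous_on (Y ` closure M) ((dL ^^ k) Rs \<circ> Yinv)" for k
    using L_op_power_r(1) by (simp only: closure_M)
  then show "\<forall>k::nat. continuous_on (Y ` closure M) ((dL ^^ k) Rs \<circ> Yinv) \<and>
            (\<forall>q\<in>Y ` M. (L_op E (Y ` M) r ^^ k) r q = ((dL ^^ k) Rs \<circ> Yinv) q)"
    using L_op_power_r(2) by blast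
  show "\<forall>q\<in>Y ` closure M. invertible (hmat E (r q)) \<and> lorentzian (hmat E (r q))"
    unfolding r_eq using hmat_invertible_lorentzian[OF eos R0_Rdom] by blast
qed

lemma gradient_estimates:
  fixes K :: real
  assumes "uniform_bounds K"
  shows "\<forall>q\<in>Y ` M. \<bar>px (Y ` M) r q\<bar> =
              1 / mu (Yinv q) * \<bar>nfac E (r q) / csnd E (r q) * dX Rs (Yinv q)\<bar> \<and>
            Opos (1 / K) K \<bar>px (Y ` M) r q\<bar> (1 / mu (Yinv q))"
    and "\<forall>q\<in>Y ` sing_curve mu {-Us..0}. \<forall>s::nat \<Rightarrow> real \<times> real. (\<forall>n. s n \<in> Y ` M) \<and> s \<longlonglongrightarrow> q \<longrightarrow>
            filterlim (\<lambda>n. \<bar>px (Y ` M) r (s n)\<bar>) at_top sequentially"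
proof -
  have K: "1 \<le> K" "\<forall>U\<in>{-Us..Us}. Opos (1 / K) K (Nf U * \<bar>deriv R0 U\<bar>) 1"
    using assms unfolding uniform_bounds_def by blast+
  show "\<forall>q\<in>Y ` M. \<bar>px (Y ` M) r q\<bar> =
              1 / mu (Yinv q) * \<bar>nfac E (r q) / csnd E (r q) * dX Rs (Yinv q)\<bar> \<and>
            Opos (1 / K) K \<bar>px (Y ` M) r q\<bar> (1 / mu (Yinv q))"
  proof
    fix q assume q: "q \<in> Y ` M"
    have "snd (Yinv q) \<in> {-Us..Us}" by (rule snd_Mbar[OF subsetD[OF M_subset_Mbar Yinv_M[OF q]]])
    with K(2) have "Opos (1 / K) K (Nf (snd (Yinv q)) * \<bar>deriv R0 (snd (Yinv q))\<bar>) 1" by blast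
    from abs_px_r(1)[OF q] abs_px_r(2)[OF q this]
    show "\<bar>px (Y ` M) r q\<bar> =
              1 / mu (Yinv q) * \<bar>nfac E (r q) / csnd E (r q) * dX Rs (Yinv q)\<bar> \<and>
            Opos (1 / K) K \<bar>px (Y ` M) r q\<bar> (1 / mu (Yinv q))" by (rule conjI)
  qed
  show "\<forall>q\<in>Y ` sing_curve mu {-Us..0}. \<forall>s::nat \<Rightarrow> real \<times> real. (\<forall>n. s n \<in> Y ` M) \<and> s \<longlonglongrightarrow> q \<longrightarrow>
            filterlim (\<lambda>n. \<bar>px (Y ` M) r (s n)\<bar>) at_top sequentially"
  proof (intro ballI allI impI)
    fix q and s :: "nat \<Rightarrow> real \<times> real"
    assume "q \<in> Y ` sing_curve mu {-Us..0}" and s: "(\<forall>n. s n \<in> Y ` M) \<and> s \<longlonglongrightarrow> q"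
    then obtain z where z: "z \<in> sing_curve mu {-Us..0}" "q = Y z" by blast
    have "z \<in> Mbar" using z(1) Mbar_eq sing_curve_closed by blast
    moreover have "mu z = 0" using z(1) by (simp add: sing_curve_def)
    ultimately show "filterlim (\<lambda>n. \<bar>px (Y ` M) r (s n)\<bar>) at_top sequentially"
      using gradient_blowup[OF _ _ _ _ K, of z s] s z(2) by blast
  qed
qed

lemma causal_structure:
  defines "B \<equiv> sing_curve mu {-Us..<0}"
  shows "\<forall>U\<in>{0..Us}. \<exists>w. (gam has_vector_derivative w) (at U within {0..Us}) \<and> w \<noteq> 0 \<and>
            hprod E (Rs (gam U)) (pushforward x1 (gam U) w) (pushforward x1 (gam U) w) = 0"
    and "\<forall>q\<in>Y ` gam ` {0..Us}. Lb_rect E (r q) \<in> tangent_vectors (Y ` gam ` {0..Us}) q \<and>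
            (\<forall>v\<in>tangent_vectors (Y ` gam ` {0..Us}) q. hprod E (r q) v v = 0)"
    and "\<forall>q\<in>B. cn_mu E Rs mu differentiable (at q) \<and> dX (cn_mu E Rs mu) q \<noteq> 0 \<and>
            Qvec E Rs mu q \<in> tangent_vectors B q"
    and "\<forall>q\<in>B. 0 < fst (Qvec E Rs mu q) \<and> snd (Qvec E Rs mu q) < 0 \<and>
            Qvec E Rs mu q \<notin> tangent_vectors {q'. snd q' = snd q} q"
    and "\<forall>q\<in>B. pushforward x1 q (Qvec E Rs mu q) \<in> tangent_vectors (Y ` B) (Y q) \<and>
            pushforward x1 q (Qvec E Rs mu q) = L_rect E (r (Y q))"
    and "\<forall>q\<in>Y ` B. \<forall>v\<in>tangent_vectors (Y ` B) q. hprod E (r q) (L_rect E (r q)) v = 0"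
    and "\<forall>q\<in>Y ` closure M. hprod E (r q) (L_rect E (r q)) (L_rect E (r q)) = 0"
    and "\<forall>q\<in>Y ` B. (\<exists>v\<in>tangent_vectors (Y ` B) q. v \<noteq> 0) \<and>
            (\<forall>v\<in>tangent_vectors (Y ` B) q. hprod E (r q) v v = 0)"
    and "\<exists>\<sigma>. (\<forall>q\<in>B. integral_curve (\<lambda>y. L_rect E (r y)) (\<sigma> q) {0..fst q} \<and>
               \<sigma> q ` {0..fst q} \<subseteq> Y ` closure M \<and> \<sigma> q (fst q) = Y q) \<and>
            (\<forall>q\<in>B. \<forall>q'\<in>B. q \<noteq> q' \<longrightarrow> \<sigma> q ` {0..fst q} \<inter> \<sigma> q' ` {0..fst q'} = {})"
proof -
  show "\<forall>U\<in>{0..Us}. \<exists>w. (gam has_vector_derivative w) (at U within {0..Us}) \<and> w \<noteq> 0 \<and>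
            hprod E (Rs (gam U)) (pushforward x1 (gam U) w) (pushforward x1 (gam U) w) = 0"
  proof
    fix U assume U: "U \<in> {0..Us}"
    have "(mu (gam U) / 2, 1) \<noteq> (0 :: real \<times> real)" by (simp add: zero_prod_def)
    with gam_has_vector_derivative hprod_CH[OF U]
    show "\<exists>w. (gam has_vector_derivative w) (at U within {0..Us}) \<and> w \<noteq> 0 \<and>
            hprod E (Rs (gam U)) (pushforward x1 (gam U) w) (pushforward x1 (gam U) w) = 0"
      by blast
  qed
  show "\<forall>q\<in>Y ` gam ` {0..Us}. Lb_rect E (r q) \<in> tangent_vectors (Y ` gam ` {0..Us}) q \<and>
            (\<forall>v\<in>tangent_vectors (Y ` gam ` {0..Us}) q. hprod E (r q) v v = 0)"
    using CH_null by blast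
  have B: "\<exists>U\<in>{-Us..<0}. q = (tS U, U)" if "q \<in> B" for q
    using that by (auto simp: B_def sing_curve_open)
  show "\<forall>q\<in>B. cn_mu E Rs mu differentiable (at q) \<and> dX (cn_mu E Rs mu) q \<noteq> 0 \<and>
            Qvec E Rs mu q \<in> tangent_vectors B q"
    unfolding B_def[symmetric]
    using cn_mu_differentiable singular_curve_point(2) singular_curve_tangents(1) B
    unfolding B_def by blast
  show "\<forall>q\<in>B. 0 < fst (Qvec E Rs mu q) \<and> snd (Qvec E Rs mu q) < 0 \<and>
            Qvec E Rs mu q \<notin> tangent_vectors {q'. snd q' = snd q} q"
    using singular_curve_tangents(2-4) B by blast
  show "\<forall>q\<in>B. pushforward x1 q (Qvec E Rs mu q) \<in> tangent_vectors (Y ` B) (Y q) \<and>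
            pushforward x1 q (Qvec E Rs mu q) = L_rect E (r (Y q))"
  proof
    fix q assume "q \<in> B"
    then obtain U where U: "U \<in> {-Us..<0}" "q = (tS U, U)" using B by blast
    show "pushforward x1 q (Qvec E Rs mu q) \<in> tangent_vectors (Y ` B) (Y q) \<and>
            pushforward x1 q (Qvec E Rs mu q) = L_rect E (r (Y q))"
      using singular_curve_tangents(5)[OF U] singular_curve_point(6)[OF U] singular_curve_point(7)[OF U]
      unfolding B_def by (intro conjI) (simp_all only:)
  qed
  have tan: "v = fst v *\<^sub>R L_rect E (r q)" if "q \<in> Y ` B" "v \<in> tangent_vectors (Y ` B) q" for q v
    using singular_curve_tangents(6) B that unfolding B_def by blast
  show "\<forall>q\<in>Y ` closure M. hprod E (r q) (L_rect E (r q)) (L_rect E (r q)) = 0"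
    using hprod_L by blast
  show "\<forall>q\<in>Y ` B. \<forall>v\<in>tangent_vectors (Y ` B) q. hprod E (r q) (L_rect E (r q)) v = 0"
  proof (intro ballI)
    fix q v assume "q \<in> Y ` B" "v \<in> tangent_vectors (Y ` B) q"
    then have "v = fst v *\<^sub>R L_rect E (r q)" by (rule tan)
    then show "hprod E (r q) (L_rect E (r q)) v = 0"
      using hprod_L_scaled[of q 1 "fst v"] by simp
  qed
  show "\<forall>q\<in>Y ` B. (\<exists>v\<in>tangent_vectors (Y ` B) q. v \<noteq> 0) \<and>
            (\<forall>v\<in>tangent_vectors (Y ` B) q. hprod E (r q) v v = 0)"
  proof
    fix q assume q: "q \<in> Y ` B"
    then obtain z where z: "z \<in> B" "q = Y z" by blast
    then obtain U where U: "U \<in> {-Us..<0}" "z = (tS U, U)" using B by blast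
    have "pushforward x1 z (Qvec E Rs mu z) \<in> tangent_vectors (Y ` B) q"
      using singular_curve_tangents(5)[OF U] unfolding B_def z(2) .
    moreover have "pushforward x1 z (Qvec E Rs mu z) \<noteq> 0"
      unfolding singular_curve_point(6)[OF U] by (simp add: zero_prod_def)
    moreover have "hprod E (r q) v v = 0" if "v \<in> tangent_vectors (Y ` B) q" for v
      using tan[OF q that] hprod_L_scaled[of q "fst v" "fst v"] by simp
    ultimately show "(\<exists>v\<in>tangent_vectors (Y ` B) q. v \<noteq> 0) \<and>
            (\<forall>v\<in>tangent_vectors (Y ` B) q. hprod E (r q) v v = 0)" by blast
  qed
  show "\<exists>\<sigma>. (\<forall>q\<in>B. integral_curve (\<lambda>y. L_rect E (r y)) (\<sigma> q) {0..fst q} \<and>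
               \<sigma> q ` {0..fst q} \<subseteq> Y ` closure M \<and> \<sigma> q (fst q) = Y q) \<and>
            (\<forall>q\<in>B. \<forall>q'\<in>B. q \<noteq> q' \<longrightarrow> \<sigma> q ` {0..fst q} \<inter> \<sigma> q' ` {0..fst q'} = {})"
    using null_foliation unfolding B_def by (simp only: closure_M)
qed

end

theorem theorem3p1:
  fixes E :: eos and \<phi> R0 :: "real \<Rightarrow> real" and U1 U2 \<delta> b p T :: real
  assumes eos: "equation_of_state E"
    and nondeg: "nondegenerate E"
    and seed: "admissible_seed \<phi> U1 U2 \<delta> b p"
    and small: "amplitude_small E \<phi> U1 U2"
    and R0: "R0 = initial_data E \<phi>"
    and T: "T = 1 / \<delta>"
  shows "\<exists>Us C1 C2. 0 < Us \<and> Us < 1 \<and> 0 < C1 \<and> C1 \<le> C2 \<and>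
    (\<exists>R x1 \<mu>. geometric_solution E R0 R x1 \<mu>) \<and>
    (\<forall>R x1 \<mu>. geometric_solution E R0 R x1 \<mu> \<longrightarrow>
      (\<comment> \<open>A1\<close>
       smooth_on UNIV R0 \<and> (\<forall>t U. R (t, U) = R0 U)) \<and>
      (\<comment> \<open>A2\<close>
       smooth_on UNIV R \<and> smooth_on UNIV \<mu> \<and> smooth_on UNIV x1 \<and>
       smooth_on UNIV (\<lambda>q. L_rect E (R q)) \<and>
       smooth_on UNIV (\<lambda>q. \<mu> q *\<^sub>R Lb_rect E (R q)) \<and>
       smooth_on UNIV (\<lambda>q. \<mu> q *\<^sub>R X_rect E (R q)) \<and>
       (\<forall>q. Upsilon x1 differentiable (at q) \<and>
            pushforward x1 q (L_geo q) = L_rect E (R q) \<and>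
            pushforward x1 q (X_geo q) = \<mu> q *\<^sub>R X_rect E (R q) \<and>
            pushforward x1 q (Lb_geo \<mu> q) = \<mu> q *\<^sub>R Lb_rect E (R q))) \<and>
      (\<comment> \<open>A3\<close>
       \<forall>t U. U \<notin> {-U1..U2} \<longrightarrow>
         R (t, U) = 0 \<and> dL x1 (t, U) = sound E (Hbar E) \<and>
         dLb \<mu> x1 (t, U) / \<mu> (t, U) = - sound E (Hbar E) \<and>
         \<mu> (t, U) = 1 / sound E (Hbar E) \<and> 0 < sound E (Hbar E)) \<and>
      (\<comment> \<open>A4\<close>
       \<forall>t. \<forall>U\<in>{-Us..Us}. Opos C1 C2 (- dL \<mu> (t, U)) \<delta>) \<and>
      (\<exists>\<gamma>. let tS = t_sing E R0;
               tCH = (\<lambda>U. fst (\<gamma> U));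
               M = M_star tS tCH Us;
               Y = Upsilon x1;
               Yinv = the_inv_into (closure M) Y;
               r = R \<circ> Yinv;
               B0 = sing_curve \<mu> {-Us..0};
               B = sing_curve \<mu> {-Us..<0};
               CH = \<gamma> ` {0..Us}
        in
        (\<comment> \<open>A4 on the closure\<close>
         \<forall>q\<in>closure M. Opos C1 C2 (- dL \<mu> q) \<delta>) \<and>
        (\<comment> \<open>B1\<close>
         closure M = M \<union> B0 \<and> M \<inter> B0 = {}) \<and>
        (\<comment> \<open>B2\<close>
         crease \<mu> Us = {(T, 0)}) \<and>
        (\<comment> \<open>B3\<close>
         \<forall>U\<in>{-Us..0}.
           (\<exists>d. (tS has_real_derivative d) (at U) \<and> Opos C1 C2 d U) \<and>
           Opos C1 C2 (tS U - T) (U\<^sup>2)) \<and>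
        (\<comment> \<open>B4\<close>
         \<forall>U\<in>{-Us..0}.
           \<exists>d. ((\<lambda>u. x1 (tS u, u)) has_real_derivative d) (at U) \<and> Opos C1 C2 d U) \<and>
        (\<comment> \<open>B5\<close>
         CH_curve \<mu> T Us \<gamma> \<and>
         (\<forall>\<gamma>'. CH_curve \<mu> T Us \<gamma>' \<longrightarrow> (\<forall>U\<in>{0..Us}. \<gamma>' U = \<gamma> U)) \<and>
         (\<forall>U\<in>{0..Us}. \<gamma> U = (tCH U, U)) \<and>
         CH = {(tCH U, U) | U. U \<in> {0..Us}} \<and>
         (\<forall>U\<in>{0..Us}.
            (\<exists>d. (tCH has_real_derivative d) (at U within {0..Us}) \<and> Opos C1 C2 d (U\<^sup>2)) \<and>
            Opos C1 C2 (tCH U - T) (U ^ 3))) \<and>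
        (\<comment> \<open>B6\<close>
         \<forall>U\<in>{0..Us}. Opos C1 C2 (\<mu> (tCH U, U)) (U\<^sup>2)) \<and>
        (\<comment> \<open>B7\<close>
         \<forall>U\<in>{0..Us}.
           \<exists>d. ((\<lambda>u. x1 (tCH u, u)) has_real_derivative d) (at U within {0..Us}) \<and>
               Opos C1 C2 (- d) (U\<^sup>2)) \<and>
        (\<comment> \<open>B8\<close>
         (\<forall>q\<in>M. 0 < \<mu> q) \<and> (\<forall>q\<in>B0. \<mu> q = 0) \<and>
         (\<forall>q\<in>\<gamma> ` {0<..Us}. 0 < \<mu> q) \<and>
         (\<forall>q\<in>crease \<mu> Us. \<mu> q = 0) \<and> crease \<mu> Us \<subseteq> CH) \<and>
        (\<comment> \<open>C1\<close>
         diffeomorphism M (Y ` M) Y Yinv \<and>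
         homeomorphism (closure M) (Y ` closure M) Y Yinv) \<and>
        (\<comment> \<open>C2, together with the role of the second geometric coordinate and of the density\<close>
         classical_solution E (Y ` M) R0 r \<and>
         eikonal_function E (Y ` M) r (snd \<circ> Yinv) \<and>
         (\<forall>q\<in>Y ` M. \<mu> (Yinv q) =
             - inverse (csnd E (r q) / nfac E (r q) * px (Y ` M) (snd \<circ> Yinv) q))) \<and>
        (\<comment> \<open>C3\<close>
         (\<forall>q\<in>Y ` M.
            \<bar>px (Y ` M) r q\<bar> =
              1 / \<mu> (Yinv q) * \<bar>nfac E (r q) / csnd E (r q) * dX R (Yinv q)\<bar> \<and>
            Opos C1 C2 \<bar>px (Y ` M) r q\<bar> (1 / \<mu> (Yinv q))) \<and>
         (\<forall>q\<in>Y ` B0. \<forall>s::nat \<Rightarrow> real \<times> real. (\<forall>m. s m \<in> Y ` M) \<and> s \<longlonglongrightarrow> q \<longrightarrow>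
            filterlim (\<lambda>m. \<bar>px (Y ` M) r (s m)\<bar>) at_top sequentially)) \<and>
        (\<comment> \<open>C4\<close>
         continuous_on (Y ` closure M) r \<and>
         (\<forall>m::nat. continuous_on (Y ` closure M) ((dL ^^ m) R \<circ> Yinv) \<and>
            (\<forall>q\<in>Y ` M. (L_op E (Y ` M) r ^^ m) r q = ((dL ^^ m) R \<circ> Yinv) q)) \<and>
         continuous_on (Y ` closure M) (\<lambda>q. hmat E (r q)) \<and>
         (\<forall>q\<in>Y ` closure M. invertible (hmat E (r q)) \<and> lorentzian (hmat E (r q)))) \<and>
        (\<comment> \<open>D, in geometric coordinates and for the image curve\<close>
         (\<forall>U\<in>{0..Us}. \<exists>w. (\<gamma> has_vector_derivative w) (at U within {0..Us}) \<and> w \<noteq> 0 \<and>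
            hprod E (R (\<gamma> U)) (pushforward x1 (\<gamma> U) w) (pushforward x1 (\<gamma> U) w) = 0) \<and>
         (\<forall>q\<in>Y ` CH.
            Lb_rect E (r q) \<in> tangent_vectors (Y ` CH) q \<and>
            (\<forall>v\<in>tangent_vectors (Y ` CH) q. hprod E (r q) v v = 0))) \<and>
        (\<comment> \<open>E1\<close>
         \<forall>q\<in>B. cn_mu E R \<mu> differentiable (at q) \<and> dX (cn_mu E R \<mu>) q \<noteq> 0 \<and>
           Qvec E R \<mu> q \<in> tangent_vectors B q) \<and>
        (\<comment> \<open>E2: the components of Q are Qt and QU\<close>
         \<forall>q\<in>B. 0 < fst (Qvec E R \<mu> q) \<and> snd (Qvec E R \<mu> q) < 0 \<and>
           Qvec E R \<mu> q \<notin> tangent_vectors {q'. snd q' = snd q} q) \<and>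
        (\<comment> \<open>E3\<close>
         \<forall>q\<in>B. pushforward x1 q (Qvec E R \<mu> q) \<in> tangent_vectors (Y ` B) (Y q) \<and>
           pushforward x1 q (Qvec E R \<mu> q) = L_rect E (r (Y q))) \<and>
        (\<comment> \<open>E4\<close>
         (\<forall>q\<in>Y ` B. \<forall>v\<in>tangent_vectors (Y ` B) q. hprod E (r q) (L_rect E (r q)) v = 0) \<and>
         (\<forall>q\<in>Y ` closure M. hprod E (r q) (L_rect E (r q)) (L_rect E (r q)) = 0) \<and>
         (\<exists>\<sigma>. (\<forall>q\<in>B. integral_curve (\<lambda>y. L_rect E (r y)) (\<sigma> q) {0..fst q} \<and>
                    \<sigma> q ` {0..fst q} \<subseteq> Y ` closure M \<and> \<sigma> q (fst q) = Y q) \<and>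
              (\<forall>q\<in>B. \<forall>q'\<in>B. q \<noteq> q' \<longrightarrow>
                    \<sigma> q ` {0..fst q} \<inter> \<sigma> q' ` {0..fst q'} = {})) \<and>
         (\<forall>q\<in>Y ` B. (\<exists>v\<in>tangent_vectors (Y ` B) q. v \<noteq> 0) \<and>
            (\<forall>v\<in>tangent_vectors (Y ` B) q. hprod E (r q) v v = 0)))))"
proof -
  interpret simple_wave E \<phi> U1 U2 \<delta> b p
    using eos nondeg seed small by unfold_locales
  obtain Us where Us: "0 < Us" "Us < 1" "\<forall>U\<in>{-Us..Us}. deriv \<phi> U < 0"
    "\<forall>U\<in>{-Us..Us}. 0 < tCH U"
    using fold_region_exists by blast
  interpret W: simple_wave_region E \<phi> U1 U2 \<delta> b p Us
    using Us by unfold_locales auto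
  obtain K where K: "W.uniform_bounds K" using W.uniform_bounds_exist by blast
  then have "1 \<le> K" by (simp add: W.uniform_bounds_def)
  then have K1: "0 < 1 / K" "1 / K \<le> K"
    using order_trans[of "1 / K" 1 K] by simp_all
  have T': "T = fold_profile.T \<delta>" by (simp add: T T_def)
  have eqs: "t_sing E (initial_data E \<phi>) = tS" "fst (W.gam U) = tCH U" for U
    by (rule W.tS_eq_t_sing W.fst_gam)+
  show ?thesis
    unfolding T' R0 Let_def
    by (rule exI[of _ Us], rule exI[of _ "1 / K"], rule exI[of _ K],
        (intro conjI W.geometric_solution_all exI[of _ W.gam]; (unfold eqs)?;
          fact Us K1 W.solution_exists W.classical_existence W.smooth_on_geometric W.region_boundary W.cauchy_horizon
            W.crease_eq W.curve_estimates[OF K] W.diffeomorphism_Y W.rectangular_picture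
            W.classical_solution_r W.eikonal_function_U W.gradient_estimates[OF K] W.causal_structure))
qed

end
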